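(* Let $k\in\mathbb{N}^*$ and let $f:\mathbb{R}\to\mathbb{R}$ be a normalized stationary centered Gaussian process of class $\mathcal{C}^k$. Let $y=(y_i)_{1\le i\le k}\in\mathbb{R}^k$ and let $\mathcal{I}$ be the partition of $\{1,\dots,k\}$ defined by: for all $i,j\in\{1,\dots,k\}$, $y_i=y_j$ if and only if there exists $I\in\mathcal{I}$ with $\{i,j\}\subset I$. For $I\in\mathcal{I}$, let $|I|$ be the cardinality of $I$ and let $y_I\in\mathbb{R}$ be the common value of the $(y_i)_{i\in I}$. Assume that the Gaussian vector $\left(f^{(i)}(y_I)\right)_{I\in\mathcal{I},\,0\le i<|I|}$ is non-degenerate and set $$\ell(y)=\left(\prod_{I\in\mathcal{I}}\prod_{i=0}^{|I|-1}\frac{i!}{|I|!}\right)\frac{\mathbb{E}\left[\prod_{I\in\mathcal{I}}\left|f^{(|I|)}(y_I)\right|^{|I|}\ \Big|\ \forall I\in\mathcal{I},\ \forall i\in\{0,\dots,|I|-1\},\ f^{(i)}(y_I)=0\right]}{(2\pi)^{k/2}\det\left(\operatorname{Var}\left(\left(f^{(i)}(y_I)\right)_{I\in\mathcal{I},0\le i<|I|}\right)\right)^{1/2}}.$$ Then there exists a neighborhood $U$ of $y$ in $\mathbb{R}^k$ such that the $k$-point function $\rho_k$ of $f^{-1}(0)$ is well-defined on $U\setminus\Delta_k$ and, as $x\to y$ with $x=(x_i)_{1\le i\le k}\in U\setminus\Delta_k$, $$\left(\prod_{I\in\mathcal{I}}\ \prod_{\{(i,j)\in I^2\mid i<j\}}\frac{1}{|x_i-x_j|}\right)\rho_k(x)\longrightarrow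 \ell(y).$$ Moreover, if $\left(f^{(i)}(y_I)\right)_{I\in\mathcal{I},\,0\le i\le|I|}$ is non-degenerate, then $\ell(y)>0$.
   Context: A process is of class $\mathcal{C}^k$ if its trajectories are almost surely $\mathcal{C}^k$. The correlation function is $\kappa(x)=\mathbb{E}[f(0)f(x)]$; a stationary centered Gaussian process of class at least $\mathcal{C}^1$ is normalized if $\kappa(0)=1=-\kappa''(0)$. A Gaussian vector is non-degenerate if its variance (covariance) matrix is invertible. The conditional expectation given that a non-degenerate Gaussian vector vanishes is taken with respect to the usual Gaussian conditional distribution: if $(U,V)$ is centered Gaussian with block variance $\begin{pmatrix} A & B^{T} \\ B & C \end{pmatrix}$ and $A$ invertible, then $V$ given $U=0$ is $\mathcal{N}(0,C-BA^{-1}B^{T})$. $\Delta_k=\{(x_1,\dots,x_k)\in\mathbb{R}^k\mid \exists i\ne j,\ x_i=x_j\}$. The $k$-point function of the random closed discrete set $Z=f^{-1}(0)$ at $x\in\mathbb{R}^k\setminus\Delta_k$ is $$\rho_k(x)=\lim_{\epsilon\to0}\frac{1}{(2\epsilon)^k}\mathbb{E}\left[\prod_{i=1}^k\operatorname{Card}\left(Z\cap[x_i-\epsilon,x_i+\epsilon]\right)\right],$$ when this limit is well-defined. *)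

theory Defs
  imports
    "HOL-Probability.Probability"
    "Jordan_Normal_Form.Determinant"
    "Jordan_Normal_Form.Gauss_Jordan_Elimination"
begin

text \<open>In this theory \<open>x $ i\<close> is a coordinate of a vector of type \<open>real ^ 'n\<close>; entries of
  matrices of varying size are those of \<open>Jordan_Normal_Form\<close>.\<close>

no_notation Matrix.vec_index (infixl \<open>$\<close> 100)

subsection \<open>Gaussian vectors\<close>

text \<open>The law \<open>N(m, s^2)\<close> on the line; a Dirac mass when \<open>s = 0\<close>.\<close>

definition normal_law :: "real \<Rightarrow> real \<Rightarrow> real measure" where
  "normal_law m s = (if s = 0 then return borel m
     else density lborel (\<lambda>x. ennreal (normal_density m s x)))"

text \<open>A finite family of real random variables is a (possibly degenerate) Gaussian vector if all
  its linear combinations are Gaussian.\<close>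

definition gaussian_vector :: "'w measure \<Rightarrow> 'j set \<Rightarrow> ('j \<Rightarrow> 'w \<Rightarrow> real) \<Rightarrow> bool" where
  "gaussian_vector M J X \<longleftrightarrow> finite J \<and> (\<forall>j\<in>J. X j \<in> borel_measurable M) \<and>
     (\<forall>c :: 'j \<Rightarrow> real. \<exists>m s. s \<ge> 0 \<and>
        distr M borel (\<lambda>w. \<Sum>j\<in>J. c j * X j w) = normal_law m s)"

text \<open>Expectations of the derivatives of a process are taken in the completion of the underlying
  space: the derivatives are determined only almost surely, and on the exceptional null
  set the values of \<^const>\<open>deriv\<close> are arbitrary, so that they are measurable for the completion
  only. For \<open>M\<close>-measurable variables the completion makes no difference.\<close>

definition rv_mean :: "'w measure \<Rightarrow> ('w \<Rightarrow> real) \<Rightarrow> real" where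
  "rv_mean M X = (\<integral>w. X w \<partial>completion M)"

definition rv_cov :: "'w measure \<Rightarrow> ('w \<Rightarrow> real) \<Rightarrow> ('w \<Rightarrow> real) \<Rightarrow> real" where
  "rv_cov M X Y = rv_mean M (\<lambda>w. (X w - rv_mean M X) * (Y w - rv_mean M Y))"

definition cov_mat :: "'w measure \<Rightarrow> ('w \<Rightarrow> real) list \<Rightarrow> ('w \<Rightarrow> real) list \<Rightarrow> real Matrix.mat" where
  "cov_mat M Xs Ys = Matrix.mat (length Xs) (length Ys) (\<lambda>(a, b). rv_cov M (Xs ! a) (Ys ! b))"

definition var_mat :: "'w measure \<Rightarrow> ('w \<Rightarrow> real) list \<Rightarrow> real Matrix.mat" where
  "var_mat M Xs = cov_mat M Xs Xs"

definition nondegenerate :: "'w measure \<Rightarrow> ('w \<Rightarrow> real) list \<Rightarrow> bool" where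
  "nondegenerate M Xs \<longleftrightarrow> invertible_mat (var_mat M Xs)"

text \<open>\<open>N(0, S)\<close>, as a measure on the functions on \<open>{..<n}\<close> where \<open>S\<close> is an \<open>n \<times> n\<close> matrix: the
  unique law under which the coordinates form a centered Gaussian vector with variance \<open>S\<close>.\<close>

definition centered_gaussian_law :: "real Matrix.mat \<Rightarrow> (nat \<Rightarrow> real) measure" where
  "centered_gaussian_law S = (THE N.
     sets N = sets (\<Pi>\<^sub>M a\<in>{..<dim_row S}. (borel :: real measure)) \<and> prob_space N \<and>
     gaussian_vector N {..<dim_row S} (\<lambda>a v. v a) \<and>
     (\<forall>a<dim_row S. rv_mean N (\<lambda>v. v a) = 0) \<and>
     var_mat N (map (\<lambda>a v. v a) [0..<dim_row S]) = S)"

text \<open>\<open>E[h(V) | U = 0]\<close> for a centered Gaussian vector \<open>(U, V)\<close> with \<open>U\<close> non-degenerate.\<close>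

definition gaussian_cond_expectation ::
  "'w measure \<Rightarrow> ('w \<Rightarrow> real) list \<Rightarrow> ('w \<Rightarrow> real) list \<Rightarrow> ((nat \<Rightarrow> real) \<Rightarrow> real) \<Rightarrow> real" where
  "gaussian_cond_expectation M Us Vs h =
     (let A = var_mat M Us; B = cov_mat M Vs Us; C = var_mat M Vs
      in \<integral>v. h v \<partial>centered_gaussian_law (C - B * the (mat_inverse A) * transpose_mat B))"

subsection \<open>Gaussian processes on the line\<close>

definition gaussian_process :: "'w measure \<Rightarrow> (real \<Rightarrow> 'w \<Rightarrow> real) \<Rightarrow> bool" where
  "gaussian_process M f \<longleftrightarrow> (\<forall>J. finite J \<longrightarrow> gaussian_vector M J f)"

definition centered_process :: "'w measure \<Rightarrow> (real \<Rightarrow> 'w \<Rightarrow> real) \<Rightarrow> bool" where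
  "centered_process M f \<longleftrightarrow> (\<forall>t. (\<integral>w. f t w \<partial>M) = 0)"

definition stationary_process :: "'w measure \<Rightarrow> (real \<Rightarrow> 'w \<Rightarrow> real) \<Rightarrow> bool" where
  "stationary_process M f \<longleftrightarrow> (\<forall>h.
     distr M (\<Pi>\<^sub>M t\<in>UNIV. (borel :: real measure)) (\<lambda>w t. f (t + h) w) =
     distr M (\<Pi>\<^sub>M t\<in>UNIV. (borel :: real measure)) (\<lambda>w t. f t w))"

definition class_C :: "nat \<Rightarrow> (real \<Rightarrow> real) \<Rightarrow> bool" where
  "class_C k g \<longleftrightarrow> (\<forall>i<k. \<forall>t. (deriv ^^ i) g field_differentiable at t) \<and>
     continuous_on UNIV ((deriv ^^ k) g)"

definition process_of_class :: "'w measure \<Rightarrow> nat \<Rightarrow> (real \<Rightarrow> 'w \<Rightarrow> real) \<Rightarrow> bool" where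
  "process_of_class M k f \<longleftrightarrow> (AE w in M. class_C k (\<lambda>t. f t w))"

definition correlation :: "'w measure \<Rightarrow> (real \<Rightarrow> 'w \<Rightarrow> real) \<Rightarrow> real \<Rightarrow> real" where
  "correlation M f x = (\<integral>w. f 0 w * f x w \<partial>M)"

definition normalized_process :: "'w measure \<Rightarrow> (real \<Rightarrow> 'w \<Rightarrow> real) \<Rightarrow> bool" where
  "normalized_process M f \<longleftrightarrow>
     correlation M f 0 = 1 \<and> (deriv ^^ 2) (correlation M f) 0 = - 1"

definition process_deriv :: "(real \<Rightarrow> 'w \<Rightarrow> real) \<Rightarrow> nat \<Rightarrow> real \<Rightarrow> 'w \<Rightarrow> real" where
  "process_deriv f i t w = (deriv ^^ i) (\<lambda>s. f s w) t"

subsection \<open>The \<open>k\<close>-point function of the zero set\<close>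

text \<open>\<open>\<real>\<^sup>k\<close> is \<open>real ^ 'n\<close> with \<open>k = CARD('n)\<close>; the linear order of \<open>'n\<close> is that of \<open>{1, ..., k}\<close>.\<close>

definition large_diagonal :: "(real ^ 'n) set" where
  "large_diagonal = {x. \<exists>i j. i \<noteq> j \<and> x $ i = x $ j}"

text \<open>Cardinals and expectations take values in \<open>[0, \<infinity>]\<close> (\<^const>\<open>card\<close> would be \<open>0\<close> on infinite sets).\<close>

definition zero_count :: "(real \<Rightarrow> 'w \<Rightarrow> real) \<Rightarrow> real set \<Rightarrow> 'w \<Rightarrow> ennreal" where
  "zero_count f A w = emeasure (count_space UNIV) ({t. f t w = 0} \<inter> A)"

definition kpoint_quotient ::
  "'w measure \<Rightarrow> (real \<Rightarrow> 'w \<Rightarrow> real) \<Rightarrow> real ^ 'n \<Rightarrow> real \<Rightarrow> ennreal" where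
  "kpoint_quotient M f x e =
     (\<integral>\<^sup>+w. (\<Prod>i\<in>UNIV. zero_count f {x $ i - e .. x $ i + e} w) \<partial>M) / ennreal ((2 * e) ^ CARD('n))"

text \<open>Well-defined: the limit exists and is finite.\<close>

definition kpoint_defined :: "'w measure \<Rightarrow> (real \<Rightarrow> 'w \<Rightarrow> real) \<Rightarrow> real ^ 'n \<Rightarrow> bool" where
  "kpoint_defined M f x \<longleftrightarrow> (\<exists>r\<ge>0. (kpoint_quotient M f x \<longlongrightarrow> ennreal r) (at_right 0))"

definition kpoint_function :: "'w measure \<Rightarrow> (real \<Rightarrow> 'w \<Rightarrow> real) \<Rightarrow> real ^ 'n \<Rightarrow> real" where
  "kpoint_function M f x = enn2real (Lim (at_right 0) (kpoint_quotient M f x))"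

subsection \<open>The partition associated with a point and the limit constant\<close>

definition blocks :: "real ^ 'n \<Rightarrow> 'n set set" where
  "blocks y = UNIV // {(i, j). y $ i = y $ j}"

definition block_value :: "real ^ 'n \<Rightarrow> 'n set \<Rightarrow> real" where
  "block_value y I = (THE v. \<forall>i\<in>I. y $ i = v)"

text \<open>The blocks in increasing order of \<open>y\<^sub>I\<close>; see \<open>set_block_list\<close> below.\<close>

definition block_list :: "real ^ 'n \<Rightarrow> 'n set list" where
  "block_list y = map (\<lambda>v. {i. y $ i = v}) (sorted_list_of_set (range (($) y)))"

text \<open>The family of the \<open>f\<^sup>(\<^sup>i\<^sup>)(y\<^sub>I)\<close> for \<open>I\<close> a block and \<open>i < d I\<close>.\<close>

definition jet ::
  "(real \<Rightarrow> 'w \<Rightarrow> real) \<Rightarrow> real ^ 'n \<Rightarrow> ('n set \<Rightarrow> nat) \<Rightarrow> ('w \<Rightarrow> real) list" where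
  "jet f y d = concat (map (\<lambda>I. map (\<lambda>i. process_deriv f i (block_value y I)) [0..<d I])
     (block_list y))"

definition ell :: "'w measure \<Rightarrow> (real \<Rightarrow> 'w \<Rightarrow> real) \<Rightarrow> real ^ 'n \<Rightarrow> real" where
  "ell M f y =
     (\<Prod>I\<in>blocks y. \<Prod>i<card I. fact i / fact (card I)) *
     (gaussian_cond_expectation M (jet f y card)
        (map (\<lambda>I. process_deriv f (card I) (block_value y I)) (block_list y))
        (\<lambda>v. \<Prod>a<length (block_list y). \<bar>v a\<bar> ^ card (block_list y ! a)) /
      ((2 * pi) powr (real CARD('n) / 2) * sqrt (Determinant.det (var_mat M (jet f y card)))))"

lemma blocks_eq: "blocks (y :: real ^ 'n) = (\<lambda>v. {i. y $ i = v}) ` range (($) y)"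
proof -
  have "{j. y $ i = y $ j} = {j. y $ j = y $ i}" for i by auto
  then show ?thesis by (auto simp: blocks_def quotient_def)
qed

lemma block_value_eq: "block_value y {i. y $ i = y $ j} = y $ j"
  unfolding block_value_def by (rule the_equality) auto

lemma set_block_list [simp]: "set (block_list (y :: real ^ 'n)) = blocks y"
  by (simp add: block_list_def blocks_eq)

lemma distinct_block_list [simp]: "distinct (block_list (y :: real ^ 'n))"
  by (auto simp: block_list_def distinct_map inj_on_def)

end

theory Submission
  imports Defs
begin

text \<open>
  Counting sign changes of \<open>f\<close> on finer and finer grids instead of zeros (almost surely there are no
  double zeros, by Bulinskaya's lemma) reduces everything to finite Gaussian vectors. The sign
  changes of \<open>f\<close> between \<open>c\<^sub>i - h\<close> and \<open>c\<^sub>i + h\<close> for all \<open>i\<close> are the event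
  \<open>\<bar>S\<^sub>i\<bar> < h \<bar>D\<^sub>i\<bar>\<close>, where \<open>S\<^sub>i\<close> is the mean and \<open>D\<^sub>i\<close> the difference quotient of the two values. Its
  probability divided by \<open>(2 h)\<^sup>k\<close> converges, as \<open>c \<rightarrow> x\<close> and \<open>h \<rightarrow> 0\<close>, to the Kac--Rice density
  \<open>E[\<Prod>\<^sub>i \<bar>f'(x\<^sub>i)\<bar> | f(x) = 0] / ((2 \<pi>)\<^sup>k det Var f(x))\<^sup>1\<^sup>/\<^sup>2\<close>: decompose \<open>D\<close> along an orthonormal frame
  of \<open>S\<close> and an independent residual, and use dominated convergence. This gives \<open>\<rho>\<^sub>k(x)\<close>. When
  \<open>x \<rightarrow> y\<close>, the values \<open>f(x\<^sub>i)\<close> are replaced by divided differences over each block, which converge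
  to the jets of \<open>f\<close> at \<open>y\<close>; on \<open>f(x) = 0\<close> the derivative \<open>f'(x\<^sub>i)\<close> is the product of the differences
  \<open>x\<^sub>i - x\<^sub>j\<close> over the block of \<open>i\<close> and a divided difference of order \<open>|I|\<close>. The triangular change
  of variables contributes one inverse Vandermonde product and the derivatives two, which leaves
  the factor \<open>\<Prod> \<bar>x\<^sub>i - x\<^sub>j\<bar>\<close>.
\<close>

section \<open>Gaussian random variables\<close>

text \<open>The moments of the zero counts are not known to be finite beforehand, so the count is
  bounded from two sides: a sign change forces a zero, and Fatou's lemma on refined grids bounds the
  count from above. The second bound meets small cells of all widths centred near the
  \<open>x i\<close>, which is why crossings are controlled for centres tending to \<open>x\<close>
  rather than at \<open>x\<close> itself. Limits of Gaussian quantities are taken along sequences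
  and pointwise in \<open>w\<close>: for centered Gaussian variables pointwise convergence already
  forces convergence of covariances, so no uniform integrability has to be established. Orthonormal
  frames are kept lower triangular because divided differences are; Jacobians are then products of
  diagonal entries, and the diagonal product of a frame is the inverse square root of the
  determinant up to sign. The factors \<open>i! / |I|!\<close> of the constant come from divided
  differences: one of order \<open>i\<close> approximates the derivative of order \<open>i\<close>
  divided by \<open>i!\<close>. The change of variables produces the numerators, and the
  \<open>|I|\<close> slopes of each block produce one denominator \<open>|I|!\<close> each.\<close>

lemma normal_law_eq_distr:
  assumes "s \<ge> 0"
  shows "normal_law m s = distr std_normal_distribution borel (\<lambda>x. m + s * x)"
proof -
  interpret N: prob_space std_normal_distribution
    using prob_space_normal_density[of 1 0] by simp
  show ?thesis
  proof (cases "s = 0")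
    case True
    then show ?thesis
      using N.distr_const[of m borel] by (simp add: normal_law_def)
  next
    case False
    with assms have s: "s > 0" by simp
    have "distributed std_normal_distribution lborel (\<lambda>x. x) std_normal_density"
      by (auto simp: distributed_def distr_id2)
    from N.normal_density_affine[OF this, of s m] s
    have "distributed std_normal_distribution lborel (\<lambda>x. m + s * x) (normal_density m s)"
      by simp
    then have "distr std_normal_distribution lborel (\<lambda>x. m + s * x) = density lborel (normal_density m s)"
      by (simp add: distributed_def)
    moreover have "distr std_normal_distribution lborel (\<lambda>x. m + s * x) = distr std_normal_distribution borel (\<lambda>x. m + s * x)"
      by (rule distr_cong) auto
    ultimately show ?thesis using s by (simp add: normal_law_def)
  qed
qed

definition centered_gaussian :: "'w measure \<Rightarrow> ('w \<Rightarrow> real) \<Rightarrow> bool" where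
  "centered_gaussian M X \<longleftrightarrow> X \<in> borel_measurable M \<and> (\<exists>s\<ge>0. distr M borel X = normal_law 0 s)"

text \<open>For centered variables this is the covariance; it serves as the scalar product of
  Gram--Schmidt.\<close>

definition inner_rv :: "'w measure \<Rightarrow> ('w \<Rightarrow> real) \<Rightarrow> ('w \<Rightarrow> real) \<Rightarrow> real" where
  "inner_rv M X Y = (\<integral>w. X w * Y w \<partial>M)"

lemma inner_rv_commute: "inner_rv M X Y = inner_rv M Y X"
  by (simp add: inner_rv_def mult.commute)

lemma centered_gaussian_measurable [measurable_dest]:
  "centered_gaussian M X \<Longrightarrow> X \<in> borel_measurable M"
  by (simp add: centered_gaussian_def)

lemma centered_gaussianE:
  assumes "centered_gaussian M X"
  obtains s where "s \<ge> 0" "distr M borel X = distr std_normal_distribution borel (\<lambda>x. s * x)"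
    "inner_rv M X X = s\<^sup>2"
proof -
  from assms obtain s where X: "X \<in> borel_measurable M" and s: "s \<ge> 0"
    and d: "distr M borel X = distr std_normal_distribution borel (\<lambda>x. s * x)"
    using normal_law_eq_distr[of _ 0] by (auto simp: centered_gaussian_def)
  have "inner_rv M X X = (\<integral>x. x * x \<partial>distr M borel X)"
    unfolding inner_rv_def using X by (subst integral_distr) auto
  also have "\<dots> = (\<integral>x. s\<^sup>2 * x ^ (2 * 1) \<partial>std_normal_distribution)"
    unfolding d by (subst integral_distr) (auto simp: power2_eq_square ac_simps)
  also have "\<dots> = s\<^sup>2"
    using std_normal_distribution_even_moments(1)[of 1] by simp
  finally show ?thesis using that s d by blast
qed

lemma centered_gaussian_integrable_power:
  assumes "centered_gaussian M X"
  shows "integrable M (\<lambda>w. X w ^ n)"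
proof -
  have [measurable]: "X \<in> borel_measurable M" using assms by (rule centered_gaussian_measurable)
  obtain s where d: "distr M borel X = distr std_normal_distribution borel (\<lambda>x. s * x)"
    using centered_gaussianE[OF assms] by blast
  have "integrable (distr M borel X) (\<lambda>x. x ^ n)"
    unfolding d by (subst integrable_distr_eq)
      (auto simp: power_mult_distrib integrable_std_normal_distribution_moment)
  then show ?thesis by (subst (asm) integrable_distr_eq) auto
qed

lemma centered_gaussian_integrable_mult:
  assumes "centered_gaussian M X" "centered_gaussian M Y"
  shows "integrable M (\<lambda>w. X w * Y w)"
proof (rule Bochner_Integration.integrable_bound)
  show "integrable M (\<lambda>w. X w ^ 2 + Y w ^ 2)"
    using assms by (intro Bochner_Integration.integrable_add centered_gaussian_integrable_power)
  show "(\<lambda>w. X w * Y w) \<in> borel_measurable M"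
    using assms[THEN centered_gaussian_measurable] by simp
  have "\<bar>a * b\<bar> \<le> a\<^sup>2 + b\<^sup>2" for a b :: real
    using sum_squares_bound[of a b] sum_squares_bound[of a "-b"] by (auto simp: abs_le_iff)
  then show "AE w in M. norm (X w * Y w) \<le> norm (X w ^ 2 + Y w ^ 2)" by simp
qed

lemma centered_gaussian_mean:
  assumes "centered_gaussian M X"
  shows "(\<integral>w. X w \<partial>M) = 0"
proof -
  have [measurable]: "X \<in> borel_measurable M" using assms by (rule centered_gaussian_measurable)
  obtain s where d: "distr M borel X = distr std_normal_distribution borel (\<lambda>x. s * x)"
    using centered_gaussianE[OF assms] by blast
  have "(\<integral>w. X w \<partial>M) = (\<integral>x. x \<partial>distr M borel X)"
    by (subst integral_distr) auto
  also have "\<dots> = s * (\<integral>x. x ^ 1 \<partial>std_normal_distribution)"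
    unfolding d by (subst integral_distr) auto
  also have "\<dots> = 0" by (subst integral_std_normal_distribution_moment_odd) auto
  finally show ?thesis .
qed

lemma centered_gaussian_char:
  assumes "centered_gaussian M X"
  shows "(\<integral>w. iexp (t * X w) \<partial>M) = complex_of_real (exp (- t\<^sup>2 * inner_rv M X X / 2))"
proof -
  have [measurable]: "X \<in> borel_measurable M" using assms by (rule centered_gaussian_measurable)
  obtain s where d: "distr M borel X = distr std_normal_distribution borel (\<lambda>x. s * x)"
    and v: "inner_rv M X X = s\<^sup>2"
    using centered_gaussianE[OF assms] by blast
  have "(\<integral>w. iexp (t * X w) \<partial>M) = (\<integral>x. iexp (t * x) \<partial>distr M borel X)"
    by (subst integral_distr) auto
  also have "\<dots> = char std_normal_distribution (t * s)"
    unfolding d char_def by (subst integral_distr) (auto simp: mult.assoc)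
  also have "\<dots> = complex_of_real (exp (- t\<^sup>2 * inner_rv M X X / 2))"
    by (simp add: char_std_normal_distribution v power_mult_distrib)
  finally show ?thesis .
qed

text \<open>The characteristic function is that of \<open>sqrt v\<close> times a standard normal
  variable, so Levy's uniqueness theorem gives the law; comparison at \<open>t = 1\<close> then
  identifies the second moment with \<open>v\<close>.\<close>

lemma (in prob_space) centered_gaussianI:
  assumes X [measurable]: "X \<in> borel_measurable M" and v: "v \<ge> 0"
    and char: "\<And>t. (\<integral>w. iexp (t * X w) \<partial>M) = complex_of_real (exp (- t\<^sup>2 * v / 2))"
  shows "centered_gaussian M X" "inner_rv M X X = v"
proof -
  interpret N: real_distribution std_normal_distribution by (rule real_dist_normal_dist)
  have "char (distr M borel X) t = char (distr std_normal_distribution borel (\<lambda>x. sqrt v * x)) t" for t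
  proof -
    have "char (distr M borel X) t = complex_of_real (exp (- t\<^sup>2 * v / 2))"
      unfolding char_def char[symmetric] by (subst integral_distr) auto
    also have "\<dots> = char std_normal_distribution (t * sqrt v)"
      using v by (simp add: char_std_normal_distribution power_mult_distrib)
    also have "\<dots> = char (distr std_normal_distribution borel (\<lambda>x. sqrt v * x)) t"
      unfolding char_def by (subst integral_distr) (auto simp: mult.assoc)
    finally show ?thesis .
  qed
  then have "distr M borel X = distr std_normal_distribution borel (\<lambda>x. sqrt v * x)"
    by (intro Levy_uniqueness real_distribution_distr N.real_distribution_distr) auto
  then show g: "centered_gaussian M X"
    unfolding centered_gaussian_def using v normal_law_eq_distr[of "sqrt v" 0]
    by (auto intro!: exI[of _ "sqrt v"])
  have "exp (- 1\<^sup>2 * inner_rv M X X / 2) = exp (- 1\<^sup>2 * v / 2)"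
    using centered_gaussian_char[OF g, of 1] char[of 1] by (simp only: of_real_eq_iff)
  then show "inner_rv M X X = v" by simp
qed

text \<open>Characteristic functions converge by dominated convergence. The variance is a logarithm
  of the characteristic function, so it converges as well, and the limit function is again of
  Gaussian form. Variances thus pass to the limit without any domination of the
  \<open>X n\<close>.\<close>

lemma (in prob_space) centered_gaussian_limit:
  assumes g: "\<And>n :: nat. centered_gaussian M (X n)" and lim: "\<And>w. (\<lambda>n. X n w) \<longlonglongrightarrow> Y w"
  shows "centered_gaussian M Y" "(\<lambda>n. inner_rv M (X n) (X n)) \<longlonglongrightarrow> inner_rv M Y Y"
proof -
  have Xm [measurable]: "X n \<in> borel_measurable M" for n using g by (rule centered_gaussian_measurable)
  have Y [measurable]: "Y \<in> borel_measurable M"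
    by (rule borel_measurable_LIMSEQ_real[OF lim]) auto
  define v where "v n = inner_rv M (X n) (X n)" for n
  have v0: "v n \<ge> 0" for n unfolding v_def inner_rv_def by (intro Bochner_Integration.integral_nonneg) auto
  have char_lim: "(\<lambda>n. \<integral>w. iexp (t * X n w) \<partial>M) \<longlonglongrightarrow> (\<integral>w. iexp (t * Y w) \<partial>M)" for t
    by (rule integral_dominated_convergence[where w="\<lambda>_. 1"])
       (auto intro!: tendsto_intros lim)
  \<comment> \<open>The characteristic function of \<open>Y\<close> is continuous at 0 with value 1
    there, so its real part is positive at some \<open>t = 1 / (m + 1)\<close>; the logarithm is
    taken at this \<open>t\<close>.\<close>
  have seq0: "(\<lambda>n. 1 / real (Suc n)) \<longlonglongrightarrow> 0"
    using LIMSEQ_inverse_real_of_nat by (simp add: inverse_eq_divide)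
  have "(\<lambda>n. iexp (1 / real (Suc n) * y)) \<longlonglongrightarrow> iexp (0 * y)" for y
    by (intro tendsto_intros seq0)
  then have "(\<lambda>n. Re (\<integral>w. iexp (1 / real (Suc n) * Y w) \<partial>M)) \<longlonglongrightarrow> Re (\<integral>w. iexp (0 * Y w) \<partial>M)"
    by (intro tendsto_Re integral_dominated_convergence[where w="\<lambda>_. 1"] AE_I2) auto
  then have "(\<lambda>n. Re (\<integral>w. iexp (1 / real (Suc n) * Y w) \<partial>M)) \<longlonglongrightarrow> 1"
    using prob_space by simp
  then have "eventually (\<lambda>n. Re (\<integral>w. iexp (1 / real (Suc n) * Y w) \<partial>M) > 0) sequentially"
    by (rule order_tendstoD) simp
  then obtain m where m: "Re (\<integral>w. iexp (1 / real (Suc m) * Y w) \<partial>M) > 0"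
    by (auto simp: eventually_sequentially)
  define t where "t = 1 / real (Suc m)"
  have t: "t > 0" by (simp add: t_def)
  define c where "c = Re (\<integral>w. iexp (t * Y w) \<partial>M)"
  have c: "c > 0" using m by (simp add: c_def t_def)
  have vlim: "v \<longlonglongrightarrow> - 2 * ln c / t\<^sup>2"
  proof -
    have "(\<lambda>n. Re (\<integral>w. iexp (t * X n w) \<partial>M)) \<longlonglongrightarrow> c"
      unfolding c_def by (intro tendsto_Re char_lim)
    then have "(\<lambda>n. exp (- t\<^sup>2 * v n / 2)) \<longlonglongrightarrow> c"
      unfolding centered_gaussian_char[OF g] v_def by simp
    then have "(\<lambda>n. - 2 * ln (exp (- t\<^sup>2 * v n / 2)) / t\<^sup>2) \<longlonglongrightarrow> - 2 * ln c / t\<^sup>2"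
      using c t by (intro tendsto_intros) auto
    then show ?thesis using t by simp
  qed
  define V where "V = - 2 * ln c / t\<^sup>2"
  have V: "V \<ge> 0" using vlim v0 unfolding V_def[symmetric] by (intro LIMSEQ_le_const) auto
  have ch: "(\<integral>w. iexp (s * Y w) \<partial>M) = complex_of_real (exp (- s\<^sup>2 * V / 2))" for s
  proof (rule LIMSEQ_unique[OF char_lim])
    show "(\<lambda>n. \<integral>w. iexp (s * X n w) \<partial>M) \<longlonglongrightarrow> complex_of_real (exp (- s\<^sup>2 * V / 2))"
      unfolding centered_gaussian_char[OF g] v_def[symmetric] V_def
      by (intro tendsto_of_real tendsto_intros vlim) auto
  qed
  show "centered_gaussian M Y" by (rule centered_gaussianI(1)[OF Y V ch])
  have "inner_rv M Y Y = V" by (rule centered_gaussianI(2)[OF Y V ch])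
  then show "(\<lambda>n. inner_rv M (X n) (X n)) \<longlonglongrightarrow> inner_rv M Y Y"
    using vlim by (simp add: v_def[abs_def] V_def)
qed

section \<open>Linear spaces of centered Gaussian variables\<close>

locale gaussian_space = prob_space M for M :: "'w measure" +
  fixes H :: "('w \<Rightarrow> real) set"
  assumes gauss: "X \<in> H \<Longrightarrow> centered_gaussian M X"
    and zero_mem: "(\<lambda>_. 0) \<in> H"
    and lincomb_mem: "X \<in> H \<Longrightarrow> Y \<in> H \<Longrightarrow> (\<lambda>w. a * X w + b * Y w) \<in> H"
begin

lemma meas [measurable (raw)]: "X \<in> H \<Longrightarrow> X \<in> borel_measurable M"
  using gauss centered_gaussian_measurable by blast

lemma add_mem: "X \<in> H \<Longrightarrow> Y \<in> H \<Longrightarrow> (\<lambda>w. X w + Y w) \<in> H"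
  using lincomb_mem[of X Y 1 1] by simp

lemma diff_mem: "X \<in> H \<Longrightarrow> Y \<in> H \<Longrightarrow> (\<lambda>w. X w - Y w) \<in> H"
  using lincomb_mem[of X Y 1 "-1"] by simp

lemma scale_mem: "X \<in> H \<Longrightarrow> (\<lambda>w. a * X w) \<in> H"
  using lincomb_mem[of X X a 0] by simp

lemma sum_mem: "(\<And>i. i \<in> A \<Longrightarrow> X i \<in> H) \<Longrightarrow> (\<lambda>w. \<Sum>i\<in>A. c i * X i w) \<in> H"
proof (induction A rule: infinite_finite_induct)
  case (insert x F)
  then show ?case using lincomb_mem[of "X x" "\<lambda>w. \<Sum>i\<in>F. c i * X i w" "c x" 1] by simp
qed (auto simp: zero_mem)

lemma integrable_mult: "X \<in> H \<Longrightarrow> Y \<in> H \<Longrightarrow> integrable M (\<lambda>w. X w * Y w)"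
  using centered_gaussian_integrable_mult gauss by blast

lemma inner_lincomb:
  assumes "X \<in> H" "Y \<in> H" "Z \<in> H"
  shows "inner_rv M (\<lambda>w. a * X w + b * Y w) Z = a * inner_rv M X Z + b * inner_rv M Y Z"
proof -
  have "inner_rv M (\<lambda>w. a * X w + b * Y w) Z = (\<integral>w. a * (X w * Z w) + b * (Y w * Z w) \<partial>M)"
    by (simp add: inner_rv_def algebra_simps)
  also have "\<dots> = a * inner_rv M X Z + b * inner_rv M Y Z"
    using integrable_mult[of X Z] integrable_mult[of Y Z] assms by (simp add: inner_rv_def)
  finally show ?thesis .
qed

lemma inner_sum_left:
  assumes "\<And>i. i \<in> A \<Longrightarrow> X i \<in> H" "Z \<in> H"
  shows "inner_rv M (\<lambda>w. \<Sum>i\<in>A. c i * X i w) Z = (\<Sum>i\<in>A. c i * inner_rv M (X i) Z)"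
proof -
  have "inner_rv M (\<lambda>w. \<Sum>i\<in>A. c i * X i w) Z = (\<integral>w. (\<Sum>i\<in>A. c i * (X i w * Z w)) \<partial>M)"
    by (simp add: inner_rv_def sum_distrib_right mult.assoc)
  also have "\<dots> = (\<Sum>i\<in>A. c i * inner_rv M (X i) Z)"
    using assms by (subst Bochner_Integration.integral_sum) (auto simp: inner_rv_def intro!: integrable_mult)
  finally show ?thesis .
qed

lemma inner_sum_right:
  assumes "\<And>i. i \<in> A \<Longrightarrow> X i \<in> H" "Z \<in> H"
  shows "inner_rv M Z (\<lambda>w. \<Sum>i\<in>A. c i * X i w) = (\<Sum>i\<in>A. c i * inner_rv M Z (X i))"
  using inner_sum_left[OF assms] by (simp add: inner_rv_commute[of M Z])

lemma inner_scale: "X \<in> H \<Longrightarrow> Z \<in> H \<Longrightarrow> inner_rv M (\<lambda>w. a * X w) Z = a * inner_rv M X Z"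
  using inner_sum_left[of "{()}" "\<lambda>_. X" Z "\<lambda>_. a"] by simp

lemma inner_diff:
  assumes "X \<in> H" "Y \<in> H" "Z \<in> H"
  shows "inner_rv M (\<lambda>w. X w - Y w) Z = inner_rv M X Z - inner_rv M Y Z"
  using inner_lincomb[OF assms, of 1 "-1"] by simp

lemma inner_self_nonneg: "inner_rv M X X \<ge> 0"
  unfolding inner_rv_def by (intro Bochner_Integration.integral_nonneg) auto

lemma inner_self_eq_0:
  assumes "X \<in> H"
  shows "inner_rv M X X = 0 \<longleftrightarrow> (AE w in M. X w = 0)"
  unfolding inner_rv_def
  using integral_nonneg_eq_0_iff_AE[OF integrable_mult[OF assms assms]] by simp

lemma polarization:
  assumes "X \<in> H" "Y \<in> H"
  shows "inner_rv M X Y = (inner_rv M (\<lambda>w. X w + Y w) (\<lambda>w. X w + Y w)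
      - inner_rv M (\<lambda>w. X w - Y w) (\<lambda>w. X w - Y w)) / 4"
proof -
  note i = integrable_mult[OF assms(1) assms(1)] integrable_mult[OF assms(1) assms(2)] integrable_mult[OF assms(2) assms(2)]
  have 1: "inner_rv M (\<lambda>w. X w + Y w) (\<lambda>w. X w + Y w) = (\<integral>w. X w * X w + 2 * (X w * Y w) + Y w * Y w \<partial>M)"
    by (simp add: inner_rv_def algebra_simps)
  have 2: "inner_rv M (\<lambda>w. X w - Y w) (\<lambda>w. X w - Y w) = (\<integral>w. X w * X w - 2 * (X w * Y w) + Y w * Y w \<partial>M)"
    by (simp add: inner_rv_def algebra_simps)
  show ?thesis unfolding 1 2 using i by (simp add: inner_rv_def)
qed

text \<open>Polarization turns the scalar product into variances of sums and differences, which
  converge by \<open>centered_gaussian_limit\<close>.\<close>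

lemma inner_tendsto:
  assumes X: "\<And>n. X n \<in> H" "\<And>w. (\<lambda>n. X n w) \<longlonglongrightarrow> X' w"
    and Y: "\<And>n. Y n \<in> H" "\<And>w. (\<lambda>n. Y n w) \<longlonglongrightarrow> Y' w"
    and X': "X' \<in> H" and Y': "Y' \<in> H"
  shows "(\<lambda>n. inner_rv M (X n) (Y n)) \<longlonglongrightarrow> inner_rv M X' Y'"
proof -
  have "(\<lambda>n. inner_rv M (\<lambda>w. X n w + Y n w) (\<lambda>w. X n w + Y n w))
      \<longlonglongrightarrow> inner_rv M (\<lambda>w. X' w + Y' w) (\<lambda>w. X' w + Y' w)"
    by (rule centered_gaussian_limit(2), rule gauss, rule add_mem[OF X(1) Y(1)], intro tendsto_intros X Y)
  moreover have "(\<lambda>n. inner_rv M (\<lambda>w. X n w - Y n w) (\<lambda>w. X n w - Y n w))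
      \<longlonglongrightarrow> inner_rv M (\<lambda>w. X' w - Y' w) (\<lambda>w. X' w - Y' w)"
    by (rule centered_gaussian_limit(2), rule gauss, rule diff_mem[OF X(1) Y(1)], intro tendsto_intros X Y)
  ultimately show ?thesis
    unfolding polarization[OF X(1) Y(1)] polarization[OF X' Y'] by (intro tendsto_intros) auto
qed

text \<open>A single layer of sequential limits at every \<open>w\<close>, not an iterated closure.
  It is applied once per derivative, since a derivative is a pointwise limit of difference
  quotients.\<close>

definition pointwise_closure :: "('w \<Rightarrow> real) set" where
  "pointwise_closure = {Y. \<exists>X. (\<forall>n. X n \<in> H) \<and> (\<forall>w. (\<lambda>n. X n w) \<longlonglongrightarrow> Y w)}"

lemma pointwise_closure_superset: "H \<subseteq> pointwise_closure"
  by (auto simp: pointwise_closure_def intro!: exI[of _ "\<lambda>_. X" for X])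

lemma pointwise_closureI:
  "(\<And>n. X n \<in> H) \<Longrightarrow> (\<And>w. (\<lambda>n. X n w) \<longlonglongrightarrow> Y w) \<Longrightarrow> Y \<in> pointwise_closure"
  by (auto simp: pointwise_closure_def)

lemma gaussian_space_pointwise_closure: "gaussian_space M pointwise_closure"
proof (unfold_locales, goal_cases)
  case (1 X)
  then show ?case using centered_gaussian_limit(1) gauss by (auto simp: pointwise_closure_def)
next
  case 2
  show ?case using pointwise_closure_superset zero_mem by auto
next
  case (3 X Y a b)
  then obtain X' Y' where *: "\<And>n. X' n \<in> H" "\<And>n. Y' n \<in> H"
    "\<And>w. (\<lambda>n. X' n w) \<longlonglongrightarrow> X w" "\<And>w. (\<lambda>n. Y' n w) \<longlonglongrightarrow> Y w"
    by (auto simp: pointwise_closure_def)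
  show ?case
    by (rule pointwise_closureI[of "\<lambda>n w. a * X' n w + b * Y' n w"])
       (rule lincomb_mem[OF *(1,2)], intro tendsto_intros *)
qed

end

section \<open>Uniqueness of finite-dimensional laws\<close>

text \<open>Divided by their common total mass \<open>c\<close>, the weights become probability
  densities, and the hypothesis says that \<open>X1\<close> and \<open>X2\<close> have the same
  characteristic function under them. The bound 2 is the one that the weights
  \<open>1 + Re (z * G)\<close> of the next lemma satisfy.\<close>

lemma weighted_char_uniqueness:
  fixes X1 :: "'a \<Rightarrow> real" and X2 :: "'b \<Rightarrow> real"
  assumes "prob_space M1" "prob_space M2"
    and [measurable]: "X1 \<in> borel_measurable M1" "X2 \<in> borel_measurable M2"
      "g1 \<in> borel_measurable M1" "g2 \<in> borel_measurable M2"
    and g: "\<And>x. 0 \<le> g1 x" "\<And>x. g1 x \<le> (2::real)" "\<And>y. 0 \<le> g2 y" "\<And>y. g2 y \<le> (2::real)"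
    and eq: "\<And>t. (\<integral>w. iexp (t * X1 w) * g1 w \<partial>M1) = (\<integral>w. iexp (t * X2 w) * g2 w \<partial>M2)"
    and A [measurable]: "A \<in> sets borel"
  shows "(\<integral>w. indicator A (X1 w) * g1 w \<partial>M1) = (\<integral>w. indicator A (X2 w) * g2 w \<partial>M2)"
proof -
  interpret M1: prob_space M1 by fact
  interpret M2: prob_space M2 by fact
  have i1: "integrable M1 g1" by (rule M1.integrable_const_bound[of _ 2]) (use g in auto)
  have i2: "integrable M2 g2" by (rule M2.integrable_const_bound[of _ 2]) (use g in auto)
  \<comment> \<open>At \<open>t = 0\<close> the hypothesis compares the two masses; if they vanish,
    both sides of the claim are 0.\<close>
  define c where "c = (\<integral>w. g1 w \<partial>M1)"
  have "complex_of_real (\<integral>w. g1 w \<partial>M1) = complex_of_real (\<integral>w. g2 w \<partial>M2)"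
    using eq[of 0] by simp
  then have c2: "c = (\<integral>w. g2 w \<partial>M2)" by (simp add: c_def)
  have c0: "c \<ge> 0" unfolding c_def using g by (intro Bochner_Integration.integral_nonneg) auto
  show ?thesis
  proof (cases "c = 0")
    case True
    have "AE w in M1. g1 w = 0" using integral_nonneg_eq_0_iff_AE[OF i1] g True by (auto simp: c_def)
    then have "(\<integral>w. indicator A (X1 w) * g1 w \<partial>M1) = (\<integral>w. 0 \<partial>M1)" by (intro integral_cong_AE) auto
    moreover have "AE w in M2. g2 w = 0" using integral_nonneg_eq_0_iff_AE[OF i2] g True by (auto simp: c2)
    then have "(\<integral>w. indicator A (X2 w) * g2 w \<partial>M2) = (\<integral>w. 0 \<partial>M2)" by (intro integral_cong_AE) auto
    ultimately show ?thesis by simp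
  next
    case False
    with c0 have c: "c > 0" by simp
    define D1 where "D1 = distr (density M1 (\<lambda>w. g1 w / c)) borel X1"
    define D2 where "D2 = distr (density M2 (\<lambda>w. g2 w / c)) borel X2"
    have p1: "prob_space (density M1 (\<lambda>w. g1 w / c))"
    proof
      have "(\<integral>\<^sup>+w. ennreal (g1 w / c) \<partial>M1) = ennreal (\<integral>w. g1 w / c \<partial>M1)"
        using i1 g c by (intro nn_integral_eq_integral) auto
      then show "emeasure (density M1 (\<lambda>w. g1 w / c)) (space (density M1 (\<lambda>w. g1 w / c))) = 1"
        using c by (simp add: emeasure_density c_def[symmetric] cong: nn_integral_cong)
    qed
    have p2: "prob_space (density M2 (\<lambda>w. g2 w / c))"
    proof
      have "(\<integral>\<^sup>+w. ennreal (g2 w / c) \<partial>M2) = ennreal (\<integral>w. g2 w / c \<partial>M2)"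
        using i2 g c by (intro nn_integral_eq_integral) auto
      then show "emeasure (density M2 (\<lambda>w. g2 w / c)) (space (density M2 (\<lambda>w. g2 w / c))) = 1"
        using c by (simp add: emeasure_density c2[symmetric] cong: nn_integral_cong)
    qed
    have ch1: "char D1 t = (\<integral>w. iexp (t * X1 w) * g1 w \<partial>M1) / c" for t
    proof -
      have "char D1 t = (\<integral>w. (g1 w / c) *\<^sub>R iexp (t * X1 w) \<partial>M1)"
        unfolding D1_def char_def using g c
        by (subst integral_distr, simp, simp, subst integral_density) auto
      also have "\<dots> = (\<integral>w. iexp (t * X1 w) * g1 w / c \<partial>M1)"
        by (simp add: scaleR_conv_of_real mult.commute)
      finally show ?thesis by simp
    qed
    have ch2: "char D2 t = (\<integral>w. iexp (t * X2 w) * g2 w \<partial>M2) / c" for t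
    proof -
      have "char D2 t = (\<integral>w. (g2 w / c) *\<^sub>R iexp (t * X2 w) \<partial>M2)"
        unfolding D2_def char_def using g c
        by (subst integral_distr, simp, simp, subst integral_density) auto
      also have "\<dots> = (\<integral>w. iexp (t * X2 w) * g2 w / c \<partial>M2)"
        by (simp add: scaleR_conv_of_real mult.commute)
      finally show ?thesis by simp
    qed
    have "char D1 = char D2" using ch1 ch2 eq by auto
    then have "D1 = D2"
      unfolding D1_def D2_def
      by (intro Levy_uniqueness prob_space.real_distribution_distr p1 p2) auto
    then have "(\<integral>x. indicator A x \<partial>D1) = (\<integral>x. indicator A x \<partial>D2 :: real)" by simp
    moreover have "(\<integral>x. indicator A x \<partial>D1) = (\<integral>w. indicator A (X1 w) * g1 w \<partial>M1) / c"
      unfolding D1_def using g c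
      by (subst integral_distr, simp, simp, subst integral_density) (auto simp: mult.commute)
    moreover have "(\<integral>x. indicator A x \<partial>D2) = (\<integral>w. indicator A (X2 w) * g2 w \<partial>M2) / c"
      unfolding D2_def using g c
      by (subst integral_distr, simp, simp, subst integral_density) (auto simp: mult.commute)
    ultimately show ?thesis using c by simp
  qed
qed

text \<open>Levy's theorem needs positive weights; the unweighted hypothesis \<open>eq1\<close> pays
  for the constant 1 that is added to the real parts.\<close>

lemma complex_weighted_char_uniqueness:
  fixes X1 :: "'a \<Rightarrow> real" and X2 :: "'b \<Rightarrow> real" and G1 :: "'a \<Rightarrow> complex" and G2 :: "'b \<Rightarrow> complex"
  assumes P1: "prob_space M1" and P2: "prob_space M2"
    and X [measurable]: "X1 \<in> borel_measurable M1" "X2 \<in> borel_measurable M2"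
    and G [measurable]: "G1 \<in> borel_measurable M1" "G2 \<in> borel_measurable M2"
    and b: "\<And>x. norm (G1 x) \<le> 1" "\<And>y. norm (G2 y) \<le> 1"
    and eq: "\<And>t. (\<integral>w. iexp (t * X1 w) * G1 w \<partial>M1) = (\<integral>w. iexp (t * X2 w) * G2 w \<partial>M2)"
    and eq1: "\<And>t. (\<integral>w. iexp (t * X1 w) \<partial>M1) = (\<integral>w. iexp (t * X2 w) \<partial>M2)"
    and A [measurable]: "A \<in> sets borel"
  shows "(\<integral>w. indicator A (X1 w) * G1 w \<partial>M1) = (\<integral>w. indicator A (X2 w) * G2 w \<partial>M2)"
proof -
  interpret M1: prob_space M1 by fact
  interpret M2: prob_space M2 by fact
  \<comment> \<open>the real parts of \<open>G\<close> and \<open>- i G\<close> become nonnegative weights after adding 1\<close>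
  have key: "(\<integral>w. indicator A (X1 w) * Re (z * G1 w) \<partial>M1) = (\<integral>w. indicator A (X2 w) * Re (z * G2 w) \<partial>M2)"
    if z: "norm z = 1" for z :: complex
  proof -
    have nb: "\<bar>Re (z * G1 x)\<bar> \<le> 1" "\<bar>Re (z * G2 y)\<bar> \<le> 1" for x y
      using abs_Re_le_cmod[of "z * G1 x"] abs_Re_le_cmod[of "z * G2 y"] b(1)[of x] b(2)[of y] z
      by (auto simp: norm_mult)
    have [measurable]: "(\<lambda>w. cnj (G1 w)) \<in> borel_measurable M1" "(\<lambda>w. cnj (G2 w)) \<in> borel_measurable M2"
      by (rule measurable_compose[OF G(1)] measurable_compose[OF G(2)],
          intro borel_measurable_continuous_onI continuous_intros)+
    have I1: "integrable M1 (\<lambda>w. iexp (t * X1 w) * G1 w)" "integrable M1 (\<lambda>w. iexp (t * X1 w))"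
      "integrable M1 (\<lambda>w. iexp (t * X1 w) * cnj (G1 w))" for t
      by (rule M1.integrable_const_bound[of _ 1]; use b in \<open>auto simp: norm_mult\<close>)+
    have I2: "integrable M2 (\<lambda>w. iexp (t * X2 w) * G2 w)" "integrable M2 (\<lambda>w. iexp (t * X2 w))"
      "integrable M2 (\<lambda>w. iexp (t * X2 w) * cnj (G2 w))" for t
      by (rule M2.integrable_const_bound[of _ 1]; use b in \<open>auto simp: norm_mult\<close>)+
    \<comment> \<open>Conjugating the hypothesis at \<open>-t\<close> gives the identity for the
      conjugate weight, and \<open>Re (z * G)\<close> is a combination of \<open>G\<close> and its
      conjugate.\<close>
    have cj: "(\<integral>w. iexp (t * X1 w) * cnj (G1 w) \<partial>M1) = (\<integral>w. iexp (t * X2 w) * cnj (G2 w) \<partial>M2)" for t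
    proof -
      have "cnj (\<integral>w. iexp ((-t) * X1 w) * G1 w \<partial>M1) = cnj (\<integral>w. iexp ((-t) * X2 w) * G2 w \<partial>M2)"
        using eq[of "-t"] by simp
      moreover have "(\<integral>w. iexp (t * X1 w) * cnj (G1 w) \<partial>M1) = cnj (\<integral>w. iexp ((-t) * X1 w) * G1 w \<partial>M1)"
        by (subst Bochner_Integration.integral_cnj[symmetric]) (simp add: exp_cnj)
      moreover have "(\<integral>w. iexp (t * X2 w) * cnj (G2 w) \<partial>M2) = cnj (\<integral>w. iexp ((-t) * X2 w) * G2 w \<partial>M2)"
        by (subst Bochner_Integration.integral_cnj[symmetric]) (simp add: exp_cnj)
      ultimately show ?thesis by simp
    qed
    have dec: "complex_of_real (1 + Re (z * g)) = 1 + (z * g + cnj z * cnj g) / 2" for g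
      by (simp add: complex_eq_iff)
    have e1: "(\<integral>w. iexp (t * X1 w) * complex_of_real (1 + Re (z * G1 w)) \<partial>M1) =
        (\<integral>w. iexp (t * X1 w) \<partial>M1) + (z * (\<integral>w. iexp (t * X1 w) * G1 w \<partial>M1)
          + cnj z * (\<integral>w. iexp (t * X1 w) * cnj (G1 w) \<partial>M1)) / 2" for t
    proof -
      have "(\<integral>w. iexp (t * X1 w) * complex_of_real (1 + Re (z * G1 w)) \<partial>M1) =
        (\<integral>w. iexp (t * X1 w) + (z * (iexp (t * X1 w) * G1 w) + cnj z * (iexp (t * X1 w) * cnj (G1 w))) / 2 \<partial>M1)"
        unfolding dec by (simp add: algebra_simps add_divide_distrib)
      then show ?thesis using I1[of t] by simp
    qed
    have e2: "(\<integral>w. iexp (t * X2 w) * complex_of_real (1 + Re (z * G2 w)) \<partial>M2) =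
        (\<integral>w. iexp (t * X2 w) \<partial>M2) + (z * (\<integral>w. iexp (t * X2 w) * G2 w \<partial>M2)
          + cnj z * (\<integral>w. iexp (t * X2 w) * cnj (G2 w) \<partial>M2)) / 2" for t
    proof -
      have "(\<integral>w. iexp (t * X2 w) * complex_of_real (1 + Re (z * G2 w)) \<partial>M2) =
        (\<integral>w. iexp (t * X2 w) + (z * (iexp (t * X2 w) * G2 w) + cnj z * (iexp (t * X2 w) * cnj (G2 w))) / 2 \<partial>M2)"
        unfolding dec by (simp add: algebra_simps add_divide_distrib)
      then show ?thesis using I2[of t] by simp
    qed
    have 1: "(\<integral>w. indicator A (X1 w) * (1 + Re (z * G1 w)) \<partial>M1) = (\<integral>w. indicator A (X2 w) * (1 + Re (z * G2 w)) \<partial>M2)"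
    proof (rule weighted_char_uniqueness[OF P1 P2])
      show "0 \<le> 1 + Re (z * G1 x)" "1 + Re (z * G1 x) \<le> 2" for x using nb(1)[of x] by linarith+
      show "0 \<le> 1 + Re (z * G2 y)" "1 + Re (z * G2 y) \<le> 2" for y using nb(2)[of y] by linarith+
      show "(\<integral>w. iexp (t * X1 w) * complex_of_real (1 + Re (z * G1 w)) \<partial>M1)
        = (\<integral>w. iexp (t * X2 w) * complex_of_real (1 + Re (z * G2 w)) \<partial>M2)" for t
        unfolding e1 e2 eq eq1 cj ..
    qed (use A in measurable)
    have 2: "(\<integral>w. indicator A (X1 w) * 1 \<partial>M1) = (\<integral>w. indicator A (X2 w) * 1 \<partial>M2 :: real)"
      by (rule weighted_char_uniqueness[OF P1 P2]) (use eq1 in auto)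
    have "integrable M1 (\<lambda>w. indicator A (X1 w) * Re (z * G1 w) :: real)" "integrable M1 (\<lambda>w. indicator A (X1 w) :: real)"
      by (rule M1.integrable_const_bound[of _ 1]; use nb in \<open>auto simp: indicator_def\<close>)+
    moreover have "integrable M2 (\<lambda>w. indicator A (X2 w) * Re (z * G2 w) :: real)" "integrable M2 (\<lambda>w. indicator A (X2 w) :: real)"
      by (rule M2.integrable_const_bound[of _ 1]; use nb in \<open>auto simp: indicator_def\<close>)+
    ultimately show ?thesis using 1 2 by (simp add: ring_distribs)
  qed
  have i1: "integrable M1 (\<lambda>w. indicator A (X1 w) * G1 w)"
    by (rule M1.integrable_const_bound[of _ 1]) (use b in \<open>auto simp: indicator_def\<close>)
  have i2: "integrable M2 (\<lambda>w. indicator A (X2 w) * G2 w)"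
    by (rule M2.integrable_const_bound[of _ 1]) (use b in \<open>auto simp: indicator_def\<close>)
  have ind: "Re (indicator A x * g) = indicator A x * Re g" "Im (indicator A x * g) = indicator A x * Im g"
    for x :: real and g :: complex by (auto simp: indicator_def)
  show ?thesis
  proof (rule complex_eqI)
    show "Re (\<integral>w. indicator A (X1 w) * G1 w \<partial>M1) = Re (\<integral>w. indicator A (X2 w) * G2 w \<partial>M2)"
      unfolding integral_Re[OF i1, symmetric] integral_Re[OF i2, symmetric] ind using key[of 1] by simp
    have "(\<integral>w. indicator A (X1 w) * Im (G1 w) \<partial>M1) = (\<integral>w. indicator A (X2 w) * Im (G2 w) \<partial>M2)"
      using key[of "- \<i>"] by simp
    then show "Im (\<integral>w. indicator A (X1 w) * G1 w \<partial>M1) = Im (\<integral>w. indicator A (X2 w) * G2 w \<partial>M2)"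
      unfolding integral_Im[OF i1, symmetric] integral_Im[OF i2, symmetric] ind .
  qed
qed

text \<open>The coordinates are treated one at a time: once \<open>j \<in> J\<close> has been handled, the factor
  \<open>exp (i t\<^sub>j v\<^sub>j)\<close> is replaced by the indicator of \<open>v\<^sub>j \<in> A j\<close>.\<close>

lemma PiM_char_uniqueness:
  fixes N1 N2 :: "('i \<Rightarrow> real) measure"
  assumes I: "finite I" and P1: "prob_space N1" and P2: "prob_space N2"
    and s1: "sets N1 = sets (\<Pi>\<^sub>M i\<in>I. borel)" and s2: "sets N2 = sets (\<Pi>\<^sub>M i\<in>I. borel)"
    and eq: "\<And>t. (\<integral>v. iexp (\<Sum>i\<in>I. t i * v i) \<partial>N1) = (\<integral>v. iexp (\<Sum>i\<in>I. t i * v i) \<partial>N2)"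
  shows "N1 = N2"
proof -
  interpret N1: prob_space N1 by fact
  interpret N2: prob_space N2 by fact
  note [measurable_cong] = s1 s2
  define L where "L J A t v = (\<Prod>j\<in>J. indicator (A j) (v j)) * iexp (\<Sum>i\<in>I - J. t i * v i)"
    for J and A :: "'i \<Rightarrow> real set" and t v
  have main: "(\<integral>v. L J A t v \<partial>N1) = (\<integral>v. L J A t v \<partial>N2)"
    if "finite J" "J \<subseteq> I" "\<And>j. j \<in> J \<Longrightarrow> A j \<in> sets borel" for J A t
    using that
  proof (induction J arbitrary: t)
    case empty
    then show ?case using eq[of t] by (simp add: L_def)
  next
    case (insert j J)
    note insert.prems(2)[measurable]
    have jI: "j \<in> I" and JI: "J \<subseteq> I" and AJ: "\<And>i. i \<in> J \<Longrightarrow> A i \<in> sets borel" using insert.prems by auto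
    define G where "G v = (\<Prod>j\<in>J. indicator (A j) (v j)) * iexp (\<Sum>i\<in>I - insert j J. t i * v i)" for v
    have vm: "(\<lambda>v. v i) \<in> borel_measurable N1" "(\<lambda>v. v i) \<in> borel_measurable N2" if "i \<in> I" for i
      using that by measurable
    have ind1: "(\<lambda>v. indicator (A i) (v i) :: complex) \<in> borel_measurable N1"
      "(\<lambda>v. indicator (A i) (v i) :: complex) \<in> borel_measurable N2" if "i \<in> J" for i
    proof -
      have "(indicator (A i) :: real \<Rightarrow> complex) \<in> borel_measurable borel" using AJ[OF that] by simp
      moreover have "i \<in> I" using that JI by auto
      ultimately show "(\<lambda>v. indicator (A i) (v i) :: complex) \<in> borel_measurable N1"
        "(\<lambda>v. indicator (A i) (v i) :: complex) \<in> borel_measurable N2"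
        by (metis measurable_compose[OF vm(1)], metis measurable_compose[OF vm(2)])
    qed
    have Gm: "G \<in> borel_measurable N1" "G \<in> borel_measurable N2"
      unfolding G_def
      by (intro borel_measurable_times borel_measurable_prod ind1 measurable_compose[OF _ borel_measurable_exp]
          borel_measurable_const borel_measurable_of_real borel_measurable_sum vm; auto)+
    have Gb: "norm (G v) \<le> 1" for v
      unfolding G_def norm_mult by (auto simp: prod_norm[symmetric] indicator_def intro!: prod_le_1)
    \<comment> \<open>With the other coordinates frozen in \<open>G\<close>, the variable
      \<open>s\<close> takes the place of \<open>t j\<close>; the induction hypothesis for
      \<open>t(j := s)\<close> therefore supplies all frequencies in coordinate
      \<open>j\<close>.\<close>
    have spl: "iexp (s * v j) * G v = L J A (t(j := s)) v" for s v
    proof -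
      have IJ: "I - J = insert j (I - insert j J)" using jI insert.hyps by auto
      have "(\<Sum>i\<in>I - J. (t(j := s)) i * v i) = s * v j + (\<Sum>i\<in>I - insert j J. (t(j := s)) i * v i)"
        by (subst IJ, subst sum.insert) (use I in auto)
      also have "(\<Sum>i\<in>I - insert j J. (t(j := s)) i * v i) = (\<Sum>i\<in>I - insert j J. t i * v i)"
        by (rule sum.cong) auto
      finally show ?thesis by (simp add: L_def G_def ring_distribs exp_add)
    qed
    \<comment> \<open>The marginal law of coordinate \<open>j\<close> is read off from frequency
      vectors supported at \<open>j\<close>.\<close>
    have one: "iexp (s * v j) = iexp (\<Sum>i\<in>I. (if i = j then s else 0) * v i)" for s v
    proof -
      have "(\<Sum>i\<in>I. (if i = j then s else 0) * v i) = (\<Sum>i\<in>I. if i = j then s * v i else 0)"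
        by (rule sum.cong) auto
      then show ?thesis using I jI by simp
    qed
    have "(\<integral>v. indicator (A j) (v j) * G v \<partial>N1) = (\<integral>v. indicator (A j) (v j) * G v \<partial>N2)"
    proof (rule complex_weighted_char_uniqueness[OF P1 P2 vm[OF jI] Gm Gb Gb])
      show "(\<integral>v. iexp (s * v j) * G v \<partial>N1) = (\<integral>v. iexp (s * v j) * G v \<partial>N2)" for s
        unfolding spl by (rule insert.IH[OF JI AJ])
      show "(\<integral>v. iexp (s * v j) \<partial>N1) = (\<integral>v. iexp (s * v j) \<partial>N2)" for s
        unfolding one by (rule eq)
    qed (use insert.prems in auto)
    moreover have "indicator (A j) (v j) * G v = L (insert j J) A t v" for v
      using insert.hyps by (simp add: L_def G_def mult.assoc)
    ultimately show ?case by simp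
  qed
  show ?thesis
  proof (rule measure_eqI_PiM_finite[OF I s1 s2])
    fix A :: "'i \<Rightarrow> real set" assume A: "\<And>i. i \<in> I \<Longrightarrow> A i \<in> sets borel"
    have Lind: "L I A t v = complex_of_real (indicator (Pi\<^sub>E I A) v)" if ve: "v \<in> extensional I" for v t
    proof (cases "v \<in> Pi\<^sub>E I A")
      case True
      then have "(\<Prod>j\<in>I. indicator (A j) (v j)) = (\<Prod>j\<in>I. 1 :: complex)"
        by (intro prod.cong) (auto simp: indicator_def PiE_iff)
      then show ?thesis using True by (simp add: L_def)
    next
      case False
      then obtain j where "j \<in> I" "v j \<notin> A j" using ve by (auto simp: PiE_iff)
      then have "(\<Prod>j\<in>I. indicator (A j) (v j)) = (0 :: complex)" using I by (auto intro!: prod_zero bexI[of _ j])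
      then show ?thesis using False by (simp add: L_def)
    qed
    have sp: "space N1 = extensional I" "space N2 = extensional I"
      using sets_eq_imp_space_eq[OF s1] sets_eq_imp_space_eq[OF s2] by (auto simp: space_PiM PiE_def)
    have B: "Pi\<^sub>E I A \<in> sets N1" "Pi\<^sub>E I A \<in> sets N2" using s1 s2 A I by (auto intro!: sets_PiM_I_finite)
    have "(\<integral>v. L I A (\<lambda>_. 0) v \<partial>N1) = (\<integral>v. L I A (\<lambda>_. 0) v \<partial>N2)" by (rule main) (use A I in auto)
    moreover have "(\<integral>v. L I A (\<lambda>_. 0) v \<partial>N1) = (\<integral>v. complex_of_real (indicator (Pi\<^sub>E I A) v) \<partial>N1)"
      by (rule Bochner_Integration.integral_cong) (auto simp: Lind sp)
    moreover have "(\<integral>v. L I A (\<lambda>_. 0) v \<partial>N2) = (\<integral>v. complex_of_real (indicator (Pi\<^sub>E I A) v) \<partial>N2)"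
      by (rule Bochner_Integration.integral_cong) (auto simp: Lind sp)
    ultimately have "measure N1 (Pi\<^sub>E I A) = measure N2 (Pi\<^sub>E I A)"
      using B by (simp add: sets.Int_space_eq2)
    then show "emeasure N1 (Pi\<^sub>E I A) = emeasure N2 (Pi\<^sub>E I A)"
      by (simp add: N1.emeasure_eq_measure N2.emeasure_eq_measure)
  next
    show "range (\<lambda>n :: nat. space (\<Pi>\<^sub>M i\<in>I. (borel :: real measure))) \<subseteq> prod_algebra I (\<lambda>_. borel)"
      by (auto simp: space_PiM intro!: prod_algebraI_finite[OF I])
  qed auto
qed

section \<open>The centered Gaussian law with a given variance\<close>

lemma rv_mean_eq: "X \<in> borel_measurable M \<Longrightarrow> rv_mean M X = (\<integral>w. X w \<partial>M)"
  unfolding rv_mean_def by (rule integral_completion)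

lemma normal_law_mean:
  assumes "X \<in> borel_measurable M" "distr M borel X = normal_law m s" "s \<ge> 0"
  shows "(\<integral>w. X w \<partial>M) = m" "integrable M X"
proof -
  have i: "integrable std_normal_distribution (\<lambda>x. x)"
    using integrable_std_normal_distribution_moment[of 1] by simp
  interpret N: prob_space std_normal_distribution
    using prob_space_normal_density[of 1 0] by simp
  have d: "distr M borel X = distr std_normal_distribution borel (\<lambda>x. m + s * x)"
    using assms normal_law_eq_distr by simp
  have z: "(\<integral>x. x \<partial>std_normal_distribution) = 0"
    using integral_std_normal_distribution_moment_odd[of 1] by simp
  have "(\<integral>w. X w \<partial>M) = (\<integral>x. x \<partial>distr M borel X)" using assms(1) by (subst integral_distr) auto
  also have "\<dots> = (\<integral>x. m + s * x \<partial>std_normal_distribution)" unfolding d by (subst integral_distr) auto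
  also have "\<dots> = m" using i z N.prob_space by simp
  finally show "(\<integral>w. X w \<partial>M) = m" .
  have "integrable std_normal_distribution (\<lambda>x. m + s * x)"
    by (intro Bochner_Integration.integrable_add integrable_mult_right i N.integrable_const)
  then have "integrable (distr M borel X) (\<lambda>x. x)"
    unfolding d by (subst integrable_distr_eq) simp_all
  then show "integrable M X" using assms(1) by (simp add: integrable_distr_eq)
qed

text \<open>The location parameter of a normal law is its mean, and the mean of the combination is
  0. Integrability of a single \<open>X j\<close> comes from the combination whose only nonzero
  coefficient is 1 at \<open>j\<close>.\<close>

lemma gaussian_vector_lincomb:
  assumes "prob_space M" and g: "gaussian_vector M J X" and mean: "\<And>j. j \<in> J \<Longrightarrow> (\<integral>w. X j w \<partial>M) = 0"
  shows "centered_gaussian M (\<lambda>w. \<Sum>j\<in>J. c j * X j w)"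
proof -
  have J: "finite J" and m: "\<And>j. j \<in> J \<Longrightarrow> X j \<in> borel_measurable M"
    and n: "\<And>c. \<exists>m s. s \<ge> 0 \<and> distr M borel (\<lambda>w. \<Sum>j\<in>J. c j * X j w) = normal_law m s"
    using g by (auto simp: gaussian_vector_def)
  have i: "integrable M (X j)" if "j \<in> J" for j
  proof -
    have e: "(\<lambda>w. \<Sum>i\<in>J. (if i = j then 1 else 0) * X i w) = X j"
    proof
      fix w
      have "(\<Sum>i\<in>J. (if i = j then 1 else 0) * X i w) = (\<Sum>i\<in>J. if i = j then X i w else 0)"
        by (rule sum.cong) auto
      then show "(\<Sum>i\<in>J. (if i = j then 1 else 0) * X i w) = X j w" using J that by simp
    qed
    obtain a s where "s \<ge> 0" "distr M borel (\<lambda>w. \<Sum>i\<in>J. (if i = j then 1 else 0) * X i w) = normal_law a s"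
      using n[of "\<lambda>i. if i = j then 1 else 0"] by metis
    from this(2,1) show ?thesis unfolding e by (rule normal_law_mean(2)[OF m[OF that]])
  qed
  obtain a s where s: "s \<ge> 0" and d: "distr M borel (\<lambda>w. \<Sum>i\<in>J. c i * X i w) = normal_law a s"
    using n[of c] by metis
  have meas: "(\<lambda>w. \<Sum>i\<in>J. c i * X i w) \<in> borel_measurable M" using m by auto
  have "a = (\<integral>w. (\<Sum>i\<in>J. c i * X i w) \<partial>M)" using normal_law_mean(1)[OF meas d s] by simp
  also have "\<dots> = 0" using i mean by (simp add: Bochner_Integration.integral_sum)
  finally show ?thesis using meas d s by (auto simp: centered_gaussian_def)
qed

lemma gaussian_space_span:
  assumes "prob_space M" "gaussian_process M f" "centered_process M f"
  shows "gaussian_space M {Y. \<exists>J c. finite J \<and> Y = (\<lambda>w. \<Sum>t\<in>J. c t * f t w)}" (is "gaussian_space M ?H")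
proof -
  interpret prob_space M by fact
  show ?thesis
  proof (unfold_locales, goal_cases)
    case (1 X)
    then obtain J c where J: "finite J" and X: "X = (\<lambda>w. \<Sum>t\<in>J. c t * f t w)" by blast
    show ?case unfolding X
      by (rule gaussian_vector_lincomb[OF assms(1)])
         (use assms J in \<open>auto simp: gaussian_process_def centered_process_def\<close>)
  next
    case 2
    show ?case by (auto intro!: exI[of _ "{}"])
  next
    case (3 X Y a b)
    then obtain J c K d where J: "finite J" "X = (\<lambda>w. \<Sum>t\<in>J. c t * f t w)"
      and K: "finite K" "Y = (\<lambda>w. \<Sum>t\<in>K. d t * f t w)" by auto
    have "a * X w + b * Y w = (\<Sum>t\<in>J \<union> K. (a * (if t \<in> J then c t else 0) + b * (if t \<in> K then d t else 0)) * f t w)" for w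
    proof -
      have "X w = (\<Sum>t\<in>J \<union> K. (if t \<in> J then c t else 0) * f t w)" unfolding J(2)
        using J K by (intro sum.mono_neutral_cong_left) auto
      moreover have "Y w = (\<Sum>t\<in>J \<union> K. (if t \<in> K then d t else 0) * f t w)" unfolding K(2)
        using J K by (intro sum.mono_neutral_cong_left) auto
      ultimately show ?thesis by (simp add: sum_distrib_left sum.distrib[symmetric] algebra_simps)
    qed
    then have "(\<lambda>w. a * X w + b * Y w) =
        (\<lambda>w. \<Sum>t\<in>J \<union> K. (a * (if t \<in> J then c t else 0) + b * (if t \<in> K then d t else 0)) * f t w)"
      by (rule ext)
    moreover have "finite (J \<union> K)" using J(1) K(1) by simp
    ultimately show ?case
      by (intro CollectI exI[of _ "J \<union> K"] conjI
          exI[of _ "\<lambda>t. a * (if t \<in> J then c t else 0) + b * (if t \<in> K then d t else 0)"])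
  qed
qed

text \<open>Mean 0 and variance \<open>S\<close> fix the characteristic function, hence the law. The
  definite description is therefore met by at most one measure, and exhibiting one suffices.\<close>

lemma centered_gaussian_law_eqI:
  assumes S: "S \<in> carrier_mat n n" and s: "sets N = sets (\<Pi>\<^sub>M a\<in>{..<n}. (borel :: real measure))"
    and p: "prob_space N" and g: "gaussian_vector N {..<n} (\<lambda>a v. v a)"
    and z: "\<And>a. a < n \<Longrightarrow> rv_mean N (\<lambda>v. v a) = 0"
    and v: "var_mat N (map (\<lambda>a v. v a) [0..<n]) = S"
  shows "centered_gaussian_law S = N"
proof -
  have char: "(\<integral>v. iexp (\<Sum>a\<in>{..<n}. t a * v a) \<partial>N') =
      complex_of_real (exp (- (\<Sum>a<n. \<Sum>b<n. t a * t b * S $$ (a, b)) / 2))"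
    if s': "sets N' = sets (\<Pi>\<^sub>M a\<in>{..<n}. (borel :: real measure))"
      and p': "prob_space N'" and g': "gaussian_vector N' {..<n} (\<lambda>a v. v a)"
      and z': "\<And>a. a < n \<Longrightarrow> rv_mean N' (\<lambda>v. v a) = 0"
      and v': "var_mat N' (map (\<lambda>a v. v a) [0..<n]) = S" for N' t
  proof -
    interpret N': prob_space N' by fact
    note [measurable_cong] = s'
    have meas: "(\<lambda>v. v a) \<in> borel_measurable N'" if "a < n" for a
    proof -
      have "a \<in> {..<n}" using that by simp
      then show ?thesis by measurable
    qed
    have mean: "(\<integral>v. v a \<partial>N') = 0" if "a < n" for a
      using z'[OF that] rv_mean_eq[OF meas[OF that]] by simp
    have cg: "centered_gaussian N' (\<lambda>v. \<Sum>a\<in>{..<n}. t a * v a)" for t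
      by (rule gaussian_vector_lincomb[OF p' g']) (use mean in auto)
    have cov: "(\<integral>v. v a * v b \<partial>N') = S $$ (a, b)" if "a < n" "b < n" for a b
    proof -
      have "S $$ (a, b) = rv_cov N' (\<lambda>v. v a) (\<lambda>v. v b)"
        using that by (simp add: v'[symmetric] var_mat_def cov_mat_def)
      also have "\<dots> = rv_mean N' (\<lambda>v. v a * v b)" using that z' by (simp add: rv_cov_def)
      also have "\<dots> = (\<integral>v. v a * v b \<partial>N')" using that meas by (intro rv_mean_eq) auto
      finally show ?thesis ..
    qed
    have cg1: "centered_gaussian N' (\<lambda>v. v a)" if "a < n" for a
    proof -
      have "(\<lambda>v. \<Sum>i\<in>{..<n}. (if i = a then 1 else 0) * v i) = (\<lambda>v :: nat \<Rightarrow> real. v a)"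
        using that by (auto simp: fun_eq_iff if_distrib[of "\<lambda>x. x * _"] cong: if_cong)
      then show ?thesis using cg[of "\<lambda>i. if i = a then 1 else 0"] by simp
    qed
    have "inner_rv N' (\<lambda>v. \<Sum>a\<in>{..<n}. t a * v a) (\<lambda>v. \<Sum>a\<in>{..<n}. t a * v a)
        = (\<integral>v. (\<Sum>a<n. \<Sum>b<n. t a * t b * (v a * v b)) \<partial>N')"
      unfolding inner_rv_def sum_product by (simp add: algebra_simps)
    also have "\<dots> = (\<Sum>a<n. \<Sum>b<n. t a * t b * S $$ (a, b))"
    proof -
      have i: "integrable N' (\<lambda>v. t a * t b * (v a * v b))" if "a \<in> {..<n}" "b \<in> {..<n}" for a b
        using that centered_gaussian_integrable_mult[OF cg1 cg1] by auto
      show ?thesis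
        by (subst Bochner_Integration.integral_sum, rule Bochner_Integration.integrable_sum, rule i, simp, simp,
            rule sum.cong, simp, subst Bochner_Integration.integral_sum, rule i, simp, simp)
           (auto intro!: sum.cong simp: cov)
    qed
    finally show ?thesis using centered_gaussian_char[OF cg, of 1 t] by simp
  qed
  have uniq: "N' = N"
    if "sets N' = sets (\<Pi>\<^sub>M a\<in>{..<n}. (borel :: real measure))"
      "prob_space N'" "gaussian_vector N' {..<n} (\<lambda>a v. v a)"
      "\<And>a. a < n \<Longrightarrow> rv_mean N' (\<lambda>v. v a) = 0"
      "var_mat N' (map (\<lambda>a v. v a) [0..<n]) = S" for N'
  proof (rule PiM_char_uniqueness[OF _ that(2) p that(1) s])
    show "(\<integral>v. iexp (\<Sum>i\<in>{..<n}. t i * v i) \<partial>N') = (\<integral>v. iexp (\<Sum>i\<in>{..<n}. t i * v i) \<partial>N)" for t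
      by (rule trans[OF char[OF that] char[OF s p g z v, symmetric]])
  qed simp
  have d: "dim_row S = n" using S by auto
  show ?thesis
    unfolding centered_gaussian_law_def d
  proof (rule the_equality)
    show "sets N = sets (\<Pi>\<^sub>M a\<in>{..<n}. (borel :: real measure)) \<and> prob_space N \<and>
       gaussian_vector N {..<n} (\<lambda>a v. v a) \<and> (\<forall>a<n. rv_mean N (\<lambda>v. v a) = 0) \<and>
       var_mat N (map (\<lambda>a v. v a) [0..<n]) = S" using s p g z v by blast
  qed (use uniq in blast)
qed

section \<open>Independence of orthogonal Gaussian variables\<close>

abbreviation std_gauss :: "nat \<Rightarrow> (nat \<Rightarrow> real) measure" where
  "std_gauss k \<equiv> \<Pi>\<^sub>M i\<in>{..<k}. std_normal_distribution"

lemma prob_space_std_normal: "prob_space std_normal_distribution"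
  using prob_space_normal_density[of 1 0] by simp

lemma prob_space_std_gauss: "prob_space (std_gauss k)"
  by (intro prob_space_PiM prob_space_std_normal)

lemma sets_std_gauss [measurable_cong]: "sets (std_gauss k) = sets (\<Pi>\<^sub>M i\<in>{..<k}. borel)"
  by (intro sets_PiM_cong) auto

lemma sum_lessThan_add: "(\<Sum>i<k + l. g i) = (\<Sum>i<k. g i) + (\<Sum>i<l. g (k + i))"
  for g :: "nat \<Rightarrow> 'a :: comm_monoid_add"
  by (induction l) (auto simp: add.assoc)

lemma char_std_gauss:
  "(\<integral>x. iexp (\<Sum>i<k. t i * x i) \<partial>std_gauss k) = complex_of_real (exp (- (\<Sum>i<k. (t i)\<^sup>2) / 2))"
proof -
  interpret N: prob_space std_normal_distribution by (rule prob_space_std_normal)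
  interpret product_sigma_finite "\<lambda>_ :: nat. std_normal_distribution"
    by unfold_locales
  have "(\<integral>x. iexp (\<Sum>i<k. t i * x i) \<partial>std_gauss k) = (\<integral>x. (\<Prod>i<k. iexp (t i * x i)) \<partial>std_gauss k)"
    by (simp add: exp_sum sum_distrib_left)
  also have "\<dots> = (\<Prod>i<k. \<integral>x. iexp (t i * x) \<partial>std_normal_distribution)"
    by (rule product_integral_prod) (auto intro!: N.integrable_iexp)
  also have "\<dots> = (\<Prod>i<k. complex_of_real (exp (- (t i)\<^sup>2 / 2)))"
    using char_std_normal_distribution by (simp add: char_def fun_eq_iff)
  also have "\<dots> = complex_of_real (exp (- (\<Sum>i<k. (t i)\<^sup>2) / 2))"
  proof -
    have "- (\<Sum>i<k. (t i)\<^sup>2) / 2 = (\<Sum>i<k. - (t i)\<^sup>2 / 2)"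
      by (simp add: sum_negf sum_divide_distrib)
    then show ?thesis by (simp only: exp_sum[OF finite_lessThan] of_real_prod)
  qed
  finally show ?thesis .
qed

context gaussian_space
begin

text \<open>Orthogonality within a Gaussian space is independence: the joint characteristic function
  of \<open>e\<close> and \<open>R\<close> splits into a product, so the joint law is
  \<open>std_gauss k\<close> times the law of \<open>R\<close>. The \<open>R i\<close> themselves
  may be correlated and degenerate.\<close>

lemma nn_integral_orthonormal:
  assumes e: "\<And>j. j < k \<Longrightarrow> e j \<in> H"
    and o: "\<And>i j. i < k \<Longrightarrow> j < k \<Longrightarrow> inner_rv M (e i) (e j) = (if i = j then 1 else 0)"
    and R: "\<And>i. i < l \<Longrightarrow> R i \<in> H"
    and z: "\<And>i j. i < l \<Longrightarrow> j < k \<Longrightarrow> inner_rv M (R i) (e j) = 0"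
    and F: "F \<in> borel_measurable (\<Pi>\<^sub>M i\<in>{..<k + l}. (borel :: real measure))"
  shows "(\<integral>\<^sup>+w. F (\<lambda>i\<in>{..<k + l}. if i < k then e i w else R (i - k) w) \<partial>M) =
    (\<integral>\<^sup>+x. \<integral>\<^sup>+w. F (\<lambda>i\<in>{..<k + l}. if i < k then x i else R (i - k) w) \<partial>M \<partial>std_gauss k)"
proof -
  interpret G: prob_space "std_gauss k" by (rule prob_space_std_gauss)
  interpret P: pair_prob_space "std_gauss k" M ..
  have em [measurable]: "e j \<in> borel_measurable M" if "j < k" for j using e[OF that] by (rule meas)
  have Rm [measurable]: "R i \<in> borel_measurable M" if "i < l" for i using R[OF that] by (rule meas)
  define f1 where "f1 w = (\<lambda>i\<in>{..<k + l}. if i < k then e i w else R (i - k) w)" for w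
  define f2 where "f2 p = (\<lambda>i\<in>{..<k + l}. if i < k then fst p i else R (i - k) (snd p))" for p :: "(nat \<Rightarrow> real) \<times> 'w"
  have f1 [measurable]: "f1 \<in> M \<rightarrow>\<^sub>M (\<Pi>\<^sub>M i\<in>{..<k + l}. borel)"
    unfolding f1_def
  proof (rule measurable_restrict)
    fix i assume "i \<in> {..<k + l}"
    then show "(\<lambda>w. if i < k then e i w else R (i - k) w) \<in> borel_measurable M"
      by (cases "i < k") auto
  qed
  have f2 [measurable]: "f2 \<in> (std_gauss k \<Otimes>\<^sub>M M) \<rightarrow>\<^sub>M (\<Pi>\<^sub>M i\<in>{..<k + l}. borel)"
    unfolding f2_def
  proof (rule measurable_restrict)
    fix i assume i: "i \<in> {..<k + l}"
    show "(\<lambda>p. if i < k then fst p i else R (i - k) (snd p)) \<in> borel_measurable (std_gauss k \<Otimes>\<^sub>M M)"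
    proof (cases "i < k")
      case True
      then have "i \<in> {..<k}" by simp
      then show ?thesis using True by simp
    next
      case False
      then have "i - k < l" using i by auto
      then show ?thesis using False by simp
    qed
  qed
  define N1 where "N1 = distr M (\<Pi>\<^sub>M i\<in>{..<k + l}. borel) f1"
  define N2 where "N2 = distr (std_gauss k \<Otimes>\<^sub>M M) (\<Pi>\<^sub>M i\<in>{..<k + l}. borel) f2"
  have "N1 = N2"
  proof (rule PiM_char_uniqueness[of "{..<k + l}"])
    show "prob_space N1" "prob_space N2"
      unfolding N1_def N2_def by (auto intro!: prob_space_distr P.prob_space_distr)
    fix t :: "nat \<Rightarrow> real"
    define X where "X w = (\<Sum>i<k. t i * e i w)" for w
    define Y where "Y w = (\<Sum>i<l. t (k + i) * R i w)" for w
    have X: "X \<in> H" unfolding X_def[abs_def] by (rule sum_mem) (simp add: e)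
    have Y: "Y \<in> H" unfolding Y_def[abs_def] by (rule sum_mem) (simp add: R)
    have [measurable]: "X \<in> borel_measurable M" "Y \<in> borel_measurable M" using X Y meas by auto
    have xx: "inner_rv M X X = (\<Sum>i<k. (t i)\<^sup>2)"
    proof -
      have eX: "inner_rv M (e i) X = t i" if "i < k" for i
      proof -
        have "inner_rv M (e i) X = (\<Sum>j<k. t j * inner_rv M (e i) (e j))"
          unfolding X_def[abs_def] by (rule inner_sum_right) (simp_all add: e that)
        also have "\<dots> = (\<Sum>j<k. if j = i then t j else 0)" by (rule sum.cong) (auto simp: o that)
        finally show ?thesis using that by simp
      qed
      have "inner_rv M X X = (\<Sum>i<k. t i * inner_rv M (e i) X)"
        by (subst (1) X_def[abs_def], rule inner_sum_left) (simp_all add: e X)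
      then show ?thesis by (simp add: eX power2_eq_square)
    qed
    have yx: "inner_rv M Y X = 0"
    proof -
      have "inner_rv M (R i) X = 0" if "i < l" for i
        unfolding X_def[abs_def] using that by (subst inner_sum_right) (simp_all add: e R z)
      then show ?thesis
        unfolding Y_def[abs_def] by (subst inner_sum_left) (simp_all add: R X)
    qed
    have XY: "(\<lambda>w. X w + Y w) \<in> H" by (rule add_mem[OF X Y])
    \<comment> \<open>The cross term vanishes, so the variance of the sum is the sum of the
      variances and the exponential factors.\<close>
    have "inner_rv M (\<lambda>w. X w + Y w) (\<lambda>w. X w + Y w) = inner_rv M X X + inner_rv M Y Y"
    proof -
      have "inner_rv M (\<lambda>w. X w + Y w) (\<lambda>w. X w + Y w) = inner_rv M X (\<lambda>w. X w + Y w) + inner_rv M Y (\<lambda>w. X w + Y w)"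
        using inner_lincomb[OF X Y XY, of 1 1] by simp
      also have "inner_rv M X (\<lambda>w. X w + Y w) = inner_rv M X X + inner_rv M Y X"
        using inner_lincomb[OF X Y X, of 1 1] by (subst inner_rv_commute) simp
      also have "inner_rv M Y (\<lambda>w. X w + Y w) = inner_rv M X Y + inner_rv M Y Y"
        using inner_lincomb[OF X Y Y, of 1 1] by (subst inner_rv_commute) simp
      also have "inner_rv M X Y = inner_rv M Y X" by (rule inner_rv_commute)
      finally show ?thesis using yx by simp
    qed
    then have c1: "(\<integral>w. iexp (X w + Y w) \<partial>M) =
        complex_of_real (exp (- (\<Sum>i<k. (t i)\<^sup>2) / 2)) * complex_of_real (exp (- inner_rv M Y Y / 2))"
      using centered_gaussian_char[OF gauss[OF XY], of 1]
      by (simp add: xx exp_add[symmetric] add_divide_distrib flip: of_real_mult)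
    have "(\<integral>v. iexp (\<Sum>i<k + l. t i * v i) \<partial>N1) = (\<integral>w. iexp (\<Sum>i<k + l. t i * f1 w i) \<partial>M)"
      unfolding N1_def by (subst integral_distr) auto
    also have "(\<lambda>w. \<Sum>i<k + l. t i * f1 w i) = (\<lambda>w. X w + Y w)"
      by (auto simp: f1_def X_def Y_def sum_lessThan_add)
    finally have l1: "(\<integral>v. iexp (\<Sum>i<k + l. t i * v i) \<partial>N1) = (\<integral>w. iexp (X w + Y w) \<partial>M)" .
    have "(\<integral>v. iexp (\<Sum>i<k + l. t i * v i) \<partial>N2) = (\<integral>p. iexp (\<Sum>i<k + l. t i * f2 p i) \<partial>(std_gauss k \<Otimes>\<^sub>M M))"
      unfolding N2_def by (subst integral_distr) auto
    also have "(\<lambda>p. \<Sum>i<k + l. t i * f2 p i) = (\<lambda>p. (\<Sum>i<k. t i * fst p i) + Y (snd p))"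
      by (auto simp: f2_def Y_def sum_lessThan_add)
    also have "(\<integral>p. iexp ((\<Sum>i<k. t i * fst p i) + Y (snd p)) \<partial>(std_gauss k \<Otimes>\<^sub>M M)) =
       (\<integral>x. \<integral>w. iexp ((\<Sum>i<k. t i * x i) + Y w) \<partial>M \<partial>std_gauss k)"
    proof -
      have "integrable (std_gauss k \<Otimes>\<^sub>M M) (\<lambda>p. iexp ((\<Sum>i<k. t i * fst p i) + Y (snd p)))"
      proof (rule P.integrable_const_bound[of _ 1])
        have "(\<lambda>p. fst p i) \<in> borel_measurable (std_gauss k \<Otimes>\<^sub>M M)" if "i < k" for i
        proof -
          from that have "i \<in> {..<k}" by simp
          then show ?thesis by measurable
        qed
        then have "(\<lambda>p. (\<Sum>i<k. t i * fst p i) + Y (snd p)) \<in> borel_measurable (std_gauss k \<Otimes>\<^sub>M M)"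
          by (intro borel_measurable_add borel_measurable_sum borel_measurable_times) auto
        then show "(\<lambda>p. iexp ((\<Sum>i<k. t i * fst p i) + Y (snd p))) \<in> borel_measurable (std_gauss k \<Otimes>\<^sub>M M)"
          by measurable
      qed auto
      from P.integral_fst'[OF this] show ?thesis by simp
    qed
    also have "\<dots> = (\<integral>x. iexp (\<Sum>i<k. t i * x i) * complex_of_real (exp (- inner_rv M Y Y / 2)) \<partial>std_gauss k)"
      using centered_gaussian_char[OF gauss[OF Y], of 1]
      by (simp add: exp_add ring_distribs)
    also have "\<dots> = complex_of_real (exp (- (\<Sum>i<k. (t i)\<^sup>2) / 2)) * complex_of_real (exp (- inner_rv M Y Y / 2))"
      using char_std_gauss[where k=k and t=t] by simp
    finally show "(\<integral>v. iexp (\<Sum>i<k + l. t i * v i) \<partial>N1) = (\<integral>v. iexp (\<Sum>i<k + l. t i * v i) \<partial>N2)"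
      unfolding l1 c1 by simp
  qed (auto simp: N1_def N2_def)
  have "(\<integral>\<^sup>+w. F (f1 w) \<partial>M) = (\<integral>\<^sup>+v. F v \<partial>N1)" unfolding N1_def using F by (subst nn_integral_distr) auto
  also have "\<dots> = (\<integral>\<^sup>+v. F v \<partial>N2)" by (simp add: \<open>N1 = N2\<close>)
  also have "\<dots> = (\<integral>\<^sup>+p. F (f2 p) \<partial>(std_gauss k \<Otimes>\<^sub>M M))" unfolding N2_def using F by (subst nn_integral_distr) auto
  also have "\<dots> = (\<integral>\<^sup>+x. \<integral>\<^sup>+w. F (f2 (x, w)) \<partial>M \<partial>std_gauss k)"
    using measurable_compose[OF f2 F] by (subst nn_integral_fst[symmetric]) auto
  finally show ?thesis unfolding f1_def f2_def fst_conv snd_conv .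
qed

end

section \<open>Triangular linear changes of variables\<close>

abbreviation leb :: "nat \<Rightarrow> (nat \<Rightarrow> real) measure" where
  "leb k \<equiv> \<Pi>\<^sub>M i\<in>{..<k}. lborel"

lemma sets_leb [measurable_cong]: "sets (leb k) = sets (\<Pi>\<^sub>M i\<in>{..<k}. borel)"
  by (intro sets_PiM_cong) auto

interpretation lborel_product: product_sigma_finite "\<lambda>_ :: nat. lborel :: real measure"
  by unfold_locales

lemma std_gauss_eq_density:
  "std_gauss k = density (leb k) (\<lambda>x. \<Prod>i<k. ennreal (std_normal_density (x i)))"
proof -
  interpret N: prob_space std_normal_distribution by (rule prob_space_std_normal)
  interpret product_sigma_finite "\<lambda>_ :: nat. std_normal_distribution" by unfold_locales
  have m: "(\<lambda>x. \<Prod>i<k. ennreal (std_normal_density (x i))) \<in> borel_measurable (leb k)"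
    by (intro borel_measurable_prod_ennreal) measurable
  show ?thesis
  proof (rule PiM_eqI[symmetric])
    show "sets (density (leb k) (\<lambda>x. \<Prod>i<k. ennreal (std_normal_density (x i)))) = sets (std_gauss k)"
      using sets_leb sets_std_gauss by simp
    fix A :: "nat \<Rightarrow> real set" assume A: "\<And>i. i \<in> {..<k} \<Longrightarrow> A i \<in> sets std_normal_distribution"
    have B: "Pi\<^sub>E {..<k} A \<in> sets (leb k)" using A by (intro sets_PiM_I_finite) auto
    have "emeasure (density (leb k) (\<lambda>x. \<Prod>i<k. ennreal (std_normal_density (x i)))) (Pi\<^sub>E {..<k} A)
      = (\<integral>\<^sup>+x. (\<Prod>i<k. ennreal (std_normal_density (x i))) * indicator (Pi\<^sub>E {..<k} A) x \<partial>leb k)"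
      using m B by (rule emeasure_density)
    also have "\<dots> = (\<integral>\<^sup>+x. (\<Prod>i<k. ennreal (std_normal_density (x i)) * indicator (A i) (x i)) \<partial>leb k)"
    proof (rule nn_integral_cong)
      fix x assume "x \<in> space (leb k)"
      then have ext: "x \<in> extensional {..<k}" by (simp add: space_PiM PiE_def)
      have "indicator (Pi\<^sub>E {..<k} A) x = (\<Prod>i<k. indicator (A i) (x i) :: ennreal)"
      proof (cases "x \<in> Pi\<^sub>E {..<k} A")
        case True
        then have "(\<Prod>i<k. indicator (A i) (x i)) = (\<Prod>i<k. 1 :: ennreal)"
          by (intro prod.cong) (auto simp: indicator_def PiE_iff)
        then show ?thesis using True by simp
      next
        case False
        then obtain i where "i \<in> {..<k}" "x i \<notin> A i" using ext unfolding PiE_iff by blast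
        then have "(\<Prod>i<k. indicator (A i) (x i) :: ennreal) = 0" by (intro prod_zero bexI[of _ i]) auto
        then show ?thesis using False by simp
      qed
      then show "(\<Prod>i<k. ennreal (std_normal_density (x i))) * indicator (Pi\<^sub>E {..<k} A) x =
         (\<Prod>i<k. ennreal (std_normal_density (x i)) * indicator (A i) (x i))"
        by (simp add: prod.distrib)
    qed
    also have "\<dots> = (\<Prod>i<k. \<integral>\<^sup>+x. ennreal (std_normal_density x) * indicator (A i) x \<partial>lborel)"
      using A by (subst lborel_product.product_nn_integral_prod) auto
    also have "\<dots> = (\<Prod>i<k. emeasure std_normal_distribution (A i))"
      using A by (intro prod.cong refl) (simp add: emeasure_density)
    finally show "emeasure (density (leb k) (\<lambda>x. \<Prod>i<k. ennreal (std_normal_density (x i)))) (Pi\<^sub>E {..<k} A)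
      = (\<Prod>i<k. emeasure std_normal_distribution (A i))" .
  qed simp
qed

lemma nn_integral_std_gauss:
  assumes "F \<in> borel_measurable (leb k)"
  shows "(\<integral>\<^sup>+x. F x \<partial>std_gauss k) = (\<integral>\<^sup>+x. (\<Prod>i<k. ennreal (std_normal_density (x i))) * F x \<partial>leb k)"
  unfolding std_gauss_eq_density
  by (intro nn_integral_density borel_measurable_prod_ennreal assms) measurable

text \<open>Invertibility is built in through the diagonal, and only entries with indices below
  \<open>k\<close> are constrained.\<close>

definition lower_triangular :: "nat \<Rightarrow> (nat \<Rightarrow> nat \<Rightarrow> real) \<Rightarrow> bool" where
  "lower_triangular k A \<longleftrightarrow> (\<forall>i<k. A i i \<noteq> 0) \<and> (\<forall>i<k. \<forall>j<k. i < j \<longrightarrow> A i j = 0)"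

text \<open>Fubini with the last coordinate innermost: \<open>x k\<close> enters only row
  \<open>k\<close>, where it is scaled by \<open>A k k\<close> and shifted by the other coordinates,
  so a one-dimensional affine substitution yields the factor \<open>1 / |A k k|\<close>.\<close>

lemma nn_integral_lower_triangular:
  assumes "lower_triangular k A" "F \<in> borel_measurable (leb k)"
  shows "(\<integral>\<^sup>+x. F (\<lambda>i\<in>{..<k}. \<Sum>j<k. A i j * x j) \<partial>leb k) =
    ennreal (\<Prod>i<k. 1 / \<bar>A i i\<bar>) * (\<integral>\<^sup>+u. F u \<partial>leb k)"
  using assms
proof (induction k arbitrary: F)
  case 0
  have "(\<lambda>i\<in>{..<0::nat}. \<Sum>j<0. A i j * x j) = (\<lambda>_. undefined)" for x :: "nat \<Rightarrow> real" by auto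
  then show ?case by (simp add: PiM_empty nn_integral_count_space_finite)
next
  case (Suc k)
  note F [measurable] = Suc.prems(2)
  have tri: "lower_triangular k A" and a: "A k k \<noteq> 0" and z: "\<And>i. i < k \<Longrightarrow> A i k = 0"
    using Suc.prems(1) by (auto simp: lower_triangular_def)
  have ins: "{..<Suc k} = insert k {..<k}" by auto
  define G where "G x = (\<integral>\<^sup>+y. F (x(k := y)) \<partial>lborel)" for x
  have upd: "(\<lambda>(x, y). x(k := y)) \<in> (leb k \<Otimes>\<^sub>M lborel) \<rightarrow>\<^sub>M leb (Suc k)"
    unfolding ins by (rule measurable_add_dim)
  have Fupd [measurable]: "(\<lambda>(x, y). F (x(k := y))) \<in> borel_measurable (leb k \<Otimes>\<^sub>M lborel)"
    using measurable_compose[OF upd F] by (simp add: case_prod_beta' fun_upd_def)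
  have G: "G \<in> borel_measurable (leb k)"
    unfolding G_def using lborel.borel_measurable_nn_integral[OF Fupd] by simp
  have lin: "(\<lambda>x. \<lambda>i\<in>{..<n}. \<Sum>j<n. A i j * x j) \<in> leb n \<rightarrow>\<^sub>M leb n" for n
  proof (rule measurable_restrict)
    fix i assume "i \<in> {..<n}"
    have "(\<lambda>x. x j) \<in> borel_measurable (leb n)" if "j \<in> {..<n}" for j using that by measurable
    then have "(\<lambda>x. \<Sum>j<n. A i j * x j) \<in> borel_measurable (leb n)" by (intro borel_measurable_sum borel_measurable_times) auto
    then show "(\<lambda>x. \<Sum>j<n. A i j * x j) \<in> leb n \<rightarrow>\<^sub>M lborel" by simp
  qed
  have "(\<integral>\<^sup>+x. F (\<lambda>i\<in>{..<Suc k}. \<Sum>j<Suc k. A i j * x j) \<partial>leb (Suc k)) =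
    (\<integral>\<^sup>+x. \<integral>\<^sup>+y. F (\<lambda>i\<in>{..<Suc k}. \<Sum>j<Suc k. A i j * (x(k := y)) j) \<partial>lborel \<partial>leb k)"
  proof -
    have nk: "k \<notin> {..<k}" by simp
    have Fl: "(\<lambda>x. F (\<lambda>i\<in>{..<Suc k}. \<Sum>j<Suc k. A i j * x j)) \<in> borel_measurable (Pi\<^sub>M (insert k {..<k}) (\<lambda>_. lborel))"
      using measurable_compose[OF lin F] unfolding ins[symmetric] .
    show ?thesis
      by (rule lborel_product.product_nn_integral_insert[OF finite_lessThan nk Fl, folded ins])
  qed
  also have "\<dots> = (\<integral>\<^sup>+x. ennreal (1 / \<bar>A k k\<bar>) * G (\<lambda>i\<in>{..<k}. \<Sum>j<k. A i j * x j) \<partial>leb k)"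
  proof (rule nn_integral_cong)
    fix x assume "x \<in> space (leb k)"
    define x' where "x' = (\<lambda>i\<in>{..<k}. \<Sum>j<k. A i j * x j)"
    define c where "c = (\<Sum>j<k. A k j * x j)"
    have e: "(\<lambda>i\<in>{..<Suc k}. \<Sum>j<Suc k. A i j * (x(k := y)) j) = x'(k := c + A k k * y)" for y
    proof
      fix i
      have "(\<Sum>j<k. A i j * (if j = k then y else x j)) = (\<Sum>j<k. A i j * x j)" for i by (rule sum.cong) auto
      then show "(\<lambda>i\<in>{..<Suc k}. \<Sum>j<Suc k. A i j * (x(k := y)) j) i = (x'(k := c + A k k * y)) i"
        by (auto simp: x'_def c_def z less_Suc_eq)
    qed
    have x': "x' \<in> space (leb k)" by (auto simp: x'_def space_PiM)
    have Fx: "(\<lambda>y. F (x'(k := y))) \<in> borel_measurable lborel"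
      using measurable_compose[OF measurable_Pair1'[OF x'] Fupd] by simp
    have "G x' = \<bar>A k k\<bar> * (\<integral>\<^sup>+y. F (x'(k := c + A k k * y)) \<partial>lborel)"
      unfolding G_def using Fx a by (subst nn_integral_real_affine[of _ "A k k" c]) auto
    then have "ennreal (1 / \<bar>A k k\<bar>) * G x' = (\<integral>\<^sup>+y. F (x'(k := c + A k k * y)) \<partial>lborel)"
      using a by (simp add: mult.assoc[symmetric] ennreal_mult[symmetric])
    then show "(\<integral>\<^sup>+y. F (\<lambda>i\<in>{..<Suc k}. \<Sum>j<Suc k. A i j * (x(k := y)) j) \<partial>lborel) = ennreal (1 / \<bar>A k k\<bar>) * G (\<lambda>i\<in>{..<k}. \<Sum>j<k. A i j * x j)"
      unfolding e x'_def by simp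
  qed
  also have "\<dots> = ennreal (1 / \<bar>A k k\<bar>) * (\<integral>\<^sup>+x. G (\<lambda>i\<in>{..<k}. \<Sum>j<k. A i j * x j) \<partial>leb k)"
    using measurable_compose[OF lin G] by (intro nn_integral_cmult)
  also have "\<dots> = ennreal (1 / \<bar>A k k\<bar>) * (ennreal (\<Prod>i<k. 1 / \<bar>A i i\<bar>) * (\<integral>\<^sup>+x. G x \<partial>leb k))"
    by (simp only: Suc.IH[OF tri G])
  also have "(\<integral>\<^sup>+x. G x \<partial>leb k) = (\<integral>\<^sup>+u. F u \<partial>leb (Suc k))"
    using F unfolding ins G_def by (subst lborel_product.product_nn_integral_insert) auto
  finally show ?case
    by (simp add: mult.assoc[symmetric] ennreal_mult[symmetric] prod_nonneg mult.commute del: ennreal_mult)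
qed

section \<open>Probability of simultaneous crossings\<close>

definition step :: "real \<Rightarrow> real \<Rightarrow> ennreal" where
  "step a b = (if \<bar>a\<bar> < \<bar>b\<bar> then 1 else 0)"

lemma measurable_step [measurable]:
  assumes [measurable]: "f \<in> borel_measurable N" "g \<in> borel_measurable N"
  shows "(\<lambda>x. step (f x) (g x)) \<in> borel_measurable N"
  unfolding step_def by measurable

text \<open>The modulus in the Kac--Rice density originates here: a crossing occupies an interval of
  length \<open>2 |b|\<close>.\<close>

lemma nn_integral_step: "(\<integral>\<^sup>+a. step a b \<partial>lborel) = ennreal (2 * \<bar>b\<bar>)"
proof -
  have "(\<integral>\<^sup>+a. step a b \<partial>lborel) = (\<integral>\<^sup>+a. indicator {-\<bar>b\<bar><..<\<bar>b\<bar>} a \<partial>lborel)"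
    by (intro nn_integral_cong) (auto simp: step_def indicator_def)
  then show ?thesis by simp
qed

lemma step_le_1: "step a b \<le> 1" by (simp add: step_def)

lemma prod_step_le_1: "(\<Prod>i\<in>I. step (u i) (v i)) \<le> 1"
  by (intro prod_le_1) (simp add: step_le_1)

lemma prod_step_eq: "finite I \<Longrightarrow> (\<Prod>i\<in>I. step (u i) (v i)) = (if \<forall>i\<in>I. \<bar>u i\<bar> < \<bar>v i\<bar> then 1 else 0)"
  by (induction I rule: finite_induct) (auto simp: step_def)

definition lin :: "nat \<Rightarrow> (nat \<Rightarrow> nat \<Rightarrow> real) \<Rightarrow> (nat \<Rightarrow> real) \<Rightarrow> nat \<Rightarrow> real" where
  "lin k A v i = (\<Sum>j<k. A i j * v j)"

lemma lin_cong: "(\<And>j. j < k \<Longrightarrow> v j = w j) \<Longrightarrow> lin k A v i = lin k A w i"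
  unfolding lin_def by (intro sum.cong) auto

lemma lin_scale: "lin k A (\<lambda>j. c * v j) i = c * lin k A v i"
  by (simp add: lin_def sum_distrib_left algebra_simps)

lemma measurable_lin [measurable (raw)]:
  assumes "\<And>j. j < k \<Longrightarrow> (\<lambda>x. v x j) \<in> borel_measurable N"
  shows "(\<lambda>x. lin k A (v x) i) \<in> borel_measurable N"
  unfolding lin_def using assms by (intro borel_measurable_sum borel_measurable_times) auto

lemma measurable_leb_component [measurable (raw)]:
  assumes "i < k" shows "(\<lambda>u. u i) \<in> borel_measurable (leb k)"
proof -
  from assms have "i \<in> {..<k}" by simp
  then show ?thesis by measurable
qed

text \<open>Up to a constant, the probability of the crossings \<open>\<bar>S i\<bar> < h \<bar>D i\<bar>\<close> divided by \<open>h\<^sup>k\<close>, where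
  \<open>A S\<close> is orthonormal and \<open>D = B S + R\<close> with \<open>R\<close> independent of \<open>S\<close>.\<close>

definition crossing ::
  "'w measure \<Rightarrow> nat \<Rightarrow> (nat \<Rightarrow> nat \<Rightarrow> real) \<Rightarrow> (nat \<Rightarrow> nat \<Rightarrow> real) \<Rightarrow> (nat \<Rightarrow> 'w \<Rightarrow> real) \<Rightarrow> real \<Rightarrow> ennreal" where
  "crossing M k A B R h = (\<integral>\<^sup>+u. (\<Prod>j<k. ennreal (std_normal_density (h * lin k A u j))) *
     (\<integral>\<^sup>+w. (\<Prod>i<k. step (u i) (h * lin k B u i + R i w)) \<partial>M) \<partial>leb k)"

lemma (in prob_space) measurable_crossing_inner:
  assumes R: "\<And>i. i < k \<Longrightarrow> R i \<in> borel_measurable M"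
    and f: "\<And>i. i < k \<Longrightarrow> (\<lambda>u. f u i) \<in> borel_measurable N"
    and g: "\<And>i. i < k \<Longrightarrow> (\<lambda>u. g u i) \<in> borel_measurable N"
  shows "(\<lambda>u. \<integral>\<^sup>+w. (\<Prod>i<k. step (f u i) (g u i + R i w)) \<partial>M) \<in> borel_measurable N"
    and "(\<lambda>(u, w). \<Prod>i<k. step (f u i) (g u i + R i w)) \<in> borel_measurable (N \<Otimes>\<^sub>M M)"
proof -
  show *: "(\<lambda>(u, w). \<Prod>i<k. step (f u i) (g u i + R i w)) \<in> borel_measurable (N \<Otimes>\<^sub>M M)"
    unfolding case_prod_beta'
  proof (intro borel_measurable_prod_ennreal measurable_step borel_measurable_add)
    fix i assume "i \<in> {..<k}"
    then have i: "i < k" by simp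
    show "(\<lambda>x. f (fst x) i) \<in> borel_measurable (N \<Otimes>\<^sub>M M)" "(\<lambda>x. g (fst x) i) \<in> borel_measurable (N \<Otimes>\<^sub>M M)"
      "(\<lambda>x. R i (snd x)) \<in> borel_measurable (N \<Otimes>\<^sub>M M)"
      by (rule measurable_compose[OF measurable_fst f[OF i]] measurable_compose[OF measurable_fst g[OF i]]
          measurable_compose[OF measurable_snd R[OF i]])+
  qed
  show "(\<lambda>u. \<integral>\<^sup>+w. (\<Prod>i<k. step (f u i) (g u i + R i w)) \<partial>M) \<in> borel_measurable N"
    by (rule borel_measurable_nn_integral[OF *])
qed

lemma (in prob_space) measurable_crossing_integrand:
  assumes R: "\<And>i. i < k \<Longrightarrow> R i \<in> borel_measurable M"
  shows "(\<lambda>u. (\<Prod>j<k. ennreal (std_normal_density (h * lin k A u j))) *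
     (\<integral>\<^sup>+w. (\<Prod>i<k. step (u i) (h * lin k B u i + R i w)) \<partial>M)) \<in> borel_measurable (leb k)"
  by (intro borel_measurable_times_ennreal borel_measurable_prod_ennreal measurable_crossing_inner R
      measurable_compose[OF _ measurable_ennreal] measurable_compose[OF _ borel_measurable_normal_density]
      borel_measurable_times borel_measurable_const measurable_lin measurable_leb_component) auto

text \<open>With \<open>S = L e\<close>, the family \<open>e\<close> is standard normal and
  independent of \<open>R\<close>, so the event is integrated against the Gaussian density of
  \<open>e\<close>. In the blown-up coordinates \<open>u = S / h\<close> this density is evaluated
  at \<open>h A u\<close>, and the part of \<open>D\<close> that depends on \<open>S\<close> carries
  a factor \<open>h\<close>, which makes it disappear as \<open>h\<close> tends to 0.\<close>

lemma (in gaussian_space) emeasure_crossing: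
  assumes e: "\<And>j. j < k \<Longrightarrow> e j \<in> H"
    and o: "\<And>i j. i < k \<Longrightarrow> j < k \<Longrightarrow> inner_rv M (e i) (e j) = (if i = j then 1 else 0)"
    and R: "\<And>i. i < k \<Longrightarrow> R i \<in> H"
    and z: "\<And>i j. i < k \<Longrightarrow> j < k \<Longrightarrow> inner_rv M (R i) (e j) = 0"
    and L: "lower_triangular k L"
    and AL: "\<And>v i. i < k \<Longrightarrow> lin k A (lin k L v) i = v i"
    and S: "\<And>i w. i < k \<Longrightarrow> S i w = lin k L (\<lambda>j. e j w) i"
    and D: "\<And>i w. i < k \<Longrightarrow> D i w = lin k B (\<lambda>j. S j w) i + R i w"
    and h: "h > 0"
  shows "emeasure M {w \<in> space M. \<forall>i<k. \<bar>S i w\<bar> < h * \<bar>D i w\<bar>} =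
    ennreal (h ^ k * (\<Prod>j<k. 1 / \<bar>L j j\<bar>)) * crossing M k A B R h"
proof -
  have Rm: "R i \<in> borel_measurable M" if "i < k" for i using R[OF that] by (rule meas)
  have em: "e i \<in> borel_measurable M" if "i < k" for i using e[OF that] by (rule meas)
  have Sm: "S i \<in> borel_measurable M" if "i < k" for i
    unfolding S[OF that, abs_def] by (rule measurable_lin) (rule em)
  have Dm: "D i \<in> borel_measurable M" if "i < k" for i
    unfolding D[OF that, abs_def] by (intro borel_measurable_add measurable_lin Rm Sm that)
  \<comment> \<open>Coordinates below \<open>k\<close> stand for the frame \<open>e\<close>,
    coordinate \<open>k + i\<close> for \<open>R i\<close>.\<close>
  define F where "F v = (\<Prod>i<k. step (lin k L v i) (h * (lin k B (lin k L v) i + v (k + i))))" for v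
  have F: "F \<in> borel_measurable (\<Pi>\<^sub>M i\<in>{..<k + k}. borel)"
  proof -
    have c: "(\<lambda>v. v i) \<in> borel_measurable (\<Pi>\<^sub>M i\<in>{..<k + k}. (borel :: real measure))" if "i < k + k" for i
    proof -
      from that have "i \<in> {..<k + k}" by simp
      then show ?thesis by measurable
    qed
    show ?thesis unfolding F_def
      by (intro borel_measurable_prod_ennreal measurable_step borel_measurable_times borel_measurable_const
          borel_measurable_add measurable_lin c) auto
  qed
  define G where "G u = (\<Prod>j<k. ennreal (std_normal_density (h * lin k A u j))) *
     (\<integral>\<^sup>+w. (\<Prod>i<k. step (u i) (h * lin k B u i + R i w)) \<partial>M)" for u
  have G: "G \<in> borel_measurable (leb k)"
    unfolding G_def by (rule measurable_crossing_integrand) (rule Rm)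
  have LF: "F (\<lambda>i\<in>{..<k + k}. if i < k then x i else R (i - k) w) =
      (\<Prod>i<k. step (lin k L x i) (h * (lin k B (lin k L x) i + R i w)))" for x w
  proof -
    have "lin k L (\<lambda>i\<in>{..<k + k}. if i < k then x i else R (i - k) w) = lin k L x"
      by (rule ext, rule lin_cong) auto
    then show ?thesis by (auto simp: F_def intro!: prod.cong)
  qed
  have "emeasure M {w \<in> space M. \<forall>i<k. \<bar>S i w\<bar> < h * \<bar>D i w\<bar>} =
      (\<integral>\<^sup>+w. indicator {w \<in> space M. \<forall>i<k. \<bar>S i w\<bar> < h * \<bar>D i w\<bar>} w \<partial>M)"
  proof (rule nn_integral_indicator[symmetric])
    have "{w \<in> space M. \<bar>S i w\<bar> < h * \<bar>D i w\<bar>} \<in> sets M" if "i < k" for i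
      using Sm[OF that] Dm[OF that] by measurable
    then have "{w \<in> space M. \<forall>i\<in>{..<k}. \<bar>S i w\<bar> < h * \<bar>D i w\<bar>} \<in> sets M"
      by (intro sets.sets_Collect_finite_All) auto
    then show "{w \<in> space M. \<forall>i<k. \<bar>S i w\<bar> < h * \<bar>D i w\<bar>} \<in> sets M"
      by (simp only: Ball_def lessThan_iff)
  qed
  also have "\<dots> = (\<integral>\<^sup>+w. F (\<lambda>i\<in>{..<k + k}. if i < k then e i w else R (i - k) w) \<partial>M)"
  proof (rule nn_integral_cong)
    fix w assume w: "w \<in> space M"
    have 1: "lin k L (\<lambda>j. e j w) i = S i w" if "i < k" for i by (simp add: S that)
    have 2: "lin k B (lin k L (\<lambda>j. e j w)) i = lin k B (\<lambda>j. S j w) i" for i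
      by (rule lin_cong) (rule 1)
    have "F (\<lambda>i\<in>{..<k + k}. if i < k then e i w else R (i - k) w) = (\<Prod>i<k. step (S i w) (h * D i w))"
      unfolding LF by (rule prod.cong) (auto simp: 1 2 D)
    then show "indicator {w \<in> space M. \<forall>i<k. \<bar>S i w\<bar> < h * \<bar>D i w\<bar>} w = F (\<lambda>i\<in>{..<k + k}. if i < k then e i w else R (i - k) w)"
      using h w by (auto simp: prod_step_eq indicator_def abs_mult)
  qed
  also have "\<dots> = (\<integral>\<^sup>+x. \<integral>\<^sup>+w. F (\<lambda>i\<in>{..<k + k}. if i < k then x i else R (i - k) w) \<partial>M \<partial>std_gauss k)"
    by (rule nn_integral_orthonormal[OF e o R z F])
  also have "\<dots> = (\<integral>\<^sup>+x. (\<Prod>i<k. ennreal (std_normal_density (x i))) *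
     (\<integral>\<^sup>+w. (\<Prod>i<k. step (lin k L x i) (h * (lin k B (lin k L x) i + R i w))) \<partial>M) \<partial>leb k)"
    unfolding LF
  proof (rule nn_integral_std_gauss)
    have "(\<lambda>u. \<integral>\<^sup>+w. (\<Prod>i<k. step (lin k L u i / h) (lin k B (lin k L u) i + R i w)) \<partial>M) \<in> borel_measurable (leb k)"
      by (intro measurable_crossing_inner Rm measurable_lin measurable_leb_component borel_measurable_divide borel_measurable_const)
    moreover have "step (a / h) b = step a (h * b)" for a b
      using h by (simp add: step_def abs_mult abs_divide field_simps)
    ultimately show "(\<lambda>x. \<integral>\<^sup>+w. (\<Prod>i<k. step (lin k L x i) (h * (lin k B (lin k L x) i + R i w))) \<partial>M) \<in> borel_measurable (leb k)"
      by simp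
  qed
  \<comment> \<open>Substitution \<open>u = L x / h\<close>: the inverse \<open>A\<close> recovers
    \<open>x = h A u\<close>, and both sides of each inequality are divided by
    \<open>h\<close>.\<close>
  also have "\<dots> = (\<integral>\<^sup>+x. G (\<lambda>i\<in>{..<k}. \<Sum>j<k. (L i j / h) * x j) \<partial>leb k)"
  proof (rule nn_integral_cong)
    fix x assume "x \<in> space (leb k)"
    define u where "u = (\<lambda>i\<in>{..<k}. \<Sum>j<k. (L i j / h) * x j)"
    have u: "u i = lin k L x i / h" if "i < k" for i
      using that by (simp add: u_def lin_def sum_divide_distrib)
    have "lin k A u i = lin k A (\<lambda>j. (1 / h) * lin k L x j) i" for i
      by (rule lin_cong) (simp add: u)
    then have 1: "h * lin k A u i = x i" if "i < k" for i
      using h that by (simp add: lin_scale AL del: times_divide_eq_left)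
    have "lin k B u i = lin k B (\<lambda>j. (1 / h) * lin k L x j) i" for i
      by (rule lin_cong) (simp add: u)
    then have 2: "h * lin k B u i = lin k B (lin k L x) i" for i
      using h by (simp add: lin_scale del: times_divide_eq_left)
    have st: "step (a / h) b = step a (h * b)" for a b
      using h by (simp add: step_def abs_mult abs_divide field_simps)
    show "(\<Prod>i<k. ennreal (std_normal_density (x i))) *
     (\<integral>\<^sup>+w. (\<Prod>i<k. step (lin k L x i) (h * (lin k B (lin k L x) i + R i w))) \<partial>M) = G (\<lambda>i\<in>{..<k}. \<Sum>j<k. (L i j / h) * x j)"
      unfolding u_def[symmetric] G_def by (simp add: 1 2 u st)
  qed
  also have "\<dots> = ennreal (\<Prod>i<k. 1 / \<bar>L i i / h\<bar>) * (\<integral>\<^sup>+u. G u \<partial>leb k)"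
  proof (rule nn_integral_lower_triangular)
    show "lower_triangular k (\<lambda>i j. L i j / h)" using L h by (auto simp: lower_triangular_def)
  qed (rule G)
  also have "(\<Prod>i<k. 1 / \<bar>L i i / h\<bar>) = h ^ k * (\<Prod>j<k. 1 / \<bar>L j j\<bar>)"
    using h by (simp add: abs_divide prod_dividef)
  finally show ?thesis by (simp add: G_def[abs_def] crossing_def)
qed

section \<open>Continuity of the crossing densities\<close>

text \<open>Each factor is at most the largest one; the summand 1 covers
  \<open>k = 0\<close>.\<close>

lemma prod_le_sum_power:
  fixes a :: "nat \<Rightarrow> real"
  assumes "\<And>i. i < k \<Longrightarrow> a i \<ge> 0"
  shows "(\<Prod>i<k. a i) \<le> 1 + (\<Sum>i<k. a i ^ k)"
proof (cases "k = 0")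
  case False
  then have "a ` {..<k} \<noteq> {}" "finite (a ` {..<k})" by auto
  then have "Max (a ` {..<k}) \<in> a ` {..<k}" by (intro Max_in)
  then obtain i where i: "i < k" "a i = Max (a ` {..<k})" by (metis imageE lessThan_iff)
  have "(\<Prod>j<k. a j) \<le> (\<Prod>j<k. a i)"
    using assms i by (intro prod_mono) auto
  also have "\<dots> = a i ^ k" by simp
  also have "\<dots> \<le> (\<Sum>i<k. a i ^ k)" using assms i by (intro member_le_sum) auto
  finally show ?thesis by simp
qed simp

text \<open>A residual may have variance 0, and its law is then a point mass at 0;
  \<open>c \<noteq> 0\<close> avoids this only possible atom.\<close>

lemma centered_gaussian_atom:
  assumes X: "centered_gaussian M X" and c: "c \<noteq> 0"
  shows "AE w in M. X w \<noteq> c"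
proof -
  have m [measurable]: "X \<in> borel_measurable M" using X by (rule centered_gaussian_measurable)
  obtain s where s: "s \<ge> 0" "distr M borel X = normal_law 0 s" using X by (auto simp: centered_gaussian_def)
  have "AE x in normal_law 0 s. x \<noteq> c"
  proof (cases "s = 0")
    case True
    then have "normal_law 0 s = return borel 0" by (simp add: normal_law_def)
    then show ?thesis using c by (subst \<open>normal_law 0 s = _\<close>, subst AE_return) auto
  next
    case False
    have "AE x in lborel. x \<noteq> c" by (rule AE_lborel_singleton)
    then have "AE x in lborel. 0 < ennreal (normal_density 0 s x) \<longrightarrow> x \<noteq> c" by eventually_elim simp
    moreover have "normal_law 0 s = density lborel (\<lambda>x. ennreal (normal_density 0 s x))"
      using False by (simp add: normal_law_def)
    ultimately show ?thesis by (subst \<open>normal_law 0 s = _\<close>, subst AE_density) auto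
  qed
  then have "AE x in distr M borel X. x \<noteq> c" unfolding s .
  then show ?thesis by (subst (asm) AE_distr_iff) auto
qed

lemma AE_leb_nonzero: "AE u in leb k. \<forall>i<k. u i \<noteq> 0"
proof -
  have "AE u in leb k. u i \<noteq> 0" if i: "i < k" for i
  proof -
    define f :: "nat \<Rightarrow> real \<Rightarrow> ennreal" where "f j = (if j = i then indicator {0} else (\<lambda>_. 1))" for j
    have e: "(\<Prod>j<k. f j (u j)) = indicator {0} (u i)" for u
    proof -
      have "(\<Prod>j<k. f j (u j)) = (\<Prod>j<k. if j = i then indicator {0} (u i) else 1)"
        by (rule prod.cong) (auto simp: f_def)
      then show ?thesis using i by simp
    qed
    have "(\<integral>\<^sup>+u. (\<Prod>j<k. f j (u j)) \<partial>leb k) = (\<Prod>j<k. \<integral>\<^sup>+x. f j x \<partial>lborel)"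
      by (rule lborel_product.product_nn_integral_prod) (auto simp: f_def)
    \<comment> \<open>The other coordinates contribute infinite integrals, but 0 times infinity is 0
      in \<open>ennreal\<close>.\<close>
    also have "\<dots> = 0" using i by (intro prod_zero bexI[of _ i]) (auto simp: f_def)
    finally have "(\<integral>\<^sup>+u. indicator {0} (u i) \<partial>leb k) = 0" unfolding e .
    moreover have "(\<lambda>u. indicator {0} (u i) :: ennreal) \<in> borel_measurable (leb k)"
      by (rule measurable_compose[OF measurable_leb_component[OF i]]) simp
    ultimately have "AE u in leb k. indicator {0} (u i) = (0::ennreal)" by (simp add: nn_integral_0_iff_AE)
    then show ?thesis by eventually_elim (auto simp: indicator_def split: if_splits)
  qed
  then have "AE u in leb k. \<forall>i\<in>{..<k}. u i \<noteq> 0" by (intro AE_finite_allI) auto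
  then show ?thesis by eventually_elim auto
qed

lemma nn_integral_inverse_1_plus_square: "(\<integral>\<^sup>+x. ennreal (inverse (1 + x\<^sup>2)) \<partial>lborel) < \<infinity>"
proof -
  have "integrable lborel (\<lambda>x::real. inverse (1 + x\<^sup>2))"
    using integrable_inverse_1_plus_square by (simp add: set_integrable_def einterval_def)
  then show ?thesis unfolding integrable_iff_bounded by simp
qed

text \<open>For fixed \<open>w\<close> the points \<open>u\<close> at which all steps are 1 form a
  box with half-sides \<open>|R i w|\<close>, of volume \<open>2 ^ k\<close> times their product;
  Fubini exchanges the two integrals.\<close>

lemma (in prob_space) nn_integral_abs_prod:
  assumes R: "\<And>i. i < k \<Longrightarrow> centered_gaussian M (R i)"
  shows "integrable M (\<lambda>w. \<Prod>i<k. \<bar>R i w\<bar>)"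
    "(\<integral>\<^sup>+u. \<integral>\<^sup>+w. (\<Prod>i<k. step (u i) (R i w)) \<partial>M \<partial>leb k) = ennreal (2 ^ k * (\<integral>w. (\<Prod>i<k. \<bar>R i w\<bar>) \<partial>M))"
proof -
  have Rm [measurable]: "R i \<in> borel_measurable M" if "i < k" for i using R[OF that] by (rule centered_gaussian_measurable)
  have pm: "(\<lambda>w. \<Prod>i<k. \<bar>R i w\<bar>) \<in> borel_measurable M"
    by (intro borel_measurable_prod borel_measurable_abs Rm) auto
  show int: "integrable M (\<lambda>w. \<Prod>i<k. \<bar>R i w\<bar>)"
  proof (rule Bochner_Integration.integrable_bound)
    have "integrable M (\<lambda>w. \<bar>R i w ^ k\<bar>)" if "i < k" for i
      using centered_gaussian_integrable_power[OF R[OF that]] by (rule integrable_abs)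
    then show "integrable M (\<lambda>w. 1 + (\<Sum>i<k. \<bar>R i w\<bar> ^ k))"
      by (intro Bochner_Integration.integrable_add Bochner_Integration.integrable_sum) (auto simp: power_abs)
    show "AE w in M. norm (\<Prod>i<k. \<bar>R i w\<bar>) \<le> norm (1 + (\<Sum>i<k. \<bar>R i w\<bar> ^ k))"
    proof (rule AE_I2)
      fix w
      have "(\<Prod>i<k. \<bar>R i w\<bar>) \<le> 1 + (\<Sum>i<k. \<bar>R i w\<bar> ^ k)" by (rule prod_le_sum_power) simp
      moreover have "0 \<le> (\<Prod>i<k. \<bar>R i w\<bar>)" by (simp add: prod_nonneg)
      ultimately show "norm (\<Prod>i<k. \<bar>R i w\<bar>) \<le> norm (1 + (\<Sum>i<k. \<bar>R i w\<bar> ^ k))" by simp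
    qed
  qed (rule pm)
  have sf: "sigma_finite_measure (leb k)" by (rule lborel_product.sigma_finite) simp
  interpret P: pair_sigma_finite "leb k" M
    using sf by (intro pair_sigma_finite.intro) (auto intro: sigma_finite_measure_axioms)
  have jm: "(\<lambda>(u, w). \<Prod>i<k. step (u i) (R i w)) \<in> borel_measurable (leb k \<Otimes>\<^sub>M M)"
    using measurable_crossing_inner(2)[of k R "\<lambda>u. u" "leb k" "\<lambda>_ _. 0"] Rm measurable_leb_component by simp
  have "(\<integral>\<^sup>+u. \<integral>\<^sup>+w. (\<Prod>i<k. step (u i) (R i w)) \<partial>M \<partial>leb k) = (\<integral>\<^sup>+w. \<integral>\<^sup>+u. (\<Prod>i<k. step (u i) (R i w)) \<partial>leb k \<partial>M)"
    by (rule P.Fubini'[OF jm, symmetric])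
  also have "\<dots> = (\<integral>\<^sup>+w. (\<Prod>i<k. ennreal (2 * \<bar>R i w\<bar>)) \<partial>M)"
    by (intro nn_integral_cong) (subst lborel_product.product_nn_integral_prod; auto simp: nn_integral_step)
  also have "\<dots> = (\<integral>\<^sup>+w. ennreal (2 ^ k * (\<Prod>i<k. \<bar>R i w\<bar>)) \<partial>M)"
    by (simp add: prod_ennreal prod.distrib)
  also have "\<dots> = ennreal (\<integral>w. 2 ^ k * (\<Prod>i<k. \<bar>R i w\<bar>) \<partial>M)"
    using int by (intro nn_integral_eq_integral) (auto simp: prod_nonneg)
  finally show "(\<integral>\<^sup>+u. \<integral>\<^sup>+w. (\<Prod>i<k. step (u i) (R i w)) \<partial>M \<partial>leb k) = ennreal (2 ^ k * (\<integral>w. (\<Prod>i<k. \<bar>R i w\<bar>) \<partial>M))"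
    by simp
qed

text \<open>If all \<open>i\<close> cross and the perturbation of \<open>R\<close> is small, then \<open>\<bar>u\<bar> \<le> 2 \<bar>R i\<bar>\<close> for the index \<open>i\<close> at
  which \<open>\<bar>u i\<bar>\<close> is maximal. This dominates the integrand in \<open>u\<close>.\<close>

lemma crossing_domination:
  assumes B: "\<And>i. i < k \<Longrightarrow> (\<Sum>l<k. \<bar>h * B i l\<bar>) \<le> 1 / 2"
  shows "(\<Prod>i<k. step (u i) (h * lin k B u i + r i)) \<le>
    ennreal ((1 + (\<Sum>i<k. (1 + 4 * (r i)\<^sup>2) ^ k)) * (\<Prod>j<k. inverse (1 + (u j)\<^sup>2)))"
proof (cases "\<forall>i<k. \<bar>u i\<bar> < \<bar>h * lin k B u i + r i\<bar>")
  case False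
  then have "\<not> (\<forall>i\<in>{..<k}. \<bar>u i\<bar> < \<bar>h * lin k B u i + r i\<bar>)" by auto
  then have z: "(\<Prod>i<k. step (u i) (h * lin k B u i + r i)) = 0" by (subst prod_step_eq) auto
  show ?thesis unfolding z by simp
next
  case True
  have pos: "(\<Prod>j<k. 1 + (u j)\<^sup>2) > 0" by (intro prod_pos) (auto simp: add_pos_nonneg)
  have "(\<Prod>j<k. 1 + (u j)\<^sup>2) \<le> 1 + (\<Sum>i<k. (1 + 4 * (r i)\<^sup>2) ^ k)"
  proof (cases "k = 0")
    case False
    then have "(\<lambda>i. \<bar>u i\<bar>) ` {..<k} \<noteq> {}" "finite ((\<lambda>i. \<bar>u i\<bar>) ` {..<k})" by auto
    then have "Max ((\<lambda>i. \<bar>u i\<bar>) ` {..<k}) \<in> (\<lambda>i. \<bar>u i\<bar>) ` {..<k}" by (intro Max_in)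
    then obtain i where i: "i < k" "\<bar>u i\<bar> = Max ((\<lambda>i. \<bar>u i\<bar>) ` {..<k})" by (metis imageE lessThan_iff)
    then have max: "\<bar>u j\<bar> \<le> \<bar>u i\<bar>" if "j < k" for j using that by auto
    have "\<bar>h * lin k B u i\<bar> = \<bar>\<Sum>l<k. h * B i l * u l\<bar>" by (simp add: lin_def sum_distrib_left mult.assoc)
    also have "\<dots> \<le> (\<Sum>l<k. \<bar>h * B i l\<bar> * \<bar>u i\<bar>)"
      by (rule order_trans[OF sum_abs]) (auto intro!: sum_mono mult_left_mono max simp: abs_mult)
    also have "\<dots> = (\<Sum>l<k. \<bar>h * B i l\<bar>) * \<bar>u i\<bar>" by (simp only: sum_distrib_right)
    also have "\<dots> \<le> 1 / 2 * \<bar>u i\<bar>" by (rule mult_right_mono[OF B[OF i(1)]]) simp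
    \<comment> \<open>Crossing at the maximal index gives
      \<open>|u i| < |u i| / 2 + |r i|\<close>.\<close>
    finally have "\<bar>u i\<bar> \<le> 2 * \<bar>r i\<bar>" using True i(1) by fastforce
    then have "1 + (u j)\<^sup>2 \<le> 1 + 4 * (r i)\<^sup>2" if "j < k" for j
      using max[OF that] abs_le_square_iff[of "u j" "2 * r i"] by (auto simp: abs_mult power_mult_distrib)
    then have "(\<Prod>j<k. 1 + (u j)\<^sup>2) \<le> (\<Prod>j<k. 1 + 4 * (r i)\<^sup>2)" by (intro prod_mono) auto
    also have "\<dots> = (1 + 4 * (r i)\<^sup>2) ^ k" by simp
    also have "\<dots> \<le> (\<Sum>i<k. (1 + 4 * (r i)\<^sup>2) ^ k)" using i(1) by (intro member_le_sum) auto
    finally show ?thesis by simp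
  qed simp
  then have "1 \<le> (1 + (\<Sum>i<k. (1 + 4 * (r i)\<^sup>2) ^ k)) * (\<Prod>j<k. inverse (1 + (u j)\<^sup>2))"
    using pos prod_inversef[of "\<lambda>j. 1 + (u j)\<^sup>2" "{..<k}"]
    by (simp add: comp_def inverse_eq_divide[of "prod _ _"] pos_le_divide_eq)
  then have "1 \<le> ennreal ((1 + (\<Sum>i<k. (1 + 4 * (r i)\<^sup>2) ^ k)) * (\<Prod>j<k. inverse (1 + (u j)\<^sup>2)))"
    by (metis ennreal_1 ennreal_leI)
  then show ?thesis by (rule order_trans[OF prod_step_le_1])
qed

text \<open>\<open>X\<close> has the law of \<open>s z\<close> with \<open>z\<close> standard normal
  and the square of \<open>s\<close> at most \<open>V\<close>, and the moment increases with
  \<open>s\<close>. One constant serves all such \<open>X\<close>, which makes the domination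
  uniform along a sequence.\<close>

lemma (in prob_space) gaussian_moment_bound:
  obtains K where "K < (\<infinity> :: ennreal)"
    "\<And>X. centered_gaussian M X \<Longrightarrow> inner_rv M X X \<le> V \<Longrightarrow> (\<integral>\<^sup>+w. ennreal ((1 + 4 * (X w)\<^sup>2) ^ k) \<partial>M) \<le> K"
proof
  define K where "K = (\<integral>\<^sup>+z. ennreal ((1 + 4 * V * z\<^sup>2) ^ k) \<partial>std_normal_distribution)"
  interpret N: prob_space std_normal_distribution by (rule prob_space_std_normal)
  have int: "integrable std_normal_distribution (\<lambda>z. (1 + 4 * V * z\<^sup>2) ^ k)"
  proof -
    have "(1 + 4 * V * z\<^sup>2) ^ k = (\<Sum>i\<le>k. real (k choose i) * (4 * V) ^ i * z ^ (2 * i))" for z :: real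
      using binomial_ring[of "4 * V * z\<^sup>2" 1 k] by (simp add: add.commute power_mult_distrib power_mult mult.assoc)
    then show ?thesis
      by (simp only:) (intro Bochner_Integration.integrable_sum integrable_mult_right integrable_std_normal_distribution_moment)
  qed
  have "K \<le> (\<integral>\<^sup>+z. ennreal (norm ((1 + 4 * V * z\<^sup>2) ^ k)) \<partial>std_normal_distribution)"
    unfolding K_def real_norm_def by (intro nn_integral_mono ennreal_leI abs_ge_self)
  also have "\<dots> < \<infinity>" using int unfolding integrable_iff_bounded by (rule conjunct2)
  finally show "K < \<infinity>" .
  fix X assume X: "centered_gaussian M X" and V: "inner_rv M X X \<le> V"
  obtain s where s: "s \<ge> 0" "distr M borel X = distr std_normal_distribution borel (\<lambda>x. s * x)" "inner_rv M X X = s\<^sup>2"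
    using centered_gaussianE[OF X] by blast
  have [measurable]: "X \<in> borel_measurable M" using X by (rule centered_gaussian_measurable)
  have "(\<integral>\<^sup>+w. ennreal ((1 + 4 * (X w)\<^sup>2) ^ k) \<partial>M) = (\<integral>\<^sup>+x. ennreal ((1 + 4 * x\<^sup>2) ^ k) \<partial>distr M borel X)"
    by (subst nn_integral_distr) auto
  also have "\<dots> = (\<integral>\<^sup>+z. ennreal ((1 + 4 * (s * z)\<^sup>2) ^ k) \<partial>std_normal_distribution)"
    unfolding s by (subst nn_integral_distr) auto
  also have "\<dots> \<le> K"
    unfolding K_def using V s(3)
    by (intro nn_integral_mono ennreal_leI power_mono) (auto simp: power_mult_distrib mult_right_mono)
  finally show "(\<integral>\<^sup>+w. ennreal ((1 + 4 * (X w)\<^sup>2) ^ k) \<partial>M) \<le> K" .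
qed

text \<open>Dominated convergence twice: over \<open>w\<close> with bound 1, over \<open>u\<close>
  with bound \<open>W\<close>. In the limit the normal densities are frozen at 0, which leaves one
  factor \<open>1 / sqrt (2 * pi)\<close> per coordinate, and the box volume adds a factor 2 for
  each.\<close>

lemma (in prob_space) crossing_tendsto:
  assumes A: "\<And>i j. i < k \<Longrightarrow> j < k \<Longrightarrow> (\<lambda>n. A n i j) \<longlonglongrightarrow> A' i j"
    and B: "\<And>i j. i < k \<Longrightarrow> j < k \<Longrightarrow> (\<lambda>n. B n i j) \<longlonglongrightarrow> B' i j"
    and gR: "\<And>n i. i < k \<Longrightarrow> centered_gaussian M (R n i)"
    and R: "\<And>i w. i < k \<Longrightarrow> (\<lambda>n. R n i w) \<longlonglongrightarrow> R' i w"
    and h: "h \<longlonglongrightarrow> 0"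
  shows "(\<lambda>n. crossing M k (A n) (B n) (R n) (h n)) \<longlonglongrightarrow>
    ennreal ((2 / sqrt (2 * pi)) ^ k * (\<integral>w. (\<Prod>i<k. \<bar>R' i w\<bar>) \<partial>M))"
proof -
  have gR': "centered_gaussian M (R' i)" and vR: "(\<lambda>n. inner_rv M (R n i) (R n i)) \<longlonglongrightarrow> inner_rv M (R' i) (R' i)"
    if "i < k" for i using centered_gaussian_limit[OF gR[OF that] R[OF that]] by auto
  have Rm: "R n i \<in> borel_measurable M" if "i < k" for n i using gR[OF that] by (rule centered_gaussian_measurable)
  have Rm': "R' i \<in> borel_measurable M" if "i < k" for i using gR'[OF that] by (rule centered_gaussian_measurable)
  define V where "V = 1 + (\<Sum>i<k. inner_rv M (R' i) (R' i))"
  have nonneg: "inner_rv M X X \<ge> 0" for X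
    unfolding inner_rv_def by (intro Bochner_Integration.integral_nonneg) auto
  have "eventually (\<lambda>n. \<forall>i\<in>{..<k}. inner_rv M (R n i) (R n i) \<le> V) sequentially"
  proof (rule eventually_ball_finite, simp, rule ballI)
    fix i assume i: "i \<in> {..<k}"
    have "inner_rv M (R' i) (R' i) \<le> (\<Sum>i<k. inner_rv M (R' i) (R' i))"
      by (rule member_le_sum) (use i nonneg in auto)
    then have "inner_rv M (R' i) (R' i) < V" by (simp add: V_def)
    then have "eventually (\<lambda>n. inner_rv M (R n i) (R n i) < V) sequentially"
      using vR[of i] i by (intro order_tendstoD) auto
    then show "eventually (\<lambda>n. inner_rv M (R n i) (R n i) \<le> V) sequentially"
      by eventually_elim simp
  qed
  moreover have "eventually (\<lambda>n. \<forall>i\<in>{..<k}. (\<Sum>l<k. \<bar>h n * B n i l\<bar>) \<le> 1 / 2) sequentially"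
  proof (rule eventually_ball_finite, simp, rule ballI)
    fix i assume i: "i \<in> {..<k}"
    have "(\<lambda>n. \<Sum>l<k. \<bar>h n * B n i l\<bar>) \<longlonglongrightarrow> (\<Sum>l<k. \<bar>0 * B' i l\<bar>)"
      using i by (intro tendsto_sum tendsto_rabs tendsto_mult h B) auto
    then have "eventually (\<lambda>n. (\<Sum>l<k. \<bar>h n * B n i l\<bar>) < 1 / 2) sequentially"
      by (rule order_tendstoD) simp
    then show "eventually (\<lambda>n. (\<Sum>l<k. \<bar>h n * B n i l\<bar>) \<le> 1 / 2) sequentially"
      by eventually_elim simp
  qed
  ultimately have "eventually (\<lambda>n. \<forall>i<k. inner_rv M (R n i) (R n i) \<le> V \<and> (\<Sum>l<k. \<bar>h n * B n i l\<bar>) \<le> 1 / 2) sequentially"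
    by eventually_elim auto
  then obtain n0 where n0: "\<And>n i. n \<ge> n0 \<Longrightarrow> i < k \<Longrightarrow> inner_rv M (R n i) (R n i) \<le> V"
    "\<And>n i. n \<ge> n0 \<Longrightarrow> i < k \<Longrightarrow> (\<Sum>l<k. \<bar>h n * B n i l\<bar>) \<le> 1 / 2"
    unfolding eventually_sequentially by blast
  obtain K where K: "K < (\<infinity> :: ennreal)"
    "\<And>X. centered_gaussian M X \<Longrightarrow> inner_rv M X X \<le> V \<Longrightarrow> (\<integral>\<^sup>+w. ennreal ((1 + 4 * (X w)\<^sup>2) ^ k) \<partial>M) \<le> K"
    using gaussian_moment_bound[of V k] by blast
  \<comment> \<open>Integrable in \<open>u\<close> because each factor
    \<open>inverse (1 + u^2)\<close> is; the constant bounds the expectation of the random factor in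
    \<open>crossing_domination\<close>.\<close>
  define W where "W u = (1 + of_nat k * K) * (\<Prod>j<k. ennreal (inverse (1 + (u j)\<^sup>2)))" for u
  define f where "f n u = (\<Prod>j<k. ennreal (std_normal_density (h n * lin k (A n) u j))) *
     (\<integral>\<^sup>+w. (\<Prod>i<k. step (u i) (h n * lin k (B n) u i + R n i w)) \<partial>M)" for n u
  define f' where "f' u = (\<Prod>j<k. ennreal (std_normal_density 0)) * (\<integral>\<^sup>+w. (\<Prod>i<k. step (u i) (R' i w)) \<partial>M)" for u
  have "(\<lambda>n. \<integral>\<^sup>+u. f (n + n0) u \<partial>leb k) \<longlonglongrightarrow> (\<integral>\<^sup>+u. f' u \<partial>leb k)"
  proof (rule nn_integral_dominated_convergence)
    show "f (n + n0) \<in> borel_measurable (leb k)" for n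
      unfolding f_def by (rule measurable_crossing_integrand) (rule Rm)
    have "(\<lambda>u. \<integral>\<^sup>+w. (\<Prod>i<k. step (u i) (0 + R' i w)) \<partial>M) \<in> borel_measurable (leb k)"
      by (intro measurable_crossing_inner Rm' measurable_leb_component) auto
    then show "f' \<in> borel_measurable (leb k)"
      unfolding f'_def by (intro borel_measurable_times_ennreal) auto
    show "W \<in> borel_measurable (leb k)"
      unfolding W_def
      by (intro borel_measurable_times_ennreal borel_measurable_prod_ennreal borel_measurable_const
          measurable_compose[OF _ measurable_ennreal] borel_measurable_inverse borel_measurable_add
          borel_measurable_power measurable_leb_component) auto
    show "(\<integral>\<^sup>+u. W u \<partial>leb k) < \<infinity>"
    proof -
      have "(\<integral>\<^sup>+u. W u \<partial>leb k) = (1 + of_nat k * K) * (\<integral>\<^sup>+u. (\<Prod>j<k. ennreal (inverse (1 + (u j)\<^sup>2))) \<partial>leb k)"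
        unfolding W_def
        by (intro nn_integral_cmult borel_measurable_prod_ennreal
          measurable_compose[OF _ measurable_ennreal] borel_measurable_inverse borel_measurable_add
          borel_measurable_power measurable_leb_component borel_measurable_const) auto
      also have "(\<integral>\<^sup>+u. (\<Prod>j<k. ennreal (inverse (1 + (u j)\<^sup>2))) \<partial>leb k) =
          (\<Prod>j<k. \<integral>\<^sup>+x. ennreal (inverse (1 + x\<^sup>2)) \<partial>lborel)"
        by (rule lborel_product.product_nn_integral_prod) auto
      also have "(1 + of_nat k * K) * \<dots> < \<infinity>"
      proof -
        obtain a b where "K = ennreal a" "a \<ge> 0"
          "(\<integral>\<^sup>+x. ennreal (inverse (1 + x\<^sup>2)) \<partial>lborel) = ennreal b" "b \<ge> 0"
          using K(1) nn_integral_inverse_1_plus_square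
          by (cases K; cases "\<integral>\<^sup>+x. ennreal (inverse (1 + x\<^sup>2)) \<partial>lborel") auto
        then show ?thesis
          by (simp add: ennreal_power ennreal_mult_less_top ennreal_of_nat_eq_real_of_nat)
      qed
      finally show ?thesis .
    qed
    show "AE u in leb k. f (n + n0) u \<le> W u" for n
    proof (rule AE_I2)
      fix u :: "nat \<Rightarrow> real"
      define n' where "n' = n + n0"
      have n': "n' \<ge> n0" by (simp add: n'_def)
      have d1: "(\<Prod>j<k. ennreal (std_normal_density (h n' * lin k (A n') u j))) \<le> 1"
      proof (rule prod_le_1)
        fix j
        have "exp (- ((h n' * lin k (A n') u j)\<^sup>2) / 2) \<le> 1" by simp
        moreover have "1 \<le> sqrt (2 * pi)" using pi_gt3 by simp
        ultimately have "1 / sqrt (2 * pi) * exp (- ((h n' * lin k (A n') u j)\<^sup>2) / 2) \<le> 1 * 1"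
          by (intro mult_mono) auto
        then have "std_normal_density (h n' * lin k (A n') u j) \<le> 1"
          by (simp only: std_normal_density_def)
        then show "0 \<le> ennreal (std_normal_density (h n' * lin k (A n') u j)) \<and> ennreal (std_normal_density (h n' * lin k (A n') u j)) \<le> 1"
          by (simp add: ennreal_le_1)
      qed
      define c where "c = (\<Prod>j<k. inverse (1 + (u j)\<^sup>2))"
      have c: "c \<ge> 0" by (simp add: c_def prod_nonneg)
      have "(\<integral>\<^sup>+w. (\<Prod>i<k. step (u i) (h n' * lin k (B n') u i + R n' i w)) \<partial>M) \<le>
         (\<integral>\<^sup>+w. (1 + (\<Sum>i<k. ennreal ((1 + 4 * (R n' i w)\<^sup>2) ^ k))) * ennreal c \<partial>M)"
      proof (rule nn_integral_mono)
        fix w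
        have "(\<Prod>i<k. step (u i) (h n' * lin k (B n') u i + R n' i w)) \<le>
          ennreal ((1 + (\<Sum>i<k. (1 + 4 * (R n' i w)\<^sup>2) ^ k)) * c)"
          unfolding c_def by (rule crossing_domination) (rule n0(2)[OF n'])
        also have "\<dots> = (1 + (\<Sum>i<k. ennreal ((1 + 4 * (R n' i w)\<^sup>2) ^ k))) * ennreal c"
          using c by (simp add: ennreal_mult sum_nonneg ennreal_plus sum_ennreal)
        finally show "(\<Prod>i<k. step (u i) (h n' * lin k (B n') u i + R n' i w)) \<le>
          (1 + (\<Sum>i<k. ennreal ((1 + 4 * (R n' i w)\<^sup>2) ^ k))) * ennreal c" .
      qed
      also have "\<dots> = (1 + (\<Sum>i<k. \<integral>\<^sup>+w. ennreal ((1 + 4 * (R n' i w)\<^sup>2) ^ k) \<partial>M)) * ennreal c"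
      proof -
        have m: "(\<lambda>w. ennreal ((1 + 4 * (R n' i w)\<^sup>2) ^ k)) \<in> borel_measurable M" if "i < k" for i
          using Rm[OF that, of n'] by measurable
        then have m2: "(\<lambda>w. \<Sum>i<k. ennreal ((1 + 4 * (R n' i w)\<^sup>2) ^ k)) \<in> borel_measurable M"
          by (intro borel_measurable_sum) auto
        have "(\<integral>\<^sup>+w. (1 + (\<Sum>i<k. ennreal ((1 + 4 * (R n' i w)\<^sup>2) ^ k))) * ennreal c \<partial>M) =
            (\<integral>\<^sup>+w. 1 + (\<Sum>i<k. ennreal ((1 + 4 * (R n' i w)\<^sup>2) ^ k)) \<partial>M) * ennreal c"
          using m2 by (intro nn_integral_multc borel_measurable_add) auto
        also have "(\<integral>\<^sup>+w. 1 + (\<Sum>i<k. ennreal ((1 + 4 * (R n' i w)\<^sup>2) ^ k)) \<partial>M) =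
            1 + (\<integral>\<^sup>+w. (\<Sum>i<k. ennreal ((1 + 4 * (R n' i w)\<^sup>2) ^ k)) \<partial>M)"
          using m2 by (subst nn_integral_add) (auto simp: emeasure_space_1)
        also have "(\<integral>\<^sup>+w. (\<Sum>i<k. ennreal ((1 + 4 * (R n' i w)\<^sup>2) ^ k)) \<partial>M) =
            (\<Sum>i<k. \<integral>\<^sup>+w. ennreal ((1 + 4 * (R n' i w)\<^sup>2) ^ k) \<partial>M)"
          by (rule nn_integral_sum) (simp only: lessThan_iff m)
        finally show ?thesis .
      qed
      also have "\<dots> \<le> (1 + (\<Sum>i<k. K)) * ennreal c"
        using n0(1)[OF n'] by (intro mult_right_mono add_left_mono sum_mono K(2) gR) auto
      finally have d2: "(\<integral>\<^sup>+w. (\<Prod>i<k. step (u i) (h n' * lin k (B n') u i + R n' i w)) \<partial>M) \<le> W u"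
        by (simp add: W_def c_def prod_ennreal)
      show "f (n + n0) u \<le> W u"
        using mult_mono[OF d1 d2] by (simp add: f_def n'_def)
    qed
    show "AE u in leb k. (\<lambda>n. f (n + n0) u) \<longlonglongrightarrow> f' u"
      using AE_leb_nonzero
    proof eventually_elim
      fix u :: "nat \<Rightarrow> real" assume u: "\<forall>i<k. u i \<noteq> 0"
      have linA: "(\<lambda>n. h n * lin k (A n) u j) \<longlonglongrightarrow> 0" if "j < k" for j
      proof -
        have "(\<lambda>n. h n * lin k (A n) u j) \<longlonglongrightarrow> 0 * lin k A' u j"
          unfolding lin_def using that by (intro tendsto_mult tendsto_sum tendsto_const h A) auto
        then show ?thesis by simp
      qed
      have linB: "(\<lambda>n. h n * lin k (B n) u j) \<longlonglongrightarrow> 0" if "j < k" for j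
      proof -
        have "(\<lambda>n. h n * lin k (B n) u j) \<longlonglongrightarrow> 0 * lin k B' u j"
          unfolding lin_def using that by (intro tendsto_mult tendsto_sum tendsto_const h B) auto
        then show ?thesis by simp
      qed
      have phi: "isCont (\<lambda>x. std_normal_density x) 0"
        unfolding std_normal_density_def by (intro continuous_intros) auto
      have "(\<lambda>n. \<Prod>j<k. std_normal_density (h n * lin k (A n) u j)) \<longlonglongrightarrow> (\<Prod>j<k. std_normal_density 0)"
        by (intro tendsto_prod isCont_tendsto_compose[OF phi] linA) auto
      then have t1: "(\<lambda>n. \<Prod>j<k. ennreal (std_normal_density (h n * lin k (A n) u j))) \<longlonglongrightarrow> (\<Prod>j<k. ennreal (std_normal_density 0))"
        using tendsto_ennrealI by (fastforce simp: prod_ennreal ennreal_power)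
      have t2: "(\<lambda>n. \<integral>\<^sup>+w. (\<Prod>i<k. step (u i) (h n * lin k (B n) u i + R n i w)) \<partial>M)
        \<longlonglongrightarrow> (\<integral>\<^sup>+w. (\<Prod>i<k. step (u i) (R' i w)) \<partial>M)"
      proof (rule nn_integral_dominated_convergence[where w = "\<lambda>_. 1"])
        show "(\<lambda>w. \<Prod>i<k. step (u i) (h n * lin k (B n) u i + R n i w)) \<in> borel_measurable M" for n
          by (intro borel_measurable_prod_ennreal measurable_step borel_measurable_add borel_measurable_const Rm) auto
        show "(\<lambda>w. \<Prod>i<k. step (u i) (R' i w)) \<in> borel_measurable M"
          by (intro borel_measurable_prod_ennreal measurable_step borel_measurable_const Rm') auto
        show "AE w in M. (\<Prod>i<k. step (u i) (h n * lin k (B n) u i + R n i w)) \<le> 1" for n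
          by (rule AE_I2) (rule prod_step_le_1)
        \<comment> \<open>The indicators jump only where \<open>|R' i w| = |u i|\<close>. As
          \<open>u i\<close> is nonzero, this event is null even for a degenerate
          \<open>R' i\<close>.\<close>
        have "AE w in M. \<forall>i\<in>{..<k}. \<bar>R' i w\<bar> \<noteq> \<bar>u i\<bar>"
        proof (rule AE_finite_allI)
          fix i assume i: "i \<in> {..<k}"
          have "AE w in M. R' i w \<noteq> u i" "AE w in M. R' i w \<noteq> - u i"
            using i u by (auto intro!: centered_gaussian_atom gR')
          then show "AE w in M. \<bar>R' i w\<bar> \<noteq> \<bar>u i\<bar>" by eventually_elim (auto simp: abs_eq_iff)
        qed simp
        then show "AE w in M. (\<lambda>n. \<Prod>i<k. step (u i) (h n * lin k (B n) u i + R n i w)) \<longlonglongrightarrow> (\<Prod>i<k. step (u i) (R' i w))"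
        proof eventually_elim
          fix w assume w: "\<forall>i\<in>{..<k}. \<bar>R' i w\<bar> \<noteq> \<bar>u i\<bar>"
          have "eventually (\<lambda>n. \<forall>i\<in>{..<k}. step (u i) (h n * lin k (B n) u i + R n i w) = step (u i) (R' i w)) sequentially"
          proof (rule eventually_ball_finite, simp, rule ballI)
            fix i assume i: "i \<in> {..<k}"
            have "(\<lambda>n. h n * lin k (B n) u i + R n i w) \<longlonglongrightarrow> 0 + R' i w"
              using i by (intro tendsto_add linB R) auto
            then have l: "(\<lambda>n. \<bar>h n * lin k (B n) u i + R n i w\<bar>) \<longlonglongrightarrow> \<bar>R' i w\<bar>"
              using tendsto_rabs by fastforce
            consider "\<bar>u i\<bar> < \<bar>R' i w\<bar>" | "\<bar>R' i w\<bar> < \<bar>u i\<bar>" using w i by (metis linorder_neqE_linordered_idom)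
            then show "eventually (\<lambda>n. step (u i) (h n * lin k (B n) u i + R n i w) = step (u i) (R' i w)) sequentially"
            proof cases
              case 1
              from order_tendstoD(1)[OF l 1] show ?thesis by eventually_elim (use 1 in \<open>simp add: step_def\<close>)
            next
              case 2
              from order_tendstoD(2)[OF l 2] show ?thesis by eventually_elim (use 2 in \<open>simp add: step_def\<close>)
            qed
          qed
          then have "eventually (\<lambda>n. (\<Prod>i<k. step (u i) (h n * lin k (B n) u i + R n i w)) = (\<Prod>i<k. step (u i) (R' i w))) sequentially"
            by eventually_elim (rule prod.cong, auto)
          then show "(\<lambda>n. \<Prod>i<k. step (u i) (h n * lin k (B n) u i + R n i w)) \<longlonglongrightarrow> (\<Prod>i<k. step (u i) (R' i w))"
            by (rule tendsto_eventually)
        qed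
      qed (auto simp: emeasure_space_1)
      have "(\<integral>\<^sup>+w. (\<Prod>i<k. step (u i) (R' i w)) \<partial>M) \<le> (\<integral>\<^sup>+w. 1 \<partial>M)"
        by (intro nn_integral_mono prod_step_le_1)
      then have fin: "(\<integral>\<^sup>+w. (\<Prod>i<k. step (u i) (R' i w)) \<partial>M) \<noteq> \<infinity>" by (auto simp: emeasure_space_1 top_unique)
      have "(\<lambda>n. f n u) \<longlonglongrightarrow> f' u"
        unfolding f_def f'_def using fin
        by (intro tendsto_mult_ennreal t1 t2) (auto simp: prod_ennreal ennreal_power)
      then show "(\<lambda>n. f (n + n0) u) \<longlonglongrightarrow> f' u" by (rule LIMSEQ_ignore_initial_segment)
    qed
  qed
  then have lim: "(\<lambda>n. \<integral>\<^sup>+u. f n u \<partial>leb k) \<longlonglongrightarrow> (\<integral>\<^sup>+u. f' u \<partial>leb k)"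
    by (rule LIMSEQ_offset)
  have m: "(\<lambda>u. \<integral>\<^sup>+w. (\<Prod>i<k. step (u i) (0 + R' i w)) \<partial>M) \<in> borel_measurable (leb k)"
    by (intro measurable_crossing_inner Rm' measurable_leb_component) auto
  have "(\<integral>\<^sup>+u. f' u \<partial>leb k) = (\<Prod>j<k. ennreal (std_normal_density 0)) * ennreal (2 ^ k * (\<integral>w. (\<Prod>i<k. \<bar>R' i w\<bar>) \<partial>M))"
    unfolding f'_def using m nn_integral_abs_prod(2)[where R=R', OF gR'] by (simp add: nn_integral_cmult)
  also have "(\<Prod>j<k. ennreal (std_normal_density 0)) = ennreal ((1 / sqrt (2 * pi)) ^ k)"
    by (simp add: std_normal_density_def ennreal_power)
  also have "\<dots> * ennreal (2 ^ k * (\<integral>w. (\<Prod>i<k. \<bar>R' i w\<bar>) \<partial>M)) =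
      ennreal ((2 / sqrt (2 * pi)) ^ k * (\<integral>w. (\<Prod>i<k. \<bar>R' i w\<bar>) \<partial>M))"
    by (subst ennreal_mult[symmetric])
       (auto simp: power_divide intro!: mult_nonneg_nonneg Bochner_Integration.integral_nonneg prod_nonneg)
  finally show ?thesis using lim by (simp add: crossing_def f_def)
qed

section \<open>Orthonormal frames\<close>

definition mat_prod :: "nat \<Rightarrow> (nat \<Rightarrow> nat \<Rightarrow> real) \<Rightarrow> (nat \<Rightarrow> nat \<Rightarrow> real) \<Rightarrow> nat \<Rightarrow> nat \<Rightarrow> real" where
  "mat_prod k A B i j = (\<Sum>l<k. A i l * B l j)"

lemma lin_mat_prod: "lin k (mat_prod k A B) v i = lin k A (lin k B v) i"
proof -
  have "lin k (mat_prod k A B) v i = (\<Sum>j<k. \<Sum>l<k. A i l * B l j * v j)"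
    by (simp add: lin_def mat_prod_def sum_distrib_right)
  also have "\<dots> = (\<Sum>l<k. \<Sum>j<k. A i l * B l j * v j)" by (rule sum.swap)
  also have "\<dots> = lin k A (lin k B v) i" by (simp add: lin_def sum_distrib_left mult.assoc)
  finally show ?thesis .
qed

lemma mat_prod_diag:
  assumes "lower_triangular k A" "lower_triangular k B" "i < k"
  shows "mat_prod k A B i i = A i i * B i i"
proof -
  have "mat_prod k A B i i = (\<Sum>l<k. if l = i then A i i * B i i else 0)"
    unfolding mat_prod_def
  proof (rule sum.cong)
    fix l assume "l \<in> {..<k}"
    then show "A i l * B l i = (if l = i then A i i * B i i else 0)"
      using assms by (cases l i rule: linorder_cases) (auto simp: lower_triangular_def)
  qed simp
  then show ?thesis using assms(3) by simp
qed

lemma lower_triangular_mat_prod: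
  assumes A: "lower_triangular k A" and B: "lower_triangular k B"
  shows "lower_triangular k (mat_prod k A B)"
  unfolding lower_triangular_def
proof safe
  fix i j assume "i < k" "j < k" "i < j"
  then show "mat_prod k A B i j = 0"
    unfolding mat_prod_def
  proof (intro sum.neutral ballI)
    fix l assume "l \<in> {..<k}"
    then show "A i l * B l j = 0"
      using A B \<open>i < k\<close> \<open>j < k\<close> \<open>i < j\<close> by (cases "i < l") (auto simp: lower_triangular_def)
  qed
next
  fix i assume "i < k" "mat_prod k A B i i = 0"
  then show False using mat_prod_diag[OF A B] A B by (auto simp: lower_triangular_def)
qed

lemma lin_Suc: "lin (Suc k) A v i = lin k A v i + A i k * v k"
  by (simp add: lin_def)

text \<open>Induction by bordering: the last row of the inverse solves row \<open>k\<close> for the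
  last unknown after the smaller inverse has recovered the first \<open>k\<close> unknowns.\<close>

lemma lower_triangular_inverse:
  assumes "lower_triangular k A"
  shows "\<exists>L. lower_triangular k L \<and> (\<forall>i<k. L i i = 1 / A i i) \<and>
     (\<forall>v. \<forall>i<k. lin k L (lin k A v) i = v i) \<and> (\<forall>v. \<forall>i<k. lin k A (lin k L v) i = v i)"
  using assms
proof (induction k)
  case 0
  then show ?case by (auto simp: lower_triangular_def)
next
  case (Suc k)
  have tri: "lower_triangular k A" and a: "A k k \<noteq> 0" and z: "\<And>i. i < k \<Longrightarrow> A i k = 0"
    using Suc.prems by (auto simp: lower_triangular_def)
  obtain L where L: "lower_triangular k L" "\<And>i. i < k \<Longrightarrow> L i i = 1 / A i i"
    "\<And>v i. i < k \<Longrightarrow> lin k L (lin k A v) i = v i" "\<And>v i. i < k \<Longrightarrow> lin k A (lin k L v) i = v i"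
    using Suc.IH[OF tri] by blast
  define L' where "L' i j = (if i < k then if j < k then L i j else 0
     else (if j = k then 1 else - mat_prod k A L k j) / A k k)" for i j
  have A1: "lin (Suc k) A v i = lin k A v i" if "i < k" for v i using z[OF that] by (simp add: lin_Suc)
  have L1: "lin (Suc k) L' v i = lin k L v i" if "i < k" for v i
    using that by (simp add: lin_Suc L'_def) (simp add: lin_def L'_def)
  have L2: "lin (Suc k) L' v k = (v k - lin k A (lin k L v) k) / A k k" for v
  proof -
    have "lin k L' v k = (\<Sum>j<k. - (mat_prod k A L k j * v j / A k k))"
      unfolding lin_def by (rule sum.cong) (auto simp: L'_def)
    also have "\<dots> = - (lin k (mat_prod k A L) v k / A k k)"
      by (simp add: lin_def sum_negf sum_divide_distrib)
    finally show ?thesis by (simp add: lin_Suc lin_mat_prod L'_def diff_divide_distrib)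
  qed
  have "lower_triangular (Suc k) L'"
    using L(1) a by (auto simp: lower_triangular_def L'_def less_Suc_eq)
  moreover have "\<forall>i<Suc k. L' i i = 1 / A i i"
    using L(2) by (auto simp: L'_def less_Suc_eq)
  moreover have "lin (Suc k) L' (lin (Suc k) A v) i = v i" if "i < Suc k" for v i
  proof (cases "i < k")
    case True
    have "lin (Suc k) L' (lin (Suc k) A v) i = lin k L (lin k A v) i"
      unfolding L1[OF True] by (rule lin_cong) (rule A1)
    then show ?thesis using L(3)[OF True] by simp
  next
    case False
    then have i: "i = k" using that by simp
    have "lin k A (lin k L (lin (Suc k) A v)) k = lin k A v k"
    proof (rule lin_cong)
      fix j assume j: "j < k"
      have "lin k L (lin (Suc k) A v) j = lin k L (lin k A v) j" by (rule lin_cong) (rule A1)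
      then show "lin k L (lin (Suc k) A v) j = v j" using L(3)[OF j] by simp
    qed
    then show ?thesis using a unfolding i L2 by (simp add: lin_Suc)
  qed
  moreover have "lin (Suc k) A (lin (Suc k) L' v) i = v i" if "i < Suc k" for v i
  proof -
    have e: "lin k A (lin (Suc k) L' v) i = lin k A (lin k L v) i" by (rule lin_cong) (rule L1)
    show ?thesis
    proof (cases "i < k")
      case True
      then show ?thesis unfolding A1[OF True] e by (rule L(4))
    next
      case False
      then have "i = k" using that by simp
      then show ?thesis using e a by (simp add: lin_Suc[of k A] L2)
    qed
  qed
  ultimately show ?case by blast
qed

section \<open>Gram--Schmidt orthonormalization of random variables\<close>

definition comb :: "nat \<Rightarrow> (nat \<Rightarrow> nat \<Rightarrow> real) \<Rightarrow> (nat \<Rightarrow> 'w \<Rightarrow> real) \<Rightarrow> nat \<Rightarrow> 'w \<Rightarrow> real" where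
  "comb k A S i w = lin k A (\<lambda>j. S j w) i"

lemma comb_mat_prod: "comb k (mat_prod k A B) S = comb k A (comb k B S)"
  by (intro ext) (simp add: comb_def lin_mat_prod)

lemma comb_cong: "(\<And>j. j < k \<Longrightarrow> S j = T j) \<Longrightarrow> comb k A S = comb k A T"
  by (intro ext) (auto simp: comb_def intro!: lin_cong)

lemma comb_tendsto:
  assumes "\<And>j. j < k \<Longrightarrow> (\<lambda>n. A n i j) \<longlonglongrightarrow> A' i j" "\<And>j. j < k \<Longrightarrow> (\<lambda>n. S n j w) \<longlonglongrightarrow> S' j w"
  shows "(\<lambda>n. comb k (A n) (S n) i w) \<longlonglongrightarrow> comb k A' S' i w"
  unfolding comb_def lin_def by (intro tendsto_sum tendsto_mult assms) auto

context gaussian_space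
begin

lemma comb_mem: "(\<And>j. j < k \<Longrightarrow> S j \<in> H) \<Longrightarrow> comb k A S i \<in> H"
  unfolding comb_def[abs_def] lin_def by (rule sum_mem) auto

definition orthonormal :: "nat \<Rightarrow> (nat \<Rightarrow> 'w \<Rightarrow> real) \<Rightarrow> bool" where
  "orthonormal k e \<longleftrightarrow> (\<forall>j<k. e j \<in> H) \<and>
     (\<forall>i<k. \<forall>j<k. inner_rv M (e i) (e j) = (if i = j then 1 else 0))"

text \<open>Up to signs \<open>A\<close> is the inverse Cholesky factor of the covariance matrix of
  \<open>S\<close>. For a family in \<open>H\<close>, a frame exists precisely when the family is
  non-degenerate.\<close>

definition frame :: "nat \<Rightarrow> (nat \<Rightarrow> nat \<Rightarrow> real) \<Rightarrow> (nat \<Rightarrow> 'w \<Rightarrow> real) \<Rightarrow> bool" where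
  "frame k A S \<longleftrightarrow> lower_triangular k A \<and> (\<forall>j<k. S j \<in> H) \<and> orthonormal k (comb k A S)"

text \<open>For orthonormal \<open>e\<close> this is \<open>V\<close> minus its orthogonal
  projection. In a Gaussian space the projection is the conditional expectation given
  \<open>e\<close>, so the residual has the law of \<open>V\<close> conditioned on
  \<open>e = 0\<close>.\<close>

definition residual :: "nat \<Rightarrow> (nat \<Rightarrow> 'w \<Rightarrow> real) \<Rightarrow> ('w \<Rightarrow> real) \<Rightarrow> 'w \<Rightarrow> real" where
  "residual k e V w = V w - (\<Sum>j<k. inner_rv M V (e j) * e j w)"

lemma residual_mem: "orthonormal k e \<Longrightarrow> V \<in> H \<Longrightarrow> residual k e V \<in> H"
  unfolding residual_def[abs_def] orthonormal_def by (intro diff_mem sum_mem) auto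

lemma residual_orthogonal:
  assumes e: "orthonormal k e" and V: "V \<in> H" and i: "i < k"
  shows "inner_rv M (residual k e V) (e i) = 0"
proof -
  have eH: "\<And>j. j < k \<Longrightarrow> e j \<in> H" using e by (auto simp: orthonormal_def)
  have s: "(\<lambda>w. \<Sum>j<k. inner_rv M V (e j) * e j w) \<in> H" by (rule sum_mem) (use eH in auto)
  have "inner_rv M (residual k e V) (e i) = inner_rv M V (e i) - inner_rv M (\<lambda>w. \<Sum>j<k. inner_rv M V (e j) * e j w) (e i)"
    unfolding residual_def[abs_def] by (rule inner_diff[OF V s eH[OF i]])
  also have "inner_rv M (\<lambda>w. \<Sum>j<k. inner_rv M V (e j) * e j w) (e i) = (\<Sum>j<k. inner_rv M V (e j) * inner_rv M (e j) (e i))"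
    by (rule inner_sum_left) (use eH i in auto)
  also have "\<dots> = (\<Sum>j<k. if j = i then inner_rv M V (e i) else 0)"
    by (rule sum.cong) (use e i in \<open>auto simp: orthonormal_def\<close>)
  also have "\<dots> = inner_rv M V (e i)" using i by simp
  finally show ?thesis by simp
qed

lemma residual_lincomb:
  assumes e: "orthonormal k e" and V: "V \<in> H" and W: "W \<in> H"
  shows "residual k e (\<lambda>w. a * V w + b * W w) w = a * residual k e V w + b * residual k e W w"
proof -
  have eH: "\<And>j. j < k \<Longrightarrow> e j \<in> H" using e by (auto simp: orthonormal_def)
  have "(\<Sum>j<k. inner_rv M (\<lambda>w. a * V w + b * W w) (e j) * e j w) =
     (\<Sum>j<k. a * (inner_rv M V (e j) * e j w) + b * (inner_rv M W (e j) * e j w))"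
    by (rule sum.cong) (use eH V W in \<open>auto simp: inner_lincomb algebra_simps\<close>)
  then show ?thesis by (simp add: residual_def sum.distrib sum_distrib_left[symmetric] algebra_simps)
qed

lemma residual_sum_basis:
  assumes e: "orthonormal k e"
  shows "residual k e (\<lambda>w. \<Sum>j<k. c j * e j w) w = 0"
proof -
  have eH: "\<And>j. j < k \<Longrightarrow> e j \<in> H" using e by (auto simp: orthonormal_def)
  have "inner_rv M (\<lambda>w. \<Sum>j<k. c j * e j w) (e i) = c i" if i: "i < k" for i
  proof -
    have "inner_rv M (\<lambda>w. \<Sum>j<k. c j * e j w) (e i) = (\<Sum>j<k. c j * inner_rv M (e j) (e i))"
      by (rule inner_sum_left) (use eH i in auto)
    also have "\<dots> = (\<Sum>j<k. if j = i then c i else 0)"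
      by (rule sum.cong) (use e i in \<open>auto simp: orthonormal_def\<close>)
    finally show ?thesis using i by simp
  qed
  then show ?thesis by (simp add: residual_def)
qed

lemma frame_inverse:
  assumes "frame k A S"
  obtains L where "lower_triangular k L" "\<And>i. i < k \<Longrightarrow> L i i = 1 / A i i"
    "\<And>v i. i < k \<Longrightarrow> lin k A (lin k L v) i = v i"
    "\<And>i. i < k \<Longrightarrow> S i = comb k L (comb k A S) i"
proof -
  obtain L where L: "lower_triangular k L" "\<And>i. i < k \<Longrightarrow> L i i = 1 / A i i"
     "\<And>v i. i < k \<Longrightarrow> lin k L (lin k A v) i = v i" "\<And>v i. i < k \<Longrightarrow> lin k A (lin k L v) i = v i"
    using assms lower_triangular_inverse[of k A] unfolding frame_def by blast
  have "S i = comb k L (comb k A S) i" if "i < k" for i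
    using L(3)[OF that] by (auto simp: comb_def[abs_def])
  with L that show ?thesis by blast
qed

text \<open>The span of \<open>S\<close> is the span of its frame. Passing to residuals thus
  implements the condition \<open>S = 0\<close>: combinations of \<open>S\<close> may be
  dropped.\<close>

lemma residual_frame_span:
  assumes "frame k A S"
  shows "residual k (comb k A S) (comb k c S i) w = 0"
proof -
  have e: "orthonormal k (comb k A S)" using assms by (simp add: frame_def)
  obtain L where L: "\<And>i. i < k \<Longrightarrow> S i = comb k L (comb k A S) i" using frame_inverse[OF assms] by metis
  have "comb k c S i = comb k c (comb k L (comb k A S)) i" using comb_cong[of k S, OF L] by metis
  also have "\<dots> = comb k (mat_prod k c L) (comb k A S) i" by (simp add: comb_mat_prod)
  finally show ?thesis
    using residual_sum_basis[OF e, of "mat_prod k c L i"] by (simp add: comb_def[of _ "mat_prod _ _ _", abs_def] lin_def)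
qed

text \<open>The new row is the normalized residual of \<open>S k\<close>, rewritten as a combination
  of the \<open>S j\<close> themselves; this accounts for the products with
  \<open>A\<close>.\<close>

definition gram_schmidt_step :: "nat \<Rightarrow> (nat \<Rightarrow> nat \<Rightarrow> real) \<Rightarrow> (nat \<Rightarrow> 'w \<Rightarrow> real) \<Rightarrow> nat \<Rightarrow> nat \<Rightarrow> real" where
  "gram_schmidt_step k A S i j =
     (let v = residual k (comb k A S) (S k)
      in if i < k then if j < k then A i j else 0
         else (if j = k then 1 else - (\<Sum>l<k. inner_rv M (S k) (comb k A S l) * A l j)) / sqrt (inner_rv M v v))"

lemma comb_gram_schmidt_step:
  "i < k \<Longrightarrow> comb (Suc k) (gram_schmidt_step k A S) S i = comb k A S i"
  "comb (Suc k) (gram_schmidt_step k A S) S k = (\<lambda>w. residual k (comb k A S) (S k) w /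
     sqrt (inner_rv M (residual k (comb k A S) (S k)) (residual k (comb k A S) (S k))))"
proof -
  show "comb (Suc k) (gram_schmidt_step k A S) S i = comb k A S i" if "i < k"
    using that by (auto simp: comb_def lin_def gram_schmidt_step_def)
  define v where "v = residual k (comb k A S) (S k)"
  define r where "r = sqrt (inner_rv M v v)"
  show "comb (Suc k) (gram_schmidt_step k A S) S k = (\<lambda>w. residual k (comb k A S) (S k) w /
     sqrt (inner_rv M (residual k (comb k A S) (S k)) (residual k (comb k A S) (S k))))"
  proof
    fix w
    have "(\<Sum>j<k. gram_schmidt_step k A S k j * S j w) =
        - (\<Sum>j<k. \<Sum>l<k. inner_rv M (S k) (comb k A S l) * A l j * S j w) / r"
      by (simp add: gram_schmidt_step_def Let_def v_def[symmetric] r_def[symmetric] sum_distrib_right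
          sum_divide_distrib sum_negf)
    also have "(\<Sum>j<k. \<Sum>l<k. inner_rv M (S k) (comb k A S l) * A l j * S j w) =
       (\<Sum>l<k. \<Sum>j<k. inner_rv M (S k) (comb k A S l) * A l j * S j w)" by (rule sum.swap)
    also have "\<dots> = (\<Sum>l<k. inner_rv M (S k) (comb k A S l) * comb k A S l w)"
      by (simp add: comb_def[of k A S _ w] lin_def sum_distrib_left mult.assoc)
    finally have "(\<Sum>j<k. gram_schmidt_step k A S k j * S j w) =
      - (\<Sum>l<k. inner_rv M (S k) (comb k A S l) * comb k A S l w) / r" .
    then show "comb (Suc k) (gram_schmidt_step k A S) S k w = residual k (comb k A S) (S k) w /
     sqrt (inner_rv M (residual k (comb k A S) (S k)) (residual k (comb k A S) (S k)))"
      unfolding v_def[symmetric] r_def[symmetric]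
      by (simp add: comb_def[of "Suc k"] lin_def gram_schmidt_step_def Let_def v_def[symmetric] r_def[symmetric])
         (simp add: v_def residual_def diff_divide_distrib)
  qed
qed

lemma frame_gram_schmidt_step:
  assumes f: "frame k A S" and S: "S k \<in> H"
    and v: "inner_rv M (residual k (comb k A S) (S k)) (residual k (comb k A S) (S k)) > 0"
  shows "frame (Suc k) (gram_schmidt_step k A S) S"
proof -
  define e where "e = comb k A S"
  define v where "v = residual k e (S k)"
  define e' where "e' = comb (Suc k) (gram_schmidt_step k A S) S"
  have on: "orthonormal k e" using f by (simp add: frame_def e_def)
  have e'1: "e' i = e i" if "i < k" for i
    using comb_gram_schmidt_step(1)[OF that] by (simp add: e'_def e_def)
  have e'2: "e' k = (\<lambda>w. (1 / sqrt (inner_rv M v v)) * v w)"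
    using comb_gram_schmidt_step(2)[of k A S] by (simp add: e'_def e_def v_def)
  have vH: "v \<in> H" unfolding v_def by (rule residual_mem[OF on S])
  have v0: "inner_rv M v v > 0" using v by (simp add: v_def e_def)
  have kH: "e' k \<in> H" unfolding e'2 by (rule scale_mem[OF vH])
  have kk: "inner_rv M (e' k) (e' k) = 1"
  proof -
    have "inner_rv M (e' k) (e' k) = (1 / sqrt (inner_rv M v v)) * inner_rv M v (e' k)"
      by (subst (1) e'2) (rule inner_scale[OF vH kH])
    also have "inner_rv M v (e' k) = (1 / sqrt (inner_rv M v v)) * inner_rv M v v"
      by (subst inner_rv_commute, subst e'2) (rule inner_scale[OF vH vH])
    finally show ?thesis using v0 by (simp add: field_simps)
  qed
  have ki: "inner_rv M (e' k) (e' i) = 0" if "i < k" for i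
  proof -
    have "e i \<in> H" using on that by (auto simp: orthonormal_def)
    then show ?thesis
      unfolding e'1[OF that] e'2 by (subst inner_scale[OF vH]) (simp_all add: v_def residual_orthogonal[OF on S that])
  qed
  have "orthonormal (Suc k) e'"
    unfolding orthonormal_def
  proof (intro conjI allI impI)
    fix i assume "i < Suc k"
    then show "e' i \<in> H" using on kH by (cases "i = k") (auto simp: orthonormal_def e'1)
  next
    fix i j assume "i < Suc k" "j < Suc k"
    then consider "i < k" "j < k" | "i = k" "j < k" | "i < k" "j = k" | "i = k" "j = k" by linarith
    then show "inner_rv M (e' i) (e' j) = (if i = j then 1 else 0)"
    proof cases
      case 1
      then show ?thesis using on by (simp add: orthonormal_def e'1)
    next
      case 2
      then show ?thesis using ki[of j] by simp
    next
      case 3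
      then show ?thesis using ki[of i] by (subst inner_rv_commute) simp
    next
      case 4
      then show ?thesis using kk by simp
    qed
  qed
  moreover have "lower_triangular (Suc k) (gram_schmidt_step k A S)"
    using f v by (auto simp: frame_def lower_triangular_def gram_schmidt_step_def Let_def less_Suc_eq)
  ultimately show ?thesis using f S by (auto simp: frame_def e'_def less_Suc_eq)
qed

text \<open>The residual of \<open>S k\<close> is a combination of the \<open>S j\<close> in which
  \<open>S k\<close> has coefficient 1. Its variance is nonzero by hypothesis, so the next
  Gram--Schmidt step is possible.\<close>

lemma frame_exists:
  assumes "\<And>j. j < k \<Longrightarrow> S j \<in> H"
    and nd: "\<And>c. \<exists>j<k. c j \<noteq> 0 \<Longrightarrow>
      inner_rv M (\<lambda>w. \<Sum>j<k. c j * S j w) (\<lambda>w. \<Sum>j<k. c j * S j w) \<noteq> 0"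
  shows "\<exists>A. frame k A S"
  using assms
proof (induction k)
  case 0
  then show ?case by (auto simp: frame_def lower_triangular_def orthonormal_def)
next
  case (Suc k)
  have "\<exists>A. frame k A S"
  proof (rule Suc.IH)
    fix c :: "nat \<Rightarrow> real" assume "\<exists>j<k. c j \<noteq> 0"
    then have "\<exists>j<Suc k. (c(k := 0)) j \<noteq> 0" by (metis fun_upd_apply less_Suc_eq less_irrefl)
    from Suc.prems(2)[OF this] show "inner_rv M (\<lambda>w. \<Sum>j<k. c j * S j w) (\<lambda>w. \<Sum>j<k. c j * S j w) \<noteq> 0"
      by simp
  qed (use Suc.prems in auto)
  then obtain A where A: "frame k A S" by blast
  define c where "c j = (if j = k then 1 else - (\<Sum>l<k. inner_rv M (S k) (comb k A S l) * A l j))" for j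
  have "residual k (comb k A S) (S k) w = (\<Sum>j<Suc k. c j * S j w)" for w
  proof -
    have "(\<Sum>l<k. inner_rv M (S k) (comb k A S l) * comb k A S l w) =
        (\<Sum>l<k. \<Sum>j<k. inner_rv M (S k) (comb k A S l) * A l j * S j w)"
      by (simp add: comb_def[of k A S _ w] lin_def sum_distrib_left mult.assoc)
    also have "\<dots> = (\<Sum>j<k. \<Sum>l<k. inner_rv M (S k) (comb k A S l) * A l j * S j w)" by (rule sum.swap)
    also have "\<dots> = - (\<Sum>j<k. c j * S j w)" by (simp add: c_def sum_distrib_right sum_negf)
    finally show ?thesis by (simp add: residual_def c_def)
  qed
  then have e: "residual k (comb k A S) (S k) = (\<lambda>w. \<Sum>j<Suc k. c j * S j w)" by (rule ext)
  have "inner_rv M (residual k (comb k A S) (S k)) (residual k (comb k A S) (S k)) \<noteq> 0"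
    unfolding e by (rule Suc.prems(2)) (auto simp: c_def intro!: exI[of _ k])
  then have "inner_rv M (residual k (comb k A S) (S k)) (residual k (comb k A S) (S k)) > 0"
    using inner_self_nonneg less_eq_real_def by metis
  from frame_gram_schmidt_step[OF A _ this] Suc.prems(1) show ?case by blast
qed

lemma residual_tendsto:
  assumes e: "\<And>n j. j < k \<Longrightarrow> e n j \<in> H" "\<And>j w. j < k \<Longrightarrow> (\<lambda>n. e n j w) \<longlonglongrightarrow> e' j w"
    and V: "\<And>n. V n \<in> H" "\<And>w. (\<lambda>n. V n w) \<longlonglongrightarrow> V' w"
    and e': "\<And>j. j < k \<Longrightarrow> e' j \<in> H" and V': "V' \<in> H"
  shows "(\<lambda>n. residual k (e n) (V n) w) \<longlonglongrightarrow> residual k e' V' w"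
  unfolding residual_def
  by (intro tendsto_diff tendsto_sum tendsto_mult V(2) e(2) inner_tendsto[OF V] e V' e') auto

text \<open>Gram--Schmidt depends continuously on the family and does nothing to an orthonormal one,
  so its matrices tend to the identity. A limit with a general frame is reduced to this case by
  applying the limiting frame matrix first.\<close>

lemma frame_perturbation:
  assumes "\<And>n j. j < k \<Longrightarrow> T n j \<in> H" "\<And>j w. j < k \<Longrightarrow> (\<lambda>n. T n j w) \<longlonglongrightarrow> T' j w" "orthonormal k T'"
  shows "\<exists>K. (\<forall>i<k. \<forall>j<k. (\<lambda>n. K n i j) \<longlonglongrightarrow> (if i = j then 1 else 0)) \<and>
     eventually (\<lambda>n. frame k (K n) (T n)) sequentially"
  using assms
proof (induction k)
  case 0
  then show ?case by (auto simp: frame_def lower_triangular_def orthonormal_def)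
next
  case (Suc k)
  have T'k: "orthonormal k T'" and T'H: "\<And>j. j < Suc k \<Longrightarrow> T' j \<in> H"
    using Suc.prems(3) by (auto simp: orthonormal_def)
  have "\<exists>K. (\<forall>i<k. \<forall>j<k. (\<lambda>n. K n i j) \<longlonglongrightarrow> (if i = j then 1 else 0)) \<and>
     eventually (\<lambda>n. frame k (K n) (T n)) sequentially"
    by (rule Suc.IH[OF _ _ T'k]) (use Suc.prems in auto)
  then obtain K where K0: "\<forall>i<k. \<forall>j<k. (\<lambda>n. K n i j) \<longlonglongrightarrow> (if i = j then 1 else 0)"
    "eventually (\<lambda>n. frame k (K n) (T n)) sequentially"
    by auto
  note K = K0(1)[rule_format] K0(2)
  define e where "e n = comb k (K n) (T n)" for n
  have eH: "e n j \<in> H" for n j unfolding e_def using Suc.prems(1) by (intro comb_mem) auto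
  have elim: "(\<lambda>n. e n j w) \<longlonglongrightarrow> T' j w" if j: "j < k" for j w
  proof -
    have "(\<lambda>n. comb k (K n) (T n) j w) \<longlonglongrightarrow> comb k (\<lambda>i j. if i = j then 1 else 0) T' j w"
      using j Suc.prems by (intro comb_tendsto K) auto
    also have "comb k (\<lambda>i j. if i = j then 1 else 0) T' j w = (\<Sum>l<k. if l = j then T' j w else 0)"
      unfolding comb_def lin_def by (rule sum.cong) auto
    finally show ?thesis using j by (simp add: e_def)
  qed
  define v where "v n = residual k (e n) (T n k)" for n
  have TkH: "T n k \<in> H" for n using Suc.prems(1) by simp
  have vH: "v n \<in> H" for n
    unfolding v_def residual_def[abs_def] using eH TkH by (intro diff_mem sum_mem) auto
  \<comment> \<open>These are the correction coefficients of the new row; they vanish in the limit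
    by orthogonality of \<open>T'\<close>.\<close>
  have cl: "(\<lambda>n. inner_rv M (T n k) (e n l)) \<longlonglongrightarrow> 0" if l: "l < k" for l
  proof -
    have "(\<lambda>n. inner_rv M (T n k) (e n l)) \<longlonglongrightarrow> inner_rv M (T' k) (T' l)"
      using l by (intro inner_tendsto eH elim TkH Suc.prems(2) T'H) auto
    then show ?thesis using Suc.prems(3) l by (auto simp: orthonormal_def)
  qed
  have vlim: "(\<lambda>n. v n w) \<longlonglongrightarrow> T' k w" for w
  proof -
    have "(\<lambda>n. v n w) \<longlonglongrightarrow> T' k w - (\<Sum>l<k. 0 * T' l w)"
      unfolding v_def residual_def using Suc.prems
      by (intro tendsto_diff tendsto_sum tendsto_mult cl elim) auto
    then show ?thesis by simp
  qed
  have "(\<lambda>n. inner_rv M (v n) (v n)) \<longlonglongrightarrow> inner_rv M (T' k) (T' k)"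
    by (intro inner_tendsto vH vlim T'H) auto
  then have vv: "(\<lambda>n. inner_rv M (v n) (v n)) \<longlonglongrightarrow> 1" using Suc.prems(3) by (auto simp: orthonormal_def)
  define K' where "K' n = gram_schmidt_step k (K n) (T n)" for n
  have "(\<lambda>n. K' n i j) \<longlonglongrightarrow> (if i = j then 1 else 0)" if "i < Suc k" "j < Suc k" for i j
  proof (cases "i < k")
    case True
    then show ?thesis using K(1)[of i j] that
      by (cases "j < k") (auto simp: K'_def gram_schmidt_step_def)
  next
    case False
    then have i: "i = k" using that by simp
    have eq: "K' n k j = (if j = k then 1 else - (\<Sum>l<k. inner_rv M (T n k) (e n l) * K n l j)) / sqrt (inner_rv M (v n) (v n))" for n
      by (simp add: K'_def gram_schmidt_step_def Let_def v_def e_def)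
    show ?thesis
    proof (cases "j = k")
      case True
      have "(\<lambda>n. 1 / sqrt (inner_rv M (v n) (v n))) \<longlonglongrightarrow> 1 / sqrt 1"
        by (intro tendsto_intros vv) auto
      moreover have "K' n i j = 1 / sqrt (inner_rv M (v n) (v n))" for n using eq[of n] True i by simp
      ultimately show ?thesis using True i by simp
    next
      case False
      then have j: "j < k" using that by simp
      have "(\<lambda>n. - (\<Sum>l<k. inner_rv M (T n k) (e n l) * K n l j) / sqrt (inner_rv M (v n) (v n)))
         \<longlonglongrightarrow> - (\<Sum>l<k. 0 * (if l = j then 1 else 0)) / sqrt 1"
        using j by (intro tendsto_divide tendsto_minus tendsto_sum tendsto_mult cl K tendsto_real_sqrt vv) auto
      then show ?thesis using False by (simp add: i eq)
    qed
  qed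
  moreover have "eventually (\<lambda>n. frame (Suc k) (K' n) (T n)) sequentially"
  proof -
    have "eventually (\<lambda>n. inner_rv M (v n) (v n) > 0) sequentially"
      using vv by (rule order_tendstoD) simp
    with K(2) show ?thesis
    proof eventually_elim
      fix n assume "frame k (K n) (T n)" "inner_rv M (v n) (v n) > 0"
      then show "frame (Suc k) (K' n) (T n)"
        unfolding K'_def v_def e_def by (intro frame_gram_schmidt_step TkH)
    qed
  qed
  ultimately show ?case by blast
qed

lemma frame_comp:
  assumes "frame k K (comb k A S)" "lower_triangular k A" "\<And>j. j < k \<Longrightarrow> S j \<in> H"
  shows "frame k (mat_prod k K A) S"
  using assms by (auto simp: frame_def comb_mat_prod lower_triangular_mat_prod)

end

section \<open>The limit of the crossing probabilities\<close>

context gaussian_space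
begin

text \<open>The Kac--Rice density at \<open>S = 0\<close>: the diagonal product is the inverse
  square root of the determinant of the variance of \<open>S\<close>, and the integral is the
  conditional expectation of the product of the \<open>|D i|\<close>.\<close>

definition crossing_const ::
  "nat \<Rightarrow> (nat \<Rightarrow> nat \<Rightarrow> real) \<Rightarrow> (nat \<Rightarrow> 'w \<Rightarrow> real) \<Rightarrow> (nat \<Rightarrow> 'w \<Rightarrow> real) \<Rightarrow> real" where
  "crossing_const k A S D = (\<Prod>j<k. \<bar>A j j\<bar>) * (1 / sqrt (2 * pi)) ^ k *
     (\<integral>w. (\<Prod>i<k. \<bar>residual k (comb k A S) (D i) w\<bar>) \<partial>M)"

lemma crossing_const_nonneg: "crossing_const k A S D \<ge> 0"
  unfolding crossing_const_def
  by (intro mult_nonneg_nonneg prod_nonneg zero_le_power Bochner_Integration.integral_nonneg) (auto intro!: prod_nonneg)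

text \<open>Frames \<open>An n\<close> of the perturbed families converge to \<open>A\<close>, hence
  so do the regression coefficients of \<open>D n\<close> on \<open>S n\<close> and the residuals.
  \<open>crossing_tendsto\<close> applies to these data.\<close>

lemma crossing_limit:
  assumes A: "frame k A S'"
    and S: "\<And>n j. j < k \<Longrightarrow> S n j \<in> H" "\<And>j w. j < k \<Longrightarrow> (\<lambda>n. S n j w) \<longlonglongrightarrow> S' j w"
    and D: "\<And>n j. j < k \<Longrightarrow> D n j \<in> H" "\<And>j w. j < k \<Longrightarrow> (\<lambda>n. D n j w) \<longlonglongrightarrow> D' j w"
    and D': "\<And>j. j < k \<Longrightarrow> D' j \<in> H"
    and h: "\<And>n. h n > 0" "h \<longlonglongrightarrow> 0"
  shows "(\<lambda>n. emeasure M {w \<in> space M. \<forall>i<k. \<bar>S n i w\<bar> < h n * \<bar>D n i w\<bar>} / ennreal ((2 * h n) ^ k))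
     \<longlonglongrightarrow> ennreal (crossing_const k A S' D')"
proof -
  have triA: "lower_triangular k A" and e'on: "orthonormal k (comb k A S')" using A by (auto simp: frame_def)
  have "\<exists>K. (\<forall>i<k. \<forall>j<k. (\<lambda>n. K n i j) \<longlonglongrightarrow> (if i = j then 1 else 0)) \<and>
     eventually (\<lambda>n. frame k (K n) (comb k A (S n))) sequentially"
    by (rule frame_perturbation[OF comb_mem comb_tendsto e'on]) (auto intro: S)
  then obtain K where K0: "\<forall>i<k. \<forall>j<k. (\<lambda>n. K n i j) \<longlonglongrightarrow> (if i = j then 1 else 0)"
    "eventually (\<lambda>n. frame k (K n) (comb k A (S n))) sequentially" by auto
  note K = K0(1)[rule_format] K0(2)
  define An where "An n = mat_prod k (K n) A" for n
  have Alim: "(\<lambda>n. An n i j) \<longlonglongrightarrow> A i j" if "i < k" "j < k" for i j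
  proof -
    have "(\<lambda>n. An n i j) \<longlonglongrightarrow> (\<Sum>l<k. (if i = l then 1 else 0) * A l j)"
      unfolding An_def mat_prod_def using that by (intro tendsto_sum tendsto_mult K tendsto_const) auto
    also have "(\<Sum>l<k. (if i = l then 1 else 0) * A l j) = (\<Sum>l<k. if i = l then A l j else 0)"
      by (rule sum.cong) auto
    finally show ?thesis using that by simp
  qed
  define e where "e n = comb k (An n) (S n)" for n
  have eH: "e n j \<in> H" for n j unfolding e_def using S(1) by (rule comb_mem)
  have e'H: "comb k A S' j \<in> H" if "j < k" for j using e'on that by (auto simp: orthonormal_def)
  have elim: "(\<lambda>n. e n j w) \<longlonglongrightarrow> comb k A S' j w" if "j < k" for j w
    unfolding e_def using that by (intro comb_tendsto Alim S)
  define C where "C n i j = inner_rv M (D n i) (e n j)" for n i j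
  define R where "R n i = residual k (e n) (D n i)" for n i
  \<comment> \<open>\<open>C n\<close> holds the regression coefficients on the frame,
    \<open>B n\<close> those on \<open>S n\<close>.\<close>
  define B where "B n = mat_prod k (C n) (An n)" for n
  have Clim: "(\<lambda>n. C n i j) \<longlonglongrightarrow> inner_rv M (D' i) (comb k A S' j)" if "i < k" "j < k" for i j
    unfolding C_def using that by (intro inner_tendsto D eH elim D' e'H)
  have Blim: "(\<lambda>n. B n i j) \<longlonglongrightarrow> (\<Sum>l<k. inner_rv M (D' i) (comb k A S' l) * A l j)" if "i < k" "j < k" for i j
    unfolding B_def mat_prod_def using that by (intro tendsto_sum tendsto_mult Clim Alim) auto
  have RH: "R n i \<in> H" if "i < k" for n i
    unfolding R_def residual_def[abs_def] using D(1)[OF that] eH by (intro diff_mem sum_mem) auto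
  have Rlim: "(\<lambda>n. R n i w) \<longlonglongrightarrow> residual k (comb k A S') (D' i) w" if "i < k" for i w
    unfolding R_def using that by (intro residual_tendsto eH elim D D' e'H)
  have cl: "(\<lambda>n. crossing M k (An n) (B n) (R n) (h n)) \<longlonglongrightarrow>
    ennreal ((2 / sqrt (2 * pi)) ^ k * (\<integral>w. (\<Prod>i<k. \<bar>residual k (comb k A S') (D' i) w\<bar>) \<partial>M))"
    by (rule crossing_tendsto[OF Alim Blim gauss[OF RH] Rlim h(2)])
  define I where "I = (\<integral>w. (\<Prod>i<k. \<bar>residual k (comb k A S') (D' i) w\<bar>) \<partial>M)"
  have I: "I \<ge> 0" unfolding I_def by (intro Bochner_Integration.integral_nonneg prod_nonneg) auto
  have "(\<lambda>n. ennreal ((\<Prod>j<k. \<bar>An n j j\<bar>) / 2 ^ k) * crossing M k (An n) (B n) (R n) (h n)) \<longlonglongrightarrow>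
     ennreal ((\<Prod>j<k. \<bar>A j j\<bar>) / 2 ^ k) * ennreal ((2 / sqrt (2 * pi)) ^ k * I)"
    by (intro tendsto_mult_ennreal tendsto_ennrealI tendsto_divide tendsto_prod tendsto_rabs Alim
        cl[folded I_def] tendsto_const) auto
  also have "ennreal ((\<Prod>j<k. \<bar>A j j\<bar>) / 2 ^ k) * ennreal ((2 / sqrt (2 * pi)) ^ k * I) = ennreal (crossing_const k A S' D')"
    using I by (subst ennreal_mult[symmetric])
      (auto simp: prod_nonneg crossing_const_def I_def[symmetric] power_divide field_simps)
  finally have lim: "(\<lambda>n. ennreal ((\<Prod>j<k. \<bar>An n j j\<bar>) / 2 ^ k) * crossing M k (An n) (B n) (R n) (h n)) \<longlonglongrightarrow>
     ennreal (crossing_const k A S' D')" .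
  have "eventually (\<lambda>n. ennreal ((\<Prod>j<k. \<bar>An n j j\<bar>) / 2 ^ k) * crossing M k (An n) (B n) (R n) (h n) =
      emeasure M {w \<in> space M. \<forall>i<k. \<bar>S n i w\<bar> < h n * \<bar>D n i w\<bar>} / ennreal ((2 * h n) ^ k)) sequentially"
    using K(2)
  proof eventually_elim
    fix n assume "frame k (K n) (comb k A (S n))"
    then have fr: "frame k (An n) (S n)" unfolding An_def by (rule frame_comp[OF _ triA S(1)])
    then have on: "orthonormal k (e n)" by (simp add: frame_def e_def)
    obtain L where L: "lower_triangular k L" "\<And>i. i < k \<Longrightarrow> L i i = 1 / An n i i"
      "\<And>v i. i < k \<Longrightarrow> lin k (An n) (lin k L v) i = v i"
      "\<And>i. i < k \<Longrightarrow> S n i = comb k L (e n) i"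
      using frame_inverse[OF fr] unfolding e_def by metis
    have "emeasure M {w \<in> space M. \<forall>i<k. \<bar>S n i w\<bar> < h n * \<bar>D n i w\<bar>} =
      ennreal (h n ^ k * (\<Prod>j<k. 1 / \<bar>L j j\<bar>)) * crossing M k (An n) (B n) (R n) (h n)"
    proof (rule emeasure_crossing[OF eH _ RH _ L(1) L(3) _ _ h(1)])
      show "inner_rv M (e n i) (e n j) = (if i = j then 1 else 0)" if "i < k" "j < k" for i j
        using on that by (auto simp: orthonormal_def)
      show "inner_rv M (R n i) (e n j) = 0" if "i < k" "j < k" for i j
        unfolding R_def using that by (intro residual_orthogonal[OF on] D)
      show "S n i w = lin k L (\<lambda>j. e n j w) i" if "i < k" for i w
        using L(4)[OF that] by (simp add: comb_def)
      show "D n i w = lin k (B n) (\<lambda>j. S n j w) i + R n i w" if "i < k" for i w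
      proof -
        have "lin k (B n) (\<lambda>j. S n j w) i = lin k (C n) (\<lambda>j. e n j w) i"
          by (simp add: B_def lin_mat_prod e_def comb_def[abs_def])
        then show ?thesis by (simp add: R_def residual_def C_def lin_def)
      qed
    qed
    also have "(\<Prod>j<k. 1 / \<bar>L j j\<bar>) = (\<Prod>j<k. \<bar>An n j j\<bar>)"
      by (rule prod.cong) (auto simp: L(2))
    finally have em: "emeasure M {w \<in> space M. \<forall>i<k. \<bar>S n i w\<bar> < h n * \<bar>D n i w\<bar>} =
      ennreal (h n ^ k * (\<Prod>j<k. \<bar>An n j j\<bar>)) * crossing M k (An n) (B n) (R n) (h n)" .
    have "ennreal (h n ^ k * (\<Prod>j<k. \<bar>An n j j\<bar>)) / ennreal ((2 * h n) ^ k) =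
       ennreal (h n ^ k * (\<Prod>j<k. \<bar>An n j j\<bar>) / (2 * h n) ^ k)"
      using h(1)[of n] by (intro divide_ennreal) (auto simp: prod_nonneg)
    also have "h n ^ k * (\<Prod>j<k. \<bar>An n j j\<bar>) / (2 * h n) ^ k = (\<Prod>j<k. \<bar>An n j j\<bar>) / 2 ^ k"
      using h(1)[of n] by (simp add: power_mult_distrib)
    finally show "ennreal ((\<Prod>j<k. \<bar>An n j j\<bar>) / 2 ^ k) * crossing M k (An n) (B n) (R n) (h n) =
      emeasure M {w \<in> space M. \<forall>i<k. \<bar>S n i w\<bar> < h n * \<bar>D n i w\<bar>} / ennreal ((2 * h n) ^ k)"
      unfolding em by (simp add: divide_ennreal_def mult.assoc mult.left_commute mult.commute)
  qed
  with lim show ?thesis by (rule Lim_transform_eventually)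
qed

text \<open>With \<open>h = 0\<close> and zero matrices, \<open>crossing\<close> equals this
  expectation times a positive constant, so the domination already proved for crossings is reused
  for absolute moments.\<close>

lemma expectation_abs_prod_tendsto:
  fixes k :: nat
  assumes g: "\<And>n i. i < k \<Longrightarrow> R n i \<in> H" and R: "\<And>i w. i < k \<Longrightarrow> (\<lambda>n. R n i w) \<longlonglongrightarrow> R' i w"
  shows "(\<lambda>n. \<integral>w. (\<Prod>i<k. \<bar>R n i w\<bar>) \<partial>M) \<longlonglongrightarrow> (\<integral>w. (\<Prod>i<k. \<bar>R' i w\<bar>) \<partial>M)"
proof -
  define c where "c = (2 / sqrt (2 * pi)) ^ k"
  have c: "c > 0" by (simp add: c_def)
  define I where "I R = (\<integral>w. (\<Prod>i<k. \<bar>R i w\<bar>) \<partial>M)" for R :: "nat \<Rightarrow> 'w \<Rightarrow> real"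
  have I: "I R \<ge> 0" for R unfolding I_def by (intro Bochner_Integration.integral_nonneg prod_nonneg) auto
  have "crossing M k (\<lambda>_ _. 0) (\<lambda>_ _. 0) (R n) 0 = ennreal (c * I (R n))" for n
  proof (rule LIMSEQ_unique)
    show "(\<lambda>m :: nat. crossing M k (\<lambda>_ _. 0) (\<lambda>_ _. 0) (R n) 0) \<longlonglongrightarrow> ennreal (c * I (R n))"
      unfolding c_def I_def by (rule crossing_tendsto) (auto intro: gauss g)
  qed simp
  moreover have "(\<lambda>n. crossing M k (\<lambda>_ _. 0) (\<lambda>_ _. 0) (R n) 0) \<longlonglongrightarrow> ennreal (c * I R')"
    unfolding c_def I_def by (rule crossing_tendsto) (auto intro: gauss g R)
  ultimately have "(\<lambda>n. ennreal (c * I (R n))) \<longlonglongrightarrow> ennreal (c * I R')" by simp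
  then have "(\<lambda>n. c * I (R n)) \<longlonglongrightarrow> c * I R'"
    using c I by (subst (asm) tendsto_ennreal_iff) auto
  then have "(\<lambda>n. c * I (R n) / c) \<longlonglongrightarrow> c * I R' / c" using c by (intro tendsto_divide tendsto_const) auto
  then show ?thesis using c by (simp add: I_def)
qed

end

section \<open>Zeros and sign changes of a differentiable function\<close>

text \<open>The centres \<open>c n\<close> move, so differentiability at \<open>x\<close> alone is
  too weak; the mean value theorem and continuity of the derivative at \<open>x\<close> replace
  it.\<close>

lemma symmetric_quotient_tendsto:
  fixes g g' :: "real \<Rightarrow> real"
  assumes d: "\<And>t. (g has_real_derivative g' t) (at t)" and cont: "isCont g' x"
    and c: "c \<longlonglongrightarrow> x" and h: "h \<longlonglongrightarrow> 0" "\<And>n :: nat. h n > 0"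
  shows "(\<lambda>n. (g (c n + h n) - g (c n - h n)) / (2 * h n)) \<longlonglongrightarrow> g' x"
proof -
  have "\<exists>z. c n - h n < z \<and> z < c n + h n \<and> g (c n + h n) - g (c n - h n) = (c n + h n - (c n - h n)) * g' z" for n
    by (rule MVT2) (use h(2)[of n] d in auto)
  then obtain z where z: "\<And>n. c n - h n < z n" "\<And>n. z n < c n + h n"
    "\<And>n. g (c n + h n) - g (c n - h n) = (c n + h n - (c n - h n)) * g' (z n)" by metis
  have "z \<longlonglongrightarrow> x"
  proof (rule tendsto_sandwich)
    show "(\<lambda>n. c n - h n) \<longlonglongrightarrow> x" "(\<lambda>n. c n + h n) \<longlonglongrightarrow> x"
      using tendsto_diff[OF c h(1)] tendsto_add[OF c h(1)] by auto
  qed (auto intro!: always_eventually less_imp_le z)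
  then have "(\<lambda>n. g' (z n)) \<longlonglongrightarrow> g' x" by (rule isCont_tendsto_compose[OF cont])
  moreover have "(g (c n + h n) - g (c n - h n)) / (2 * h n) = g' (z n)" for n
    using h(2)[of n] by (simp add: z(3))
  ultimately show ?thesis by simp
qed

text \<open>Multiplying the difference quotient by \<open>D\<close> makes its limit
  \<open>D * D\<close> positive whatever the sign of \<open>D\<close>.\<close>

lemma simple_zero_sign_change:
  fixes g :: "real \<Rightarrow> real"
  assumes d: "(g has_real_derivative D) (at z)" and D: "D \<noteq> 0" and z: "g z = 0"
  shows "eventually (\<lambda>\<delta>. \<forall>s s'. z - \<delta> < s \<and> s < z \<and> z < s' \<and> s' < z + \<delta> \<longrightarrow> g s * g s' < 0) (at_right 0)"
    and "eventually (\<lambda>t. g t \<noteq> 0) (at z)"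
proof -
  have "((\<lambda>t. (g t - g z) / (t - z)) \<longlongrightarrow> D) (at z)"
    using d by (simp add: has_field_derivative_iff)
  then have "((\<lambda>t. g t / (t - z) * D) \<longlongrightarrow> D * D) (at z)"
    using z by (intro tendsto_mult tendsto_const) auto
  moreover have "D * D > 0" using D by (metis not_real_square_gt_zero)
  ultimately have ev: "eventually (\<lambda>t. g t / (t - z) * D > 0) (at z)" by (rule order_tendstoD(1))
  then show "eventually (\<lambda>t. g t \<noteq> 0) (at z)" by eventually_elim auto
  obtain \<delta> where \<delta>: "\<delta> > 0" "\<And>t. t \<noteq> z \<Longrightarrow> dist t z < \<delta> \<Longrightarrow> g t / (t - z) * D > 0"
    using ev unfolding eventually_at by auto
  have main: "g s * g s' < 0" if "z - \<delta> < s" "s < z" "z < s'" "s' < z + \<delta>" for s s'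
  proof -
    have p: "g s / (s - z) * D > 0" by (rule \<delta>) (use that in \<open>auto simp: dist_real_def\<close>)
    have q: "g s' / (s' - z) * D > 0" by (rule \<delta>) (use that in \<open>auto simp: dist_real_def\<close>)
    show ?thesis
    proof (cases "D > 0")
      case True
      then have "g s / (s - z) > 0" "g s' / (s' - z) > 0"
        using zero_less_mult_pos2[OF p] zero_less_mult_pos2[OF q] by auto
      then show ?thesis using that by (auto simp: zero_less_divide_iff mult_neg_pos)
    next
      case False
      then have "D < 0" using D by simp
      have neg: "x < 0" if "x * D > 0" for x using that \<open>D < 0\<close> by (simp add: zero_less_mult_iff)
      have "g s / (s - z) < 0" "g s' / (s' - z) < 0" using neg[OF p] neg[OF q] by auto
      then show ?thesis using that by (auto simp: divide_less_0_iff mult_pos_neg)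
    qed
  qed
  show "eventually (\<lambda>\<delta>. \<forall>s s'. z - \<delta> < s \<and> s < z \<and> z < s' \<and> s' < z + \<delta> \<longrightarrow> g s * g s' < 0) (at_right 0)"
    unfolding eventually_at_right_field
  proof (intro exI[of _ \<delta>] conjI allI impI)
    fix y s s' assume y: "0 < y" "y < \<delta>" and s: "z - y < s \<and> s < z \<and> z < s' \<and> s' < z + y"
    show "g s * g s' < 0" by (rule main) (use y s in auto)
  qed (use \<delta>(1) in auto)
qed

section \<open>Counting simple zeros on a grid\<close>

definition grid :: "real \<Rightarrow> real \<Rightarrow> nat \<Rightarrow> nat \<Rightarrow> real" where
  "grid a b m j = a + (b - a) * real j / real m"

lemma grid_0 [simp]: "grid a b m 0 = a" by (simp add: grid_def)

lemma grid_self [simp]: "m > 0 \<Longrightarrow> grid a b m m = b" by (simp add: grid_def)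

lemma grid_Suc: "grid a b m (Suc j) = grid a b m j + (b - a) / real m"
  by (simp add: grid_def distrib_left add_divide_distrib)

text \<open>The value \<open>j = m\<close> does occur: \<open>t = b\<close> lies in the cell that
  begins at \<open>b\<close>. It is excluded in \<open>zeros_le_sign_changes\<close>, where grid
  points are not zeros.\<close>

lemma grid_cell:
  assumes "a < b" "m > 0" "a \<le> t" "t \<le> b"
  obtains j where "j \<le> m" "grid a b m j \<le> t" "t < grid a b m (Suc j)"
proof
  define j where "j = nat \<lfloor>(t - a) * real m / (b - a)\<rfloor>"
  have nn: "(t - a) * real m / (b - a) \<ge> 0" using assms by simp
  then have j: "real j \<le> (t - a) * real m / (b - a)" "(t - a) * real m / (b - a) < real j + 1"
    unfolding j_def by linarith+
  have "(t - a) * real m / (b - a) \<le> real m" using assms by (simp add: divide_le_eq mult.commute mult_left_mono)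
  then show "j \<le> m" using j(1) by linarith
  show "grid a b m j \<le> t" "t < grid a b m (Suc j)"
    using j assms by (auto simp: grid_def field_simps)
qed

text \<open>Infinitely many zeros in a compact interval would accumulate at a zero, but simple zeros
  are isolated.\<close>

lemma finite_simple_zeros:
  fixes g :: "real \<Rightarrow> real"
  assumes d: "\<And>t. (g has_real_derivative g' t) (at t)"
    and nt: "\<And>t. a \<le> t \<Longrightarrow> t \<le> b \<Longrightarrow> g t = 0 \<Longrightarrow> g' t \<noteq> 0"
  shows "finite ({t. g t = 0} \<inter> {a..b})"
proof (rule ccontr)
  assume inf: "infinite ({t. g t = 0} \<inter> {a..b})"
  have "compact {a..b}" by simp
  with inf obtain z where z: "z \<in> {a..b}" "z islimpt ({t. g t = 0} \<inter> {a..b})"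
    unfolding compact_eq_Bolzano_Weierstrass by blast
  have cont: "continuous_on UNIV g" using d by (meson DERIV_continuous_on)
  have fr: "frequently (\<lambda>t. g t = 0) (at z)"
    using z(2) unfolding islimpt_conv_frequently_at by (rule frequently_mono[rotated]) auto
  have "closed {t. g t = 0}" using cont by (intro closed_Collect_eq) (auto intro: continuous_on_const)
  moreover have "z islimpt {t. g t = 0}" using z(2) by (rule islimpt_subset) auto
  ultimately have "g z = 0" by (auto simp: closed_limpt)
  then have "eventually (\<lambda>t. g t \<noteq> 0) (at z)"
    using simple_zero_sign_change(2)[OF d[of z] nt] z(1) by auto
  with fr show False by (simp add: frequently_def)
qed

text \<open>The zeros are finitely many and so share one radius \<open>\<delta>\<close> within which
  the sign changes across them. Once the mesh is below \<open>\<delta>\<close>, every zero lies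
  inside a cell with a sign change, and distinct zeros lie in distinct cells.\<close>

lemma zeros_le_sign_changes:
  fixes g :: "real \<Rightarrow> real"
  assumes ab: "a < b" and d: "\<And>t. (g has_real_derivative g' t) (at t)"
    and nt: "\<And>t. a \<le> t \<Longrightarrow> t \<le> b \<Longrightarrow> g t = 0 \<Longrightarrow> g' t \<noteq> 0"
    and gr: "\<And>m j. g (grid a b (Suc m) j) \<noteq> 0"
  shows "eventually (\<lambda>m. card ({t. g t = 0} \<inter> {a..b}) \<le>
     card {j. j < Suc m \<and> g (grid a b (Suc m) j) * g (grid a b (Suc m) (Suc j)) < 0}) sequentially"
proof -
  define Z where "Z = {t. g t = 0} \<inter> {a..b}"
  have fin: "finite Z" unfolding Z_def by (rule finite_simple_zeros[OF d nt])
  have "eventually (\<lambda>\<delta>. \<forall>z\<in>Z. \<forall>s s'. z - \<delta> < s \<and> s < z \<and> z < s' \<and> s' < z + \<delta> \<longrightarrow> g s * g s' < 0) (at_right 0)"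
    by (rule eventually_ball_finite[OF fin]) (use nt in \<open>auto simp: Z_def intro!: simple_zero_sign_change(1)[OF d]\<close>)
  then obtain \<delta> where \<delta>: "\<delta> > 0"
    "\<And>z s s'. z \<in> Z \<Longrightarrow> z - \<delta> < s \<Longrightarrow> s < z \<Longrightarrow> z < s' \<Longrightarrow> s' < z + \<delta> \<Longrightarrow> g s * g s' < 0"
    using eventually_happens'[OF trivial_limit_at_right_real[of 0]
      eventually_conj[OF _ eventually_at_right_less[of 0]]] by (metis (no_types, lifting))
  have "(\<lambda>m. (b - a) * (1 / real (Suc m))) \<longlonglongrightarrow> (b - a) * 0"
    by (intro tendsto_mult tendsto_const) (use LIMSEQ_inverse_real_of_nat in \<open>simp add: inverse_eq_divide\<close>)
  then have "eventually (\<lambda>m. (b - a) * (1 / real (Suc m)) < \<delta>) sequentially"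
    using \<delta>(1) by (intro order_tendstoD(2)) auto
  then show ?thesis
  proof eventually_elim
    fix m assume m: "(b - a) * (1 / real (Suc m)) < \<delta>"
    define p where "p j = grid a b (Suc m) j" for j
    have step: "p (Suc j) < p j + \<delta>" for j using m by (simp add: p_def grid_Suc)
    have "\<forall>z\<in>Z. \<exists>j. j \<le> Suc m \<and> p j \<le> z \<and> z < p (Suc j)"
      unfolding p_def using grid_cell[OF ab, of "Suc m"] by (auto simp: Z_def) metis
    then obtain J where J: "\<And>z. z \<in> Z \<Longrightarrow> J z \<le> Suc m" "\<And>z. z \<in> Z \<Longrightarrow> p (J z) \<le> z" "\<And>z. z \<in> Z \<Longrightarrow> z < p (Suc (J z))"
      by metis
    have strict: "p (J z) < z" if "z \<in> Z" for z
      using J(2)[OF that] gr[of m "J z"] that by (auto simp: p_def Z_def less_le)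
    have Jm: "J z < Suc m" if "z \<in> Z" for z
    proof (rule ccontr)
      assume "\<not> J z < Suc m"
      then have "J z = Suc m" using J(1)[OF that] by simp
      then have "b < z" using strict[OF that] by (simp add: p_def)
      then show False using that by (simp add: Z_def)
    qed
    have "J ` Z \<subseteq> {j. j < Suc m \<and> g (p j) * g (p (Suc j)) < 0}"
    proof safe
      fix z assume z: "z \<in> Z"
      show "J z < Suc m" by (rule Jm[OF z])
      show "g (p (J z)) * g (p (Suc (J z))) < 0"
        by (rule \<delta>(2)[OF z]) (use strict[OF z] J(3)[OF z] step[of "J z"] in auto)
    qed
    moreover have "inj_on J Z"
    proof (rule linorder_inj_onI')
      fix z z' assume z: "z \<in> Z" "z' \<in> Z" "z < z'"
      show "J z \<noteq> J z'"
      proof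
        assume e: "J z = J z'"
        \<comment> \<open>In a common cell \<open>z'\<close> would lie within
          \<open>\<delta>\<close> to the right of \<open>z\<close>, where \<open>g\<close> has a
          strict sign.\<close>
        have "g (p (J z)) * g z' < 0"
          by (rule \<delta>(2)[OF z(1)]) (use strict[OF z(1)] J(3)[OF z(2)] step[of "J z"] z e in auto)
        then show False using z(2) by (simp add: Z_def)
      qed
    qed
    ultimately show "card ({t. g t = 0} \<inter> {a..b}) \<le>
     card {j. j < Suc m \<and> g (grid a b (Suc m) j) * g (grid a b (Suc m) (Suc j)) < 0}"
      unfolding Z_def[symmetric] p_def[symmetric] by (intro card_inj_on_le[of J]) auto
  qed
qed

section \<open>The Kac--Rice formula\<close>

lemma unit_gaussian_distr:
  assumes "centered_gaussian M X" "inner_rv M X X = 1"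
  shows "distr M borel X = std_normal_distribution"
proof -
  obtain s where s: "s \<ge> 0" "distr M borel X = normal_law 0 s" using assms(1) by (auto simp: centered_gaussian_def)
  obtain s' where s': "s' \<ge> 0" "distr M borel X = distr std_normal_distribution borel (\<lambda>x. s' * x)" "inner_rv M X X = s'\<^sup>2"
    using centered_gaussianE[OF assms(1)] by blast
  have "s' = 1" using s'(1,3) assms(2) by (simp add: power2_eq_1_iff)
  then have "distr M borel X = normal_law 0 1" using s'(2) normal_law_eq_distr[of 1 0] by simp
  then show ?thesis by (simp add: normal_law_def)
qed

lemma unit_gaussian_small_ball:
  assumes X: "centered_gaussian M X" "inner_rv M X X = 1" and c: "c \<ge> 0"
  shows "emeasure M {w \<in> space M. \<bar>X w\<bar> \<le> c} \<le> ennreal (2 * c)"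
proof -
  have [measurable]: "X \<in> borel_measurable M" using X(1) by (rule centered_gaussian_measurable)
  have "{w \<in> space M. \<bar>X w\<bar> \<le> c} = X -` {-c..c} \<inter> space M" by (auto simp: abs_le_iff)
  then have "emeasure M {w \<in> space M. \<bar>X w\<bar> \<le> c} = emeasure (distr M borel X) {-c..c}"
    by (simp add: emeasure_distr)
  also have "\<dots> = (\<integral>\<^sup>+x. ennreal (std_normal_density x) * indicator {-c..c} x \<partial>lborel)"
    unfolding unit_gaussian_distr[OF X] by (rule emeasure_density) auto
  also have "\<dots> \<le> (\<integral>\<^sup>+x. indicator {-c..c} x \<partial>lborel)"
  proof (rule nn_integral_mono)
    fix x :: real
    have "exp (- (x\<^sup>2) / 2) \<le> 1" by simp
    moreover have "1 \<le> sqrt (2 * pi)" using pi_gt3 by simp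
    ultimately have "1 / sqrt (2 * pi) * exp (- (x\<^sup>2) / 2) \<le> 1 * 1" by (intro mult_mono) auto
    then have "ennreal (std_normal_density x) \<le> 1" by (simp only: std_normal_density_def ennreal_le_1)
    then show "ennreal (std_normal_density x) * indicator {-c..c} x \<le> indicator {-c..c} x"
      by (auto simp: indicator_def)
  qed
  also have "\<dots> = ennreal (2 * c)" using c by simp
  finally show ?thesis .
qed

lemma unit_gaussian_AE_nonzero:
  assumes X: "centered_gaussian M X" "inner_rv M X X = 1"
  shows "AE w in M. X w \<noteq> 0"
proof -
  have [measurable]: "X \<in> borel_measurable M" using X(1) by (rule centered_gaussian_measurable)
  have "AE x in lborel. x \<noteq> (0::real)" by (rule AE_lborel_singleton)
  then have "AE x in lborel. 0 < ennreal (std_normal_density x) \<longrightarrow> x \<noteq> 0" by eventually_elim simp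
  then have "AE x in std_normal_distribution. x \<noteq> 0" by (subst AE_density) auto
  then have "AE x in distr M borel X. x \<noteq> 0" unfolding unit_gaussian_distr[OF X] .
  then show ?thesis by (subst (asm) AE_distr_iff) auto
qed

text \<open>Differentiability and continuity are required for every \<open>w\<close>, so that limits
  can be taken pointwise; the exceptional null set is removed once and for all in
  \<open>smooth_version\<close>.\<close>

locale smooth_gaussian = gaussian_space M H for M :: "'w measure" and H +
  fixes f f' :: "real \<Rightarrow> 'w \<Rightarrow> real"
  assumes f_mem: "f t \<in> H" and f'_mem: "f' t \<in> H"
    and unit_variance: "inner_rv M (f t) (f t) = 1"
    and deriv: "\<And>w t. ((\<lambda>s. f s w) has_real_derivative f' t w) (at t)"
    and cont_deriv: "\<And>w. continuous_on UNIV (\<lambda>t. f' t w)"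
begin

lemma f_measurable [measurable]: "f t \<in> borel_measurable M"
  using f_mem by (rule meas)

text \<open>Bulinskaya's lemma: if \<open>f\<close> has a double zero, then at every fine enough scale \<open>1 / n\<close> some
  grid value is \<open>\<le> \<eta> / n\<close>, and this has probability at most of order \<open>\<eta>\<close>.\<close>

lemma no_double_zero:
  assumes ab: "a < b"
  shows "AE w in M. \<forall>t. a \<le> t \<and> t \<le> b \<and> f t w = 0 \<longrightarrow> f' t w \<noteq> 0"
proof -
  define E where "E \<eta> n = {w \<in> space M. \<exists>j\<in>{..Suc n}. \<bar>f (grid a b (Suc n) j) w\<bar> \<le> \<eta> * ((b - a) / real (Suc n))}" for \<eta> n
  define B where "B \<eta> = (\<Union>N. \<Inter>n\<in>{N..}. E \<eta> n)" for \<eta>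
  have E [measurable]: "E \<eta> n \<in> sets M" for \<eta> n
    unfolding E_def by (intro sets.sets_Collect_finite_Ex) measurable
  have B: "B \<eta> \<in> sets M" for \<eta>
    unfolding B_def by (intro sets.countable_UN sets.countable_INT) auto
  have Eb: "emeasure M (E \<eta> n) \<le> ennreal (4 * \<eta> * (b - a))" if \<eta>: "\<eta> \<ge> 0" for \<eta> n
  proof -
    define c where "c = \<eta> * ((b - a) / real (Suc n))"
    have c: "c \<ge> 0" using \<eta> ab by (simp add: c_def)
    have "E \<eta> n = (\<Union>j\<in>{..Suc n}. {w \<in> space M. \<bar>f (grid a b (Suc n) j) w\<bar> \<le> c})"
      by (auto simp: E_def c_def)
    then have "emeasure M (E \<eta> n) \<le> (\<Sum>j\<in>{..Suc n}. emeasure M {w \<in> space M. \<bar>f (grid a b (Suc n) j) w\<bar> \<le> c})"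
      by (simp only:) (rule emeasure_subadditive_finite; auto)
    also have "\<dots> \<le> (\<Sum>j\<in>{..Suc n}. ennreal (2 * c))"
      by (intro sum_mono unit_gaussian_small_ball gauss f_mem unit_variance c)
    also have "\<dots> = ennreal (real (Suc (Suc n)) * (2 * c))"
      using c by (simp add: ennreal_mult ennreal_of_nat_eq_real_of_nat del: of_nat_Suc)
    \<comment> \<open>There are \<open>n + 2\<close> grid points, at most \<open>2 (n + 1)\<close>,
      each contributing \<open>2 c\<close>; the mesh contained in \<open>c\<close> cancels the
      factor \<open>n + 1\<close>.\<close>
    also have "\<dots> \<le> ennreal (4 * \<eta> * (b - a))"
    proof (rule ennreal_leI)
      have "real (Suc (Suc n)) * (2 * c) \<le> (2 * real (Suc n)) * (2 * c)" using c by (intro mult_right_mono) auto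
      also have "\<dots> = 4 * \<eta> * (b - a)" by (simp add: c_def field_simps)
      finally show "real (Suc (Suc n)) * (2 * c) \<le> 4 * \<eta> * (b - a)" .
    qed
    finally show ?thesis .
  qed
  have Bb: "emeasure M (B \<eta>) \<le> ennreal (4 * \<eta> * (b - a))" if \<eta>: "\<eta> \<ge> 0" for \<eta>
  proof -
    have "(SUP N. emeasure M (\<Inter>n\<in>{N..}. E \<eta> n)) = emeasure M (B \<eta>)"
      unfolding B_def
    proof (rule SUP_emeasure_incseq)
      show "range (\<lambda>N. \<Inter>n\<in>{N..}. E \<eta> n) \<subseteq> sets M" by (auto intro!: sets.countable_INT)
      show "incseq (\<lambda>N. \<Inter>n\<in>{N..}. E \<eta> n)" by (rule incseq_SucI) (rule INF_superset_mono, auto)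
    qed
    moreover have "(SUP N. emeasure M (\<Inter>n\<in>{N..}. E \<eta> n)) \<le> ennreal (4 * \<eta> * (b - a))"
    proof (rule SUP_least)
      fix N
      have "emeasure M (\<Inter>n\<in>{N..}. E \<eta> n) \<le> emeasure M (E \<eta> N)" by (intro emeasure_mono E) auto
      also have "\<dots> \<le> ennreal (4 * \<eta> * (b - a))" by (rule Eb[OF \<eta>])
      finally show "emeasure M (\<Inter>n\<in>{N..}. E \<eta> n) \<le> ennreal (4 * \<eta> * (b - a))" .
    qed
    ultimately show ?thesis by simp
  qed
  \<comment> \<open>Every path with a double zero in the interval lies in \<open>B \<eta>\<close>
    for all \<open>\<eta> > 0\<close>, and the probability of \<open>B \<eta>\<close> is of order
    \<open>\<eta>\<close>; a sequence of values \<open>\<eta>\<close> tending to 0 keeps the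
    intersection measurable and null.\<close>
  define N where "N = (\<Inter>m. B (1 / real (Suc m)))"
  have Ns: "N \<in> sets M" unfolding N_def by (intro sets.countable_INT) (auto intro: B)
  have "emeasure M N = 0"
  proof -
    have "emeasure M N \<le> ennreal (4 * (1 / real (Suc m)) * (b - a))" for m
    proof -
      have "emeasure M N \<le> emeasure M (B (1 / real (Suc m)))" unfolding N_def by (intro emeasure_mono B) auto
      also have "\<dots> \<le> ennreal (4 * (1 / real (Suc m)) * (b - a))" by (rule Bb) simp
      finally show ?thesis .
    qed
    moreover have "(\<lambda>m. ennreal (4 * (1 / real (Suc m)) * (b - a))) \<longlonglongrightarrow> ennreal (4 * 0 * (b - a))"
      by (intro tendsto_ennrealI tendsto_mult tendsto_const)
         (use LIMSEQ_inverse_real_of_nat in \<open>simp add: inverse_eq_divide\<close>)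
    ultimately have "emeasure M N \<le> ennreal (4 * 0 * (b - a))"
      by (intro LIMSEQ_le_const) auto
    then show ?thesis by simp
  qed
  then have "N \<in> null_sets M" using Ns by auto
  moreover have "{w \<in> space M. \<not> (\<forall>t. a \<le> t \<and> t \<le> b \<and> f t w = 0 \<longrightarrow> f' t w \<noteq> 0)} \<subseteq> N"
  proof (rule subsetI)
    fix w assume "w \<in> {w \<in> space M. \<not> (\<forall>t. a \<le> t \<and> t \<le> b \<and> f t w = 0 \<longrightarrow> f' t w \<noteq> 0)}"
    then obtain t where w: "w \<in> space M" and t: "a \<le> t" "t \<le> b" "f t w = 0" "f' t w = 0" by auto
    \<comment> \<open>Near the double zero \<open>t\<close> the derivative is at most
      \<open>\<eta>\<close> in modulus, so the grid point just left of \<open>t\<close> carries a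
      value of at most \<open>\<eta>\<close> times the mesh.\<close>
    have "w \<in> B \<eta>" if \<eta>: "\<eta> > 0" for \<eta>
    proof -
      have "isCont (\<lambda>s. f' s w) t" using cont_deriv by (simp add: continuous_on_eq_continuous_at)
      then obtain \<delta> where \<delta>: "\<delta> > 0" "\<And>s. \<bar>s - t\<bar> < \<delta> \<Longrightarrow> \<bar>f' s w\<bar> < \<eta>"
        using t(4) \<eta> unfolding continuous_at_eps_delta dist_real_def by auto
      have "(\<lambda>m. (b - a) * (1 / real (Suc m))) \<longlonglongrightarrow> (b - a) * 0"
        by (intro tendsto_mult tendsto_const) (use LIMSEQ_inverse_real_of_nat in \<open>simp add: inverse_eq_divide\<close>)
      then have "eventually (\<lambda>m. (b - a) * (1 / real (Suc m)) < \<delta>) sequentially"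
        using \<delta>(1) by (intro order_tendstoD(2)) auto
      then obtain n0 where n0: "\<And>m. m \<ge> n0 \<Longrightarrow> (b - a) * (1 / real (Suc m)) < \<delta>"
        by (auto simp: eventually_sequentially)
      have "w \<in> E \<eta> n" if n: "n \<ge> n0" for n
      proof -
        obtain j where j: "j \<le> Suc n" "grid a b (Suc n) j \<le> t" "t < grid a b (Suc n) (Suc j)"
          using grid_cell[OF ab, of "Suc n" t] t by auto
        define s where "s = grid a b (Suc n) j"
        have s: "s \<le> t" "t - s < (b - a) / real (Suc n)" using j by (auto simp: s_def grid_Suc)
        have "\<bar>f s w\<bar> \<le> \<eta> * (t - s)"
        proof (cases "s = t")
          case True
          then show ?thesis using t by simp
        next
          case False
          then have st: "s < t" using s by simp
          obtain z where z: "s < z" "z < t" "f t w - f s w = (t - s) * f' z w"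
            using MVT2[OF st, of "\<lambda>s. f s w" "\<lambda>s. f' s w"] deriv by blast
          have "\<bar>z - t\<bar> < \<delta>" using z s n0[OF n] by auto
          then have "\<bar>f' z w\<bar> \<le> \<eta>" using \<delta>(2) by (simp add: less_imp_le)
          moreover have "f s w = - ((t - s) * f' z w)" using z(3) t(3) by simp
          then have "\<bar>f s w\<bar> = (t - s) * \<bar>f' z w\<bar>" using st by (simp only:) (simp add: abs_mult)
          ultimately show ?thesis using st by (simp add: mult.commute mult_right_mono)
        qed
        also have "\<dots> \<le> \<eta> * ((b - a) / real (Suc n))" using s \<eta> by (intro mult_left_mono) auto
        finally show ?thesis using w j(1) unfolding E_def s_def by auto
      qed
      then show ?thesis unfolding B_def by auto
    qed
    then show "w \<in> N" by (auto simp: N_def)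
  qed
  ultimately show ?thesis by (intro AE_I') 
qed

section \<open>Simultaneous sign changes over small cells\<close>

definition sign_changes :: "nat \<Rightarrow> (nat \<Rightarrow> real) \<Rightarrow> real \<Rightarrow> 'w set" where
  "sign_changes k c h = {w \<in> space M. \<forall>i<k. f (c i - h) w * f (c i + h) w < 0}"

lemma sign_changes_sets [measurable]: "sign_changes k c h \<in> sets M"
proof -
  have "{w \<in> space M. f (c i - h) w * f (c i + h) w < 0} \<in> sets M" for i by measurable
  then have "{w \<in> space M. \<forall>i\<in>{..<k}. f (c i - h) w * f (c i + h) w < 0} \<in> sets M"
    by (intro sets.sets_Collect_finite_All) auto
  then show ?thesis unfolding sign_changes_def by (simp only: Ball_def lessThan_iff)
qed

lemma sign_changes_limit:
  assumes A: "frame k A (\<lambda>j. f (x j))"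
    and c: "\<And>j. j < k \<Longrightarrow> (\<lambda>n. c n j) \<longlonglongrightarrow> x j" and h: "\<And>n :: nat. h n > 0" "h \<longlonglongrightarrow> 0"
  shows "(\<lambda>n. emeasure M (sign_changes k (c n) (h n)) / ennreal ((2 * h n) ^ k))
    \<longlonglongrightarrow> ennreal (crossing_const k A (\<lambda>j. f (x j)) (\<lambda>j. f' (x j)))"
proof -
  define S where "S n j w = (1 / 2) * f (c n j + h n) w + (1 / 2) * f (c n j - h n) w" for n j w
  define D where "D n j w = (1 / (2 * h n)) * f (c n j + h n) w + (- 1 / (2 * h n)) * f (c n j - h n) w" for n j w
  have fc: "isCont (\<lambda>s. f s w) t" for w t using deriv by (rule DERIV_isCont)
  have f'c: "isCont (\<lambda>s. f' s w) t" for w t using cont_deriv by (simp add: continuous_on_eq_continuous_at)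
  have "(\<lambda>n. emeasure M {w \<in> space M. \<forall>i<k. \<bar>S n i w\<bar> < h n * \<bar>D n i w\<bar>} / ennreal ((2 * h n) ^ k))
     \<longlonglongrightarrow> ennreal (crossing_const k A (\<lambda>j. f (x j)) (\<lambda>j. f' (x j)))"
  proof (rule crossing_limit[OF A _ _ _ _ f'_mem h])
    show "S n j \<in> H" "D n j \<in> H" for n j
      unfolding S_def[abs_def] D_def[abs_def] by (rule lincomb_mem[OF f_mem f_mem])+
    fix j w assume j: "j < k"
    have "(\<lambda>n. f (c n j + h n) w) \<longlonglongrightarrow> f (x j) w" "(\<lambda>n. f (c n j - h n) w) \<longlonglongrightarrow> f (x j) w"
      using tendsto_add[OF c[OF j] h(2)] tendsto_diff[OF c[OF j] h(2)]
      by (auto intro!: isCont_tendsto_compose[OF fc])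
    then have "(\<lambda>n. S n j w) \<longlonglongrightarrow> (1 / 2) * f (x j) w + (1 / 2) * f (x j) w"
      unfolding S_def by (intro tendsto_intros)
    then show "(\<lambda>n. S n j w) \<longlonglongrightarrow> f (x j) w" by simp
    have "(\<lambda>n. (f (c n j + h n) w - f (c n j - h n) w) / (2 * h n)) \<longlonglongrightarrow> f' (x j) w"
      by (rule symmetric_quotient_tendsto[OF deriv f'c c[OF j] h(2,1)])
    then show "(\<lambda>n. D n j w) \<longlonglongrightarrow> f' (x j) w" by (simp add: D_def diff_divide_distrib)
  qed
  moreover have "{w \<in> space M. \<forall>i<k. \<bar>S n i w\<bar> < h n * \<bar>D n i w\<bar>} = sign_changes k (c n) (h n)" for n
  proof -
    have "\<bar>S n i w\<bar> < h n * \<bar>D n i w\<bar> \<longleftrightarrow> f (c n i - h n) w * f (c n i + h n) w < 0" for i w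
    proof -
      define p where "p = f (c n i + h n) w"
      define q where "q = f (c n i - h n) w"
      have "h n * \<bar>D n i w\<bar> = \<bar>h n * D n i w\<bar>" using h(1)[of n] by (simp add: abs_mult)
      also have "h n * D n i w = (p - q) / 2" using h(1)[of n] by (simp add: D_def p_def q_def field_simps)
      finally have hD: "h n * \<bar>D n i w\<bar> = \<bar>(p - q) / 2\<bar>" .
      have "S n i w = (p + q) / 2" by (simp add: S_def p_def q_def add_divide_distrib)
      then have "\<bar>S n i w\<bar> < h n * \<bar>D n i w\<bar> \<longleftrightarrow> \<bar>(p + q) / 2\<bar> < \<bar>(p - q) / 2\<bar>" by (simp only: hD)
      \<comment> \<open>The difference of the two squares is \<open>p q\<close>.\<close>
      also have "\<dots> \<longleftrightarrow> ((p + q) / 2)\<^sup>2 < ((p - q) / 2)\<^sup>2" by (metis abs_le_square_iff linorder_not_le)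
      also have "\<dots> \<longleftrightarrow> q * p < 0" by (simp add: power2_eq_square field_simps)
      finally show ?thesis by (simp add: p_def q_def)
    qed
    then show ?thesis by (simp add: sign_changes_def)
  qed
  ultimately show ?thesis by simp
qed

text \<open>A sequential limit with moving centres is a uniform statement: violations at every scale
  \<open>1 / (n + 1)\<close> would form sequences that contradict \<open>sign_changes_limit\<close>.
  The uniformity covers all cells of a grid simultaneously.\<close>

lemma sign_changes_uniform_limit:
  assumes A: "frame k A (\<lambda>j. f (x j))" and V: "open V"
    "ennreal (crossing_const k A (\<lambda>j. f (x j)) (\<lambda>j. f' (x j))) \<in> V"
  shows "\<exists>\<delta>>0. \<forall>c h. (\<forall>j<k. \<bar>c j - x j\<bar> \<le> \<delta>) \<longrightarrow> 0 < h \<longrightarrow> h \<le> \<delta> \<longrightarrow>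
    emeasure M (sign_changes k c h) / ennreal ((2 * h) ^ k) \<in> V"
proof (rule ccontr)
  assume neg: "\<not> ?thesis"
  have "\<forall>n. \<exists>c h. (\<forall>j<k. \<bar>c j - x j\<bar> \<le> 1 / real (Suc n)) \<and> 0 < h \<and> h \<le> 1 / real (Suc n) \<and>
     emeasure M (sign_changes k c h) / ennreal ((2 * h) ^ k) \<notin> V"
  proof
    fix n
    have "1 / real (Suc n) > 0" by simp
    with neg show "\<exists>c h. (\<forall>j<k. \<bar>c j - x j\<bar> \<le> 1 / real (Suc n)) \<and> 0 < h \<and> h \<le> 1 / real (Suc n) \<and>
     emeasure M (sign_changes k c h) / ennreal ((2 * h) ^ k) \<notin> V" by metis
  qed
  then obtain c h where ch: "\<And>n j. j < k \<Longrightarrow> \<bar>c n j - x j\<bar> \<le> 1 / real (Suc n)" "\<And>n. 0 < h n"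
    "\<And>n. h n \<le> 1 / real (Suc n)" "\<And>n. emeasure M (sign_changes k (c n) (h n)) / ennreal ((2 * h n) ^ k) \<notin> V"
    by metis
  have z: "(\<lambda>n. 1 / real (Suc n)) \<longlonglongrightarrow> 0"
    using LIMSEQ_inverse_real_of_nat by (simp add: inverse_eq_divide)
  have h0: "h \<longlonglongrightarrow> 0"
  proof (rule tendsto_sandwich[OF _ _ tendsto_const z])
    show "eventually (\<lambda>n. 0 \<le> h n) sequentially" using ch(2) by (simp add: less_imp_le)
    show "eventually (\<lambda>n. h n \<le> 1 / real (Suc n)) sequentially" using ch(3) by simp
  qed
  have "(\<lambda>n. c n j) \<longlonglongrightarrow> x j" if "j < k" for j
  proof -
    have "eventually (\<lambda>n. norm (c n j - x j) \<le> 1 / real (Suc n)) sequentially"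
      using ch(1)[OF that] by simp
    then have "(\<lambda>n. c n j - x j) \<longlonglongrightarrow> 0" by (rule Lim_null_comparison[OF _ z])
    then show ?thesis by (simp add: LIM_zero_iff)
  qed
  from sign_changes_limit[OF A this ch(2) h0] have
    "eventually (\<lambda>n. emeasure M (sign_changes k (c n) (h n)) / ennreal ((2 * h n) ^ k) \<in> V) sequentially"
    using V by (rule topological_tendstoD) 
  then show False using ch(4) by (auto simp: eventually_sequentially)
qed

lemma zero_count_ge_1:
  assumes "f a w * f b w < 0" "a < b"
  shows "1 \<le> zero_count f {a..b} w"
proof -
  have c: "isCont (\<lambda>s. f s w) t" for t using deriv by (rule DERIV_isCont)
  have "\<exists>t. a \<le> t \<and> t \<le> b \<and> f t w = 0"
  proof (cases "f a w < 0")
    case True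
    then show ?thesis using assms IVT[of "\<lambda>s. f s w" a 0 b] c by (auto simp: mult_less_0_iff)
  next
    case False
    then show ?thesis using assms IVT2[of "\<lambda>s. f s w" b 0 a] c by (auto simp: mult_less_0_iff)
  qed
  then obtain t where "t \<in> {t. f t w = 0} \<inter> {a..b}" by auto
  then have "emeasure (count_space UNIV) {t} \<le> zero_count f {a..b} w"
    unfolding zero_count_def by (intro emeasure_mono) auto
  then show ?thesis by simp
qed

text \<open>On fine grids the product of the counts is at most the number of choices of one
  sign-changing cell in each interval. There are \<open>(m + 1) ^ k\<close> choices of cells, each
  changing sign with probability at most \<open>(2 h) ^ k\<close> times \<open>b\<close>, where
  \<open>h = \<epsilon> / (m + 1)\<close>; the grid size cancels, and Fatou's lemma passes to the
  limit.\<close>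

lemma zero_count_product_upper:
  assumes \<epsilon>: "\<epsilon> > 0"
    and b: "\<And>c h. (\<forall>j<k. \<bar>c j - x j\<bar> \<le> \<epsilon>) \<Longrightarrow> 0 < h \<Longrightarrow> h \<le> \<epsilon> \<Longrightarrow>
      emeasure M (sign_changes k c h) \<le> ennreal ((2 * h) ^ k) * b"
  shows "(\<integral>\<^sup>+w. (\<Prod>i<k. zero_count f {x i - \<epsilon>..x i + \<epsilon>} w) \<partial>M) \<le> ennreal ((2 * \<epsilon>) ^ k) * b"
proof -
  define g where "g i m j = grid (x i - \<epsilon>) (x i + \<epsilon>) (Suc m) j" for i m j
  define s where "s i m j w = (if f (g i m j) w * f (g i m (Suc j)) w < 0 then 1 else 0 :: ennreal)" for i m j w
  define U where "U m w = (\<Prod>i<k. \<Sum>j<Suc m. s i m j w)" for m w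
  have s_meas [measurable]: "s i m j \<in> borel_measurable M" for i m j unfolding s_def by measurable
  have U_meas: "U m \<in> borel_measurable M" for m unfolding U_def
    by (intro borel_measurable_prod_ennreal borel_measurable_sum s_meas)
  have "AE w in M. \<forall>i\<in>{..<k}. \<forall>t. x i - \<epsilon> \<le> t \<and> t \<le> x i + \<epsilon> \<and> f t w = 0 \<longrightarrow> f' t w \<noteq> 0"
    by (intro AE_finite_allI no_double_zero) (use \<epsilon> in auto)
  \<comment> \<open>Only countably many grid points are involved, each with a nondegenerate normal
    value, so almost surely none of them is a zero.\<close>
  moreover have "AE w in M. \<forall>i m j. f (g i m j) w \<noteq> 0"
    unfolding AE_all_countable by (intro allI unit_gaussian_AE_nonzero gauss f_mem unit_variance)
  ultimately have "AE w in M. (\<Prod>i<k. zero_count f {x i - \<epsilon>..x i + \<epsilon>} w) \<le> liminf (\<lambda>m. U m w)"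
  proof eventually_elim
    fix w assume nd: "\<forall>i\<in>{..<k}. \<forall>t. x i - \<epsilon> \<le> t \<and> t \<le> x i + \<epsilon> \<and> f t w = 0 \<longrightarrow> f' t w \<noteq> 0"
      and gn: "\<forall>i m j. f (g i m j) w \<noteq> 0"
    have ev: "eventually (\<lambda>m. \<forall>i\<in>{..<k}. zero_count f {x i - \<epsilon>..x i + \<epsilon>} w \<le> (\<Sum>j<Suc m. s i m j w)) sequentially"
    proof (rule eventually_ball_finite, simp, rule ballI)
      fix i assume i: "i \<in> {..<k}"
      have nd': "\<And>t. x i - \<epsilon> \<le> t \<Longrightarrow> t \<le> x i + \<epsilon> \<Longrightarrow> f t w = 0 \<Longrightarrow> f' t w \<noteq> 0" using nd i by auto
      have gn': "\<And>m j. f (grid (x i - \<epsilon>) (x i + \<epsilon>) (Suc m) j) w \<noteq> 0" using gn by (simp add: g_def)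
      have lt: "x i - \<epsilon> < x i + \<epsilon>" using \<epsilon> by simp
      have fin: "finite ({t. f t w = 0} \<inter> {x i - \<epsilon>..x i + \<epsilon>})" by (rule finite_simple_zeros[OF deriv nd'])
      have "eventually (\<lambda>m. card ({t. f t w = 0} \<inter> {x i - \<epsilon>..x i + \<epsilon>}) \<le> card {j. j < Suc m \<and>
          f (grid (x i - \<epsilon>) (x i + \<epsilon>) (Suc m) j) w * f (grid (x i - \<epsilon>) (x i + \<epsilon>) (Suc m) (Suc j)) w < 0}) sequentially"
        by (rule zeros_le_sign_changes[OF lt deriv _ gn']) (rule nd')
      then show "eventually (\<lambda>m. zero_count f {x i - \<epsilon>..x i + \<epsilon>} w \<le> (\<Sum>j<Suc m. s i m j w)) sequentially"
      proof eventually_elim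
        fix m
        assume le: "card ({t. f t w = 0} \<inter> {x i - \<epsilon>..x i + \<epsilon>}) \<le> card {j. j < Suc m \<and>
          f (grid (x i - \<epsilon>) (x i + \<epsilon>) (Suc m) j) w * f (grid (x i - \<epsilon>) (x i + \<epsilon>) (Suc m) (Suc j)) w < 0}"
        have "zero_count f {x i - \<epsilon>..x i + \<epsilon>} w = of_nat (card ({t. f t w = 0} \<inter> {x i - \<epsilon>..x i + \<epsilon>}))"
          unfolding zero_count_def using fin by (simp add: emeasure_count_space_finite)
        also have "\<dots> \<le> of_nat (card {j. j < Suc m \<and> f (g i m j) w * f (g i m (Suc j)) w < 0})"
          using le by (simp add: g_def)
        also have "\<dots> = (\<Sum>j\<in>{j. j < Suc m \<and> f (g i m j) w * f (g i m (Suc j)) w < 0}. 1)" by simp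
        also have "\<dots> = (\<Sum>j<Suc m. s i m j w)"
          unfolding s_def by (intro sum.mono_neutral_cong_left) auto
        finally show "zero_count f {x i - \<epsilon>..x i + \<epsilon>} w \<le> (\<Sum>j<Suc m. s i m j w)" .
      qed
    qed
    show "(\<Prod>i<k. zero_count f {x i - \<epsilon>..x i + \<epsilon>} w) \<le> liminf (\<lambda>m. U m w)"
    proof (rule Liminf_bounded)
      show "eventually (\<lambda>m. (\<Prod>i<k. zero_count f {x i - \<epsilon>..x i + \<epsilon>} w) \<le> U m w) sequentially"
        using ev unfolding U_def by eventually_elim (rule prod_mono_ennreal, simp)
    qed
  qed
  then have "(\<integral>\<^sup>+w. (\<Prod>i<k. zero_count f {x i - \<epsilon>..x i + \<epsilon>} w) \<partial>M) \<le> (\<integral>\<^sup>+w. liminf (\<lambda>m. U m w) \<partial>M)"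
    by (rule nn_integral_mono_AE)
  also have "\<dots> \<le> liminf (\<lambda>m. \<integral>\<^sup>+w. U m w \<partial>M)" by (rule nn_integral_liminf) (rule U_meas)
  also have "\<dots> \<le> ennreal ((2 * \<epsilon>) ^ k) * b"
  proof -
    have "(\<integral>\<^sup>+w. U m w \<partial>M) \<le> ennreal ((2 * \<epsilon>) ^ k) * b" for m
    proof -
      define h where "h = \<epsilon> / real (Suc m)"
      define P where "P = Pi\<^sub>E {..<k} (\<lambda>_. {..<Suc m})"
      have finP: "finite P" unfolding P_def by (rule finite_PiE) auto
      have h: "0 < h" "h \<le> \<epsilon>" using \<epsilon> by (auto simp: h_def divide_le_eq mult_le_cancel_left1)
      have Uw: "U m w = (\<Sum>J\<in>P. \<Prod>i<k. s i m (J i) w)" for w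
        unfolding U_def P_def by (rule prod_sum_PiE) auto
      have "(\<integral>\<^sup>+w. U m w \<partial>M) = (\<Sum>J\<in>P. \<integral>\<^sup>+w. (\<Prod>i<k. s i m (J i) w) \<partial>M)"
        unfolding Uw by (rule nn_integral_sum) (intro borel_measurable_prod_ennreal s_meas)
      also have "\<dots> \<le> (\<Sum>J\<in>P. ennreal ((2 * h) ^ k) * b)"
      proof (rule sum_mono)
        fix J assume J: "J \<in> P"
        define c where "c i = g i m (J i) + h" for i
        have gc: "g i m (J i) = c i - h" "g i m (Suc (J i)) = c i + h" for i
          by (auto simp: c_def g_def grid_Suc h_def)
        \<comment> \<open>Each cell lies inside its interval, so its centre is admissible in the
          hypothesis of the lemma.\<close>
        have cx: "\<bar>c i - x i\<bar> \<le> \<epsilon>" if i: "i < k" for i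
        proof -
          have "J i < Suc m" using J i by (auto simp: P_def PiE_iff)
          then have "real (J i) + 1 \<le> real (Suc m)" by linarith
          then have "2 * \<epsilon> * (real (J i) + 1) / real (Suc m) \<le> 2 * \<epsilon>" using \<epsilon> by (simp add: divide_le_eq)
          moreover have "g i m (Suc (J i)) = x i - \<epsilon> + 2 * \<epsilon> * (real (J i) + 1) / real (Suc m)"
            by (simp add: g_def grid_def algebra_simps)
          moreover have "g i m (J i) \<ge> x i - \<epsilon>" using \<epsilon> by (simp add: g_def grid_def)
          ultimately show ?thesis using gc[of i] h by (auto simp: abs_le_iff)
        qed
        have "(\<integral>\<^sup>+w. (\<Prod>i<k. s i m (J i) w) \<partial>M) = (\<integral>\<^sup>+w. indicator (sign_changes k c h) w \<partial>M)"
        proof (rule nn_integral_cong)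
          fix w assume w: "w \<in> space M"
          show "(\<Prod>i<k. s i m (J i) w) = indicator (sign_changes k c h) w"
          proof (cases "\<forall>i<k. f (c i - h) w * f (c i + h) w < 0")
            case True
            then have "(\<Prod>i<k. s i m (J i) w) = (\<Prod>i<k. 1)" by (intro prod.cong) (auto simp: s_def gc)
            then show ?thesis using True w by (simp add: sign_changes_def)
          next
            case False
            then obtain i where i: "i \<in> {..<k}" "\<not> f (c i - h) w * f (c i + h) w < 0" by auto
            then have "(\<Prod>i<k. s i m (J i) w) = 0" by (intro prod_zero bexI[of _ i]) (auto simp: s_def gc)
            then show ?thesis using i by (auto simp: sign_changes_def indicator_def)
          qed
        qed
        also have "\<dots> = emeasure M (sign_changes k c h)" by (rule nn_integral_indicator) (rule sign_changes_sets)
        also have "\<dots> \<le> ennreal ((2 * h) ^ k) * b" by (rule b) (use cx h in auto)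
        finally show "(\<integral>\<^sup>+w. (\<Prod>i<k. s i m (J i) w) \<partial>M) \<le> ennreal ((2 * h) ^ k) * b" .
      qed
      also have "\<dots> = ennreal (real (Suc m) ^ k * (2 * h) ^ k) * b"
      proof -
        have "card P = Suc m ^ k" by (simp add: P_def card_PiE)
        then have "(\<Sum>J\<in>P. ennreal ((2 * h) ^ k) * b) = ennreal (real (Suc m ^ k)) * (ennreal ((2 * h) ^ k) * b)"
          by (simp only: sum_constant ennreal_of_nat_eq_real_of_nat)
        also have "\<dots> = ennreal (real (Suc m ^ k) * (2 * h) ^ k) * b"
          using h by (subst ennreal_mult) (auto simp: mult.assoc)
        finally show ?thesis by simp
      qed
      also have "real (Suc m) ^ k * (2 * h) ^ k = (2 * \<epsilon>) ^ k"
      proof -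
        have "real (Suc m) * (2 * h) = 2 * \<epsilon>" by (simp add: h_def)
        then show ?thesis by (simp only: power_mult_distrib[symmetric])
      qed
      finally show ?thesis .
    qed
    then show ?thesis
      unfolding liminf_SUP_INF by (intro SUP_least) (rule INF_lower2[OF atLeast_iff[THEN iffD2, OF order_refl]])
  qed
  finally show ?thesis .
qed

text \<open>From below, a sign change over the whole interval already forces a zero; this uses the
  centres \<open>x\<close> and \<open>h = \<epsilon>\<close>. From above, the uniform bound on small
  cells is summed over grids.\<close>

theorem kac_rice:
  assumes A: "frame k A (\<lambda>j. f (x j))"
  shows "((\<lambda>\<epsilon>. (\<integral>\<^sup>+w. (\<Prod>i<k. zero_count f {x i - \<epsilon>..x i + \<epsilon>} w) \<partial>M) / ennreal ((2 * \<epsilon>) ^ k)) \<longlongrightarrow>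
    ennreal (crossing_const k A (\<lambda>j. f (x j)) (\<lambda>j. f' (x j)))) (at_right 0)"
proof (rule order_tendstoI)
  {
    fix a assume "a < ennreal (crossing_const k A (\<lambda>j. f (x j)) (\<lambda>j. f' (x j)))"
    then have "\<exists>\<delta>>0. \<forall>c h. (\<forall>j<k. \<bar>c j - x j\<bar> \<le> \<delta>) \<longrightarrow> 0 < h \<longrightarrow> h \<le> \<delta> \<longrightarrow>
      emeasure M (sign_changes k c h) / ennreal ((2 * h) ^ k) \<in> {a<..}"
      by (intro sign_changes_uniform_limit[OF A]) auto
    then obtain \<delta> where \<delta>: "\<delta> > 0" "\<And>c h. (\<forall>j<k. \<bar>c j - x j\<bar> \<le> \<delta>) \<Longrightarrow> 0 < h \<Longrightarrow> h \<le> \<delta> \<Longrightarrow>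
      a < emeasure M (sign_changes k c h) / ennreal ((2 * h) ^ k)" by auto
    show "eventually (\<lambda>\<epsilon>. a < (\<integral>\<^sup>+w. (\<Prod>i<k. zero_count f {x i - \<epsilon>..x i + \<epsilon>} w) \<partial>M) / ennreal ((2 * \<epsilon>) ^ k)) (at_right 0)"
      unfolding eventually_at_right_field
    proof (intro exI[of _ \<delta>] conjI allI impI)
      fix \<epsilon> assume \<epsilon>: "0 < \<epsilon>" "\<epsilon> < \<delta>"
      have "a < emeasure M (sign_changes k x \<epsilon>) / ennreal ((2 * \<epsilon>) ^ k)" by (rule \<delta>(2)) (use \<epsilon> in auto)
      also have "\<dots> \<le> (\<integral>\<^sup>+w. (\<Prod>i<k. zero_count f {x i - \<epsilon>..x i + \<epsilon>} w) \<partial>M) / ennreal ((2 * \<epsilon>) ^ k)"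
      proof (rule divide_right_mono_ennreal)
        have "emeasure M (sign_changes k x \<epsilon>) = (\<integral>\<^sup>+w. indicator (sign_changes k x \<epsilon>) w \<partial>M)"
          by (rule nn_integral_indicator[symmetric]) (rule sign_changes_sets)
        also have "\<dots> \<le> (\<integral>\<^sup>+w. (\<Prod>i<k. zero_count f {x i - \<epsilon>..x i + \<epsilon>} w) \<partial>M)"
        proof (rule nn_integral_mono)
          fix w
          show "indicator (sign_changes k x \<epsilon>) w \<le> (\<Prod>i<k. zero_count f {x i - \<epsilon>..x i + \<epsilon>} w)"
          proof (cases "w \<in> sign_changes k x \<epsilon>")
            case True
            have "(\<Prod>i<k. 1) \<le> (\<Prod>i<k. zero_count f {x i - \<epsilon>..x i + \<epsilon>} w)"
              by (intro prod_mono_ennreal zero_count_ge_1) (use True \<epsilon> in \<open>auto simp: sign_changes_def\<close>)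
            then show ?thesis using True by simp
          qed simp
        qed
        finally show "emeasure M (sign_changes k x \<epsilon>) \<le> (\<integral>\<^sup>+w. (\<Prod>i<k. zero_count f {x i - \<epsilon>..x i + \<epsilon>} w) \<partial>M)" .
      qed
      finally show "a < (\<integral>\<^sup>+w. (\<Prod>i<k. zero_count f {x i - \<epsilon>..x i + \<epsilon>} w) \<partial>M) / ennreal ((2 * \<epsilon>) ^ k)" .
    qed (rule \<delta>(1))
  next
    fix b assume "ennreal (crossing_const k A (\<lambda>j. f (x j)) (\<lambda>j. f' (x j))) < b"
    \<comment> \<open>The summation over cells yields only a weak inequality; \<open>b'\<close>
      leaves room for the strict one.\<close>
    then obtain b' where b': "ennreal (crossing_const k A (\<lambda>j. f (x j)) (\<lambda>j. f' (x j))) < b'" "b' < b"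
      using dense by blast
    then have "\<exists>\<delta>>0. \<forall>c h. (\<forall>j<k. \<bar>c j - x j\<bar> \<le> \<delta>) \<longrightarrow> 0 < h \<longrightarrow> h \<le> \<delta> \<longrightarrow>
      emeasure M (sign_changes k c h) / ennreal ((2 * h) ^ k) \<in> {..<b'}"
      by (intro sign_changes_uniform_limit[OF A]) auto
    then obtain \<delta> where \<delta>: "\<delta> > 0" "\<And>c h. (\<forall>j<k. \<bar>c j - x j\<bar> \<le> \<delta>) \<Longrightarrow> 0 < h \<Longrightarrow> h \<le> \<delta> \<Longrightarrow>
      emeasure M (sign_changes k c h) / ennreal ((2 * h) ^ k) < b'" by auto
    have div_le: "X \<le> ennreal ((2 * h) ^ k) * b'" if "X / ennreal ((2 * h) ^ k) \<le> b'" "h > 0" for X h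
    proof -
      have "X = X / ennreal ((2 * h) ^ k) * ennreal ((2 * h) ^ k)"
        using that(2) by (subst ennreal_divide_times) (simp add: ennreal_divide_self)
      also have "\<dots> \<le> b' * ennreal ((2 * h) ^ k)" by (rule mult_right_mono[OF that(1)]) simp
      finally show ?thesis by (simp add: mult.commute)
    qed
    show "eventually (\<lambda>\<epsilon>. (\<integral>\<^sup>+w. (\<Prod>i<k. zero_count f {x i - \<epsilon>..x i + \<epsilon>} w) \<partial>M) / ennreal ((2 * \<epsilon>) ^ k) < b) (at_right 0)"
      unfolding eventually_at_right_field
    proof (intro exI[of _ \<delta>] conjI allI impI)
      fix \<epsilon> assume \<epsilon>: "0 < \<epsilon>" "\<epsilon> < \<delta>"
      have "(\<integral>\<^sup>+w. (\<Prod>i<k. zero_count f {x i - \<epsilon>..x i + \<epsilon>} w) \<partial>M) \<le> ennreal ((2 * \<epsilon>) ^ k) * b'"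
      proof (rule zero_count_product_upper[OF \<epsilon>(1)])
        fix c h assume c: "\<forall>j<k. \<bar>c j - x j\<bar> \<le> \<epsilon>" and h: "0 < h" "h \<le> \<epsilon>"
        have "emeasure M (sign_changes k c h) / ennreal ((2 * h) ^ k) < b'"
          by (rule \<delta>(2)) (use c h \<epsilon> in force)+
        then show "emeasure M (sign_changes k c h) \<le> ennreal ((2 * h) ^ k) * b'"
          by (intro div_le h less_imp_le)
      qed
      then have "(\<integral>\<^sup>+w. (\<Prod>i<k. zero_count f {x i - \<epsilon>..x i + \<epsilon>} w) \<partial>M) / ennreal ((2 * \<epsilon>) ^ k) \<le>
         ennreal ((2 * \<epsilon>) ^ k) * b' / ennreal ((2 * \<epsilon>) ^ k)"
        by (rule divide_right_mono_ennreal)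
      also have "\<dots> = b'"
        using \<epsilon> by (simp add: ennreal_mult_divide_eq mult.commute)
      finally show "(\<integral>\<^sup>+w. (\<Prod>i<k. zero_count f {x i - \<epsilon>..x i + \<epsilon>} w) \<partial>M) / ennreal ((2 * \<epsilon>) ^ k) < b"
        using b'(2) by simp
    qed (rule \<delta>(1))
  }
qed

end

section \<open>Divided differences\<close>

text \<open>Induction on the largest element: Rolle's theorem adds one zero of \<open>g'\<close>
  between the last two elements of \<open>Z\<close>. The new zeros avoid \<open>Z\<close>, which
  matters when a zero of \<open>g\<close> is also a zero of \<open>g'\<close>.\<close>

lemma Rolle_zeros:
  fixes g g' :: "real \<Rightarrow> real"
  assumes d: "\<And>t. (g has_real_derivative g' t) (at t)"
    and "finite Z" "Z \<noteq> {}" "\<And>z. z \<in> Z \<Longrightarrow> g z = 0"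
  shows "\<exists>Z'. finite Z' \<and> Suc (card Z') = card Z \<and> Z' \<inter> Z = {} \<and> Z' \<subseteq> {Min Z..Max Z} \<and> (\<forall>z\<in>Z'. g' z = 0)"
  using assms(2-)
proof (induction Z rule: finite_linorder_max_induct)
  case (insert b A)
  show ?case
  proof (cases "A = {}")
    case True
    then show ?thesis by (intro exI[of _ "{}"]) auto
  next
    case False
    obtain Z' where Z': "finite Z'" "Suc (card Z') = card A" "Z' \<inter> A = {}" "Z' \<subseteq> {Min A..Max A}" "\<forall>z\<in>Z'. g' z = 0"
      using insert.IH[OF False] insert.prems by auto
    have mA: "Max A \<in> A" using False insert.hyps by (intro Max_in)
    then have lt: "Max A < b" using insert.hyps by auto
    have "g (Max A) = g b" using insert.prems mA by simp
    then obtain z where z: "Max A < z" "z < b" "g' z = 0"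
      using Rolle[OF lt, of g] d DERIV_unique by (metis DERIV_isCont continuous_at_imp_continuous_on real_differentiable_def)
    have mx: "Max (insert b A) = b" using insert.hyps by (intro Max_eqI) (auto simp: less_imp_le)
    have "Min A \<le> b" using Min_le[OF insert.hyps(1) mA] lt by linarith
    then have mn: "Min (insert b A) = Min A" using insert.hyps False by (intro Min_eqI) auto
    have zA: "z \<notin> A" "z \<notin> Z'" "b \<notin> Z'" using z Z'(4) Max_ge[OF insert.hyps(1)] lt by force+
    have bA: "b \<notin> A" using insert.hyps by auto
    show ?thesis
    proof (intro exI[of _ "insert z Z'"] conjI)
      show "Suc (card (insert z Z')) = card (insert b A)" using Z' zA bA insert.hyps by simp
      show "insert z Z' \<subseteq> {Min (insert b A)..Max (insert b A)}"
        unfolding mx mn using Z'(4) z lt Min_le[OF insert.hyps(1) mA] by force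
      show "insert z Z' \<inter> insert b A = {}" using Z' zA z by auto
    qed (use Z' z in auto)
  qed
qed simp

lemma Rolle_iterated:
  fixes G :: "nat \<Rightarrow> real \<Rightarrow> real"
  assumes "\<And>i t. i < m \<Longrightarrow> (G i has_real_derivative G (Suc i) t) (at t)"
    and "finite Z" "card Z = Suc m" "\<And>z. z \<in> Z \<Longrightarrow> G 0 z = 0" "Z \<subseteq> {a..b}"
  shows "\<exists>\<xi>\<in>{a..b}. G m \<xi> = 0"
  using assms
proof (induction m arbitrary: G Z)
  case 0
  then obtain z where "Z = {z}" by (auto simp: card_Suc_eq)
  then show ?case using 0 by auto
next
  case (Suc m)
  have ne: "Z \<noteq> {}" using Suc.prems by auto
  obtain Z' where Z': "finite Z'" "Suc (card Z') = card Z" "Z' \<subseteq> {Min Z..Max Z}" "\<forall>z\<in>Z'. G (Suc 0) z = 0"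
    using Rolle_zeros[of "G 0" "G (Suc 0)" Z] Suc.prems ne by auto
  have "Z' \<subseteq> {a..b}" using Z'(3) Min_in[OF Suc.prems(2) ne] Max_in[OF Suc.prems(2) ne] Suc.prems(5) by force
  then show ?case using Suc.IH[of "\<lambda>i. G (Suc i)" Z'] Suc.prems Z' by auto
qed

text \<open>The double node \<open>x\<close> is a zero of the derivative in addition to those from
  Rolle's theorem, since the latter avoid \<open>Z\<close>. The first differentiation therefore
  loses no zero.\<close>

lemma Rolle_iterated_double:
  fixes G :: "nat \<Rightarrow> real \<Rightarrow> real"
  assumes d: "\<And>i t. i < m \<Longrightarrow> (G i has_real_derivative G (Suc i) t) (at t)"
    and Z: "finite Z" "card Z = m" "\<And>z. z \<in> Z \<Longrightarrow> G 0 z = 0" "Z \<subseteq> {a..b}"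
    and x: "x \<in> Z" "G (Suc 0) x = 0"
  shows "\<exists>\<xi>\<in>{a..b}. G m \<xi> = 0"
proof -
  have ne: "Z \<noteq> {}" using x by auto
  have m: "m > 0" using Z x by (auto simp: card_gt_0_iff)
  obtain Z' where Z': "finite Z'" "Suc (card Z') = card Z" "Z' \<inter> Z = {}" "Z' \<subseteq> {Min Z..Max Z}" "\<forall>z\<in>Z'. G (Suc 0) z = 0"
    using Rolle_zeros[of "G 0" "G (Suc 0)" Z] Z d m ne by auto
  have "Z' \<subseteq> {a..b}" using Z'(4) Min_in[OF Z(1) ne] Max_in[OF Z(1) ne] Z(4) by force
  then have sub: "insert x Z' \<subseteq> {a..b}" using x Z by auto
  have "x \<notin> Z'" using Z' x by auto
  then have card: "card (insert x Z') = Suc (m - 1)" using Z' Z by simp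
  have "\<exists>\<xi>\<in>{a..b}. G (Suc (m - 1)) \<xi> = 0"
    by (rule Rolle_iterated[of "m - 1" "\<lambda>i. G (Suc i)" "insert x Z'"]) (use d card sub Z' x in auto)
  then show ?thesis using m by simp
qed

lemma higher_pderiv_degree_le:
  fixes P :: "real poly"
  assumes "degree P \<le> m"
  shows "(pderiv ^^ m) P = [:fact m * coeff P m:]"
proof (rule poly_eqI)
  fix n
  show "coeff ((pderiv ^^ m) P) n = coeff [:fact m * coeff P m:] n"
  proof (cases n)
    case 0
    then show ?thesis by (simp add: coeff_higher_pderiv pochhammer_fact)
  next
    case (Suc n')
    then have "coeff P (n + m) = 0" using assms by (intro coeff_eq_0) simp
    then show ?thesis using Suc by (simp add: coeff_higher_pderiv)
  qed
qed

text \<open>\<open>F 0 - P\<close> vanishes at the nodes, so the iterated Rolle argument gives a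
  zero of its derivative of order \<open>m\<close>, and that derivative of \<open>P\<close> is
  constant. Simple nodes and one double node are treated together.\<close>

lemma interpolation_mean_value:
  fixes P :: "real poly" and F :: "nat \<Rightarrow> real \<Rightarrow> real"
  assumes d: "\<And>i t. i < m \<Longrightarrow> (F i has_real_derivative F (Suc i) t) (at t)"
    and P: "degree P \<le> m"
    and Z: "finite Z" "\<And>z. z \<in> Z \<Longrightarrow> F 0 z = poly P z" "Z \<subseteq> {a..b}"
    and c: "card Z = Suc m \<or> (card Z = m \<and> (\<exists>x\<in>Z. F (Suc 0) x = poly (pderiv P) x))"
  shows "\<exists>\<xi>\<in>{a..b}. F m \<xi> = fact m * coeff P m"
proof -
  define G where "G i t = F i t - poly ((pderiv ^^ i) P) t" for i t
  have dG: "(G i has_real_derivative G (Suc i) t) (at t)" if "i < m" for i t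
    unfolding G_def[abs_def] by (auto intro!: derivative_eq_intros d[OF that] poly_DERIV)
  have Z0: "G 0 z = 0" if "z \<in> Z" for z using Z(2)[OF that] by (simp add: G_def)
  have "\<exists>\<xi>\<in>{a..b}. G m \<xi> = 0"
    using c
  proof
    assume "card Z = Suc m"
    then show ?thesis by (intro Rolle_iterated[OF dG Z(1) _ Z0 Z(3)])
  next
    assume "card Z = m \<and> (\<exists>x\<in>Z. F (Suc 0) x = poly (pderiv P) x)"
    then obtain x where "card Z = m" "x \<in> Z" "G (Suc 0) x = 0" by (auto simp: G_def)
    then show ?thesis by (intro Rolle_iterated_double[OF dG Z(1) _ Z0 Z(3)])
  qed
  then show ?thesis by (auto simp: G_def higher_pderiv_degree_le[OF P])
qed

section \<open>Lagrange interpolation and divided differences\<close>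

definition node_prod :: "(nat \<Rightarrow> real) \<Rightarrow> nat set \<Rightarrow> nat \<Rightarrow> real" where
  "node_prod x A l = (\<Prod>j\<in>A - {l}. x l - x j)"

text \<open>The classical divided difference in its symmetric form. Written this way it is visibly
  linear in the values of \<open>g\<close>, hence a row of a matrix; it is also the top coefficient
  of the interpolation polynomial.\<close>

definition divided_difference :: "(nat \<Rightarrow> real) \<Rightarrow> nat set \<Rightarrow> (real \<Rightarrow> real) \<Rightarrow> real" where
  "divided_difference x A g = (\<Sum>l\<in>A. g (x l) / node_prod x A l)"

definition nodal_poly :: "(nat \<Rightarrow> real) \<Rightarrow> nat set \<Rightarrow> real poly" where
  "nodal_poly x A = (\<Prod>j\<in>A. [:- x j, 1:])"

definition lagrange_poly :: "(nat \<Rightarrow> real) \<Rightarrow> nat set \<Rightarrow> (real \<Rightarrow> real) \<Rightarrow> real poly" where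
  "lagrange_poly x A g = (\<Sum>l\<in>A. Polynomial.smult (g (x l) / node_prod x A l) (nodal_poly x (A - {l})))"

lemma node_prod_nonzero:
  "inj_on x A \<Longrightarrow> finite A \<Longrightarrow> l \<in> A \<Longrightarrow> node_prod x A l \<noteq> 0"
  by (auto simp: node_prod_def prod_zero_iff inj_on_def)

lemma poly_nodal_poly: "poly (nodal_poly x A) t = (\<Prod>j\<in>A. t - x j)"
  by (simp add: nodal_poly_def poly_prod)

lemma degree_nodal_poly: "finite A \<Longrightarrow> degree (nodal_poly x A) = card A"
  by (simp add: nodal_poly_def degree_prod_eq_sum_degree)

lemma coeff_nodal_poly: "finite A \<Longrightarrow> coeff (nodal_poly x A) (card A) = 1"
proof -
  assume A: "finite A"
  have "lead_coeff (nodal_poly x A) = 1" by (simp add: nodal_poly_def lead_coeff_prod)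
  then show ?thesis by (simp add: degree_nodal_poly[OF A])
qed

lemma poly_lagrange_poly:
  assumes A: "finite A" "inj_on x A" "i \<in> A"
  shows "poly (lagrange_poly x A g) (x i) = g (x i)"
proof -
  have "poly (lagrange_poly x A g) (x i) =
      (\<Sum>l\<in>A. g (x l) / node_prod x A l * (\<Prod>j\<in>A - {l}. x i - x j))"
    by (simp add: lagrange_poly_def poly_sum poly_nodal_poly)
  also have "\<dots> = (\<Sum>l\<in>A. if l = i then g (x i) else 0)"
  proof (rule sum.cong)
    fix l assume l: "l \<in> A"
    show "g (x l) / node_prod x A l * (\<Prod>j\<in>A - {l}. x i - x j) = (if l = i then g (x i) else 0)"
    proof (cases "l = i")
      case True
      then show ?thesis using node_prod_nonzero[OF A(2,1,3)] by (simp add: node_prod_def)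
    next
      case False
      then have "(\<Prod>j\<in>A - {l}. x i - x j) = 0" using A by (intro prod_zero bexI[of _ i]) auto
      then show ?thesis using False by simp
    qed
  qed simp
  also have "\<dots> = g (x i)" using A by simp
  finally show ?thesis .
qed

lemma degree_lagrange_poly:
  assumes A: "finite A" "A \<noteq> {}"
  shows "degree (lagrange_poly x A g) \<le> card A - 1"
  unfolding lagrange_poly_def
proof (rule degree_sum_le[OF A(1)])
  fix l assume "l \<in> A"
  have "degree (Polynomial.smult (g (x l) / node_prod x A l) (nodal_poly x (A - {l}))) \<le> degree (nodal_poly x (A - {l}))"
    by (rule degree_smult_le)
  also have "\<dots> = card A - 1" using A \<open>l \<in> A\<close> by (simp add: degree_nodal_poly)
  finally show "degree (Polynomial.smult (g (x l) / node_prod x A l) (nodal_poly x (A - {l}))) \<le> card A - 1" .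
qed

lemma coeff_lagrange_poly:
  assumes A: "finite A"
  shows "coeff (lagrange_poly x A g) (card A - 1) = divided_difference x A g"
proof -
  have "coeff (nodal_poly x (A - {l})) (card A - 1) = 1" if "l \<in> A" for l
    using coeff_nodal_poly[of "A - {l}" x] A that by simp
  then show ?thesis by (simp add: lagrange_poly_def coeff_sum divided_difference_def)
qed

lemma divided_difference_mean_value:
  fixes F :: "nat \<Rightarrow> real \<Rightarrow> real"
  assumes A: "finite A" "inj_on x A" "card A = Suc m" "x ` A \<subseteq> {a..b}"
    and d: "\<And>i t. i < m \<Longrightarrow> (F i has_real_derivative F (Suc i) t) (at t)"
  shows "\<exists>\<xi>\<in>{a..b}. fact m * divided_difference x A (F 0) = F m \<xi>"
proof -
  have ne: "A \<noteq> {}" using A by auto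
  have "\<exists>\<xi>\<in>{a..b}. F m \<xi> = fact m * coeff (lagrange_poly x A (F 0)) m"
  proof (rule interpolation_mean_value[of m F _ "x ` A"])
    show "degree (lagrange_poly x A (F 0)) \<le> m" using degree_lagrange_poly[OF A(1) ne, of x "F 0"] A by simp
    show "card (x ` A) = Suc m \<or> (card (x ` A) = m \<and> (\<exists>z\<in>x ` A. F (Suc 0) z = poly (pderiv (lagrange_poly x A (F 0))) z))"
      using A by (simp add: card_image)
    show "F 0 z = poly (lagrange_poly x A (F 0)) z" if "z \<in> x ` A" for z
      using that by (auto simp: poly_lagrange_poly[OF A(1,2)])
  qed (use A d in auto)
  moreover have "coeff (lagrange_poly x A (F 0)) m = divided_difference x A (F 0)"
    using coeff_lagrange_poly[OF A(1), of x "F 0"] A by simp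
  ultimately show ?thesis by metis
qed

text \<open>The divided difference at the nodes \<open>x j\<close> (\<open>j \<in> A\<close>) with \<open>x i\<close> counted twice.\<close>

definition double_difference ::
  "(nat \<Rightarrow> real) \<Rightarrow> nat set \<Rightarrow> nat \<Rightarrow> (real \<Rightarrow> real) \<Rightarrow> real \<Rightarrow> real" where
  "double_difference x A i g D = (D - poly (pderiv (lagrange_poly x A g)) (x i)) / node_prod x A i"

lemma pderiv_lagrange_poly:
  "poly (pderiv (lagrange_poly x A g)) t =
     (\<Sum>l\<in>A. poly (pderiv (nodal_poly x (A - {l}))) t / node_prod x A l * g (x l))"
proof -
  have "pderiv (\<Sum>l\<in>A. P l) = (\<Sum>l\<in>A. pderiv (P l))" for P :: "nat \<Rightarrow> real poly"
    by (induction A rule: infinite_finite_induct) (auto simp: pderiv_add)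
  then show ?thesis by (simp add: lagrange_poly_def pderiv_smult poly_sum mult.commute)
qed

lemma poly_pderiv_nodal_poly:
  assumes "finite A" "i \<in> A"
  shows "poly (pderiv (nodal_poly x A)) (x i) = node_prod x A i"
proof -
  have e: "nodal_poly x A = [:- x i, 1:] * nodal_poly x (A - {i})"
    unfolding nodal_poly_def using assms by (rule prod.remove)
  have "poly (pderiv (nodal_poly x A)) (x i) = poly (nodal_poly x (A - {i})) (x i)"
    by (subst e) (unfold pderiv_mult, simp add: pderiv_pCons)
  then show ?thesis by (simp add: poly_nodal_poly node_prod_def)
qed

lemma double_difference_mean_value:
  fixes F :: "nat \<Rightarrow> real \<Rightarrow> real"
  assumes A: "finite A" "inj_on x A" "card A = m" "x ` A \<subseteq> {a..b}" "i \<in> A"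
    and d: "\<And>i t. i < m \<Longrightarrow> (F i has_real_derivative F (Suc i) t) (at t)"
  shows "\<exists>\<xi>\<in>{a..b}. fact m * double_difference x A i (F 0) (F (Suc 0) (x i)) = F m \<xi>"
proof -
  have ne: "A \<noteq> {}" using A by auto
  then have m: "m > 0" using A by auto
  define W where "W = double_difference x A i (F 0) (F (Suc 0) (x i))"
  \<comment> \<open>The Hermite interpolation polynomial: the nodal term leaves the values at the
    nodes unchanged, and \<open>W\<close> adjusts the derivative at \<open>x i\<close>.\<close>
  define P where "P = lagrange_poly x A (F 0) + Polynomial.smult W (nodal_poly x A)"
  have np: "node_prod x A i \<noteq> 0" by (rule node_prod_nonzero[OF A(2,1,5)])
  have dl: "degree (lagrange_poly x A (F 0)) \<le> m - 1" using degree_lagrange_poly[OF A(1) ne, of x "F 0"] A by simp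
  have cP: "coeff P m = W"
  proof -
    have "coeff (lagrange_poly x A (F 0)) m = 0" using dl m by (intro coeff_eq_0) simp
    moreover have "coeff (nodal_poly x A) m = 1" using coeff_nodal_poly[OF A(1)] A by simp
    ultimately show ?thesis by (simp add: P_def)
  qed
  have "\<exists>\<xi>\<in>{a..b}. F m \<xi> = fact m * coeff P m"
  proof (rule interpolation_mean_value[of m F _ "x ` A"])
    show "degree P \<le> m"
      unfolding P_def using dl degree_smult_le[of W "nodal_poly x A"] degree_nodal_poly[OF A(1), of x] A
      by (intro degree_add_le) auto
    have "poly (pderiv P) (x i) = F (Suc 0) (x i)"
      using np by (simp add: P_def pderiv_add pderiv_smult poly_pderiv_nodal_poly[OF A(1,5)] W_def double_difference_def)
    then show "card (x ` A) = Suc m \<or> (card (x ` A) = m \<and> (\<exists>z\<in>x ` A. F (Suc 0) z = poly (pderiv P) z))"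
      using A by (intro disjI2 conjI bexI[of _ "x i"]) (auto simp: card_image)
    show "F 0 z = poly P z" if "z \<in> x ` A" for z
    proof -
      from that obtain j where j: "j \<in> A" "z = x j" by auto
      then have "poly (nodal_poly x A) z = 0" using A by (auto simp: poly_nodal_poly intro!: prod_zero)
      then show ?thesis using j by (simp add: P_def poly_lagrange_poly[OF A(1,2)])
    qed
  qed (use A d in auto)
  then show ?thesis unfolding cP W_def by metis
qed

section \<open>Confluence of the zeros\<close>

locale smooth_process = gaussian_space M H for M :: "'w measure" and H +
  fixes F :: "nat \<Rightarrow> real \<Rightarrow> 'w \<Rightarrow> real" and k :: nat
  assumes k_pos: "k > 0"
    and F_mem: "\<And>i t. i \<le> k \<Longrightarrow> F i t \<in> H"
    and F_deriv: "\<And>i t w. i < k \<Longrightarrow> ((\<lambda>s. F i s w) has_real_derivative F (Suc i) t w) (at t)"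
    and F_cont: "\<And>i w. i \<le> k \<Longrightarrow> continuous_on UNIV (\<lambda>s. F i s w)"
    and F_unit: "\<And>t. inner_rv M (F 0 t) (F 0 t) = 1"

sublocale smooth_process \<subseteq> smooth_gaussian M H "F 0" "F 1"
  using F_mem F_deriv[of 0] F_cont[of 1] F_unit k_pos by unfold_locales auto

text \<open>Index \<open>a\<close> carries the derivative whose order is the number of earlier
  indices with the same \<open>y\<close>-value. Divided differences over these earlier nodes and
  \<open>a\<close> itself are then triangular in the samples.\<close>

locale confluence = smooth_process M H F k for M :: "'w measure" and H F k +
  fixes y :: "nat \<Rightarrow> real" and m :: "nat \<Rightarrow> nat \<Rightarrow> real"
  assumes jet_frame: "frame k m (\<lambda>a. F (card {l. l < a \<and> y l = y a}) (y a))"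
begin

definition pos :: "nat \<Rightarrow> nat" where "pos a = card {l. l < a \<and> y l = y a}"

definition lower :: "nat \<Rightarrow> nat set" where "lower a = {l. l \<le> a \<and> y l = y a}"

definition block :: "nat \<Rightarrow> nat set" where "block a = {l. l < k \<and> y l = y a}"

definition bsize :: "nat \<Rightarrow> nat" where "bsize a = card (block a)"

lemma finite_lower [simp]: "finite (lower a)" by (simp add: lower_def)

lemma finite_block [simp]: "finite (block a)" by (simp add: block_def)

lemma self_mem: "a \<in> lower a" "a < k \<Longrightarrow> a \<in> block a" by (auto simp: lower_def block_def)

lemma lower_less: "l \<in> lower a \<Longrightarrow> a < k \<Longrightarrow> l < k" by (auto simp: lower_def)

lemma card_lower: "card (lower a) = Suc (pos a)"
proof -
  have "lower a = insert a {l. l < a \<and> y l = y a}" by (auto simp: lower_def)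
  then show ?thesis by (simp add: pos_def)
qed

lemma pos_less: assumes "a < k" shows "pos a < k"
proof -
  have "card (lower a) \<le> card {..<k}" using assms by (intro card_mono) (auto simp: lower_def)
  then show ?thesis by (simp add: card_lower)
qed

lemma bsize_le: "bsize a \<le> k"
proof -
  have "card (block a) \<le> card {..<k}" by (intro card_mono) (auto simp: block_def)
  then show ?thesis by (simp add: bsize_def)
qed

text \<open>The jets at \<open>y\<close>, and the divided differences at \<open>x\<close> which converge to them.\<close>

definition jets :: "nat \<Rightarrow> 'w \<Rightarrow> real" where "jets a = F (pos a) (y a)"

text \<open>The factorial turns a divided difference into an approximation of the derivative itself
  and produces the numerators \<open>i!\<close> of the limit constant.\<close>

definition newton :: "(nat \<Rightarrow> real) \<Rightarrow> nat \<Rightarrow> nat \<Rightarrow> real" where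
  "newton x a l = (if l \<in> lower a then fact (pos a) / node_prod x (lower a) l else 0)"

definition samples :: "(nat \<Rightarrow> real) \<Rightarrow> nat \<Rightarrow> 'w \<Rightarrow> real" where
  "samples x j = F 0 (x j)"

text \<open>Where all samples vanish, the Lagrange polynomial is 0 and this is
  \<open>F 1 (x a)\<close> times \<open>|I|!\<close> divided by the node product over the block
  \<open>I\<close> of \<open>a\<close>.\<close>

definition slope :: "(nat \<Rightarrow> real) \<Rightarrow> nat \<Rightarrow> 'w \<Rightarrow> real" where
  "slope x a w = fact (bsize a) * double_difference x (block a) a (\<lambda>t. F 0 t w) (F 1 (x a) w)"

lemma jets_frame: "frame k m jets"
  using jet_frame by (simp add: jets_def[abs_def] pos_def)

lemma samples_mem: "samples x j \<in> H"
  unfolding samples_def by (intro F_mem) simp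

lemma lower_triangular_newton:
  assumes "inj_on x {..<k}"
  shows "lower_triangular k (newton x)"
  unfolding lower_triangular_def
proof safe
  fix a assume a: "a < k" "newton x a a = 0"
  have "inj_on x (lower a)" using assms by (rule inj_on_subset) (use a in \<open>auto dest: lower_less\<close>)
  then show False using a node_prod_nonzero[of x "lower a" a] self_mem[of a] by (auto simp: newton_def)
qed (auto simp: newton_def lower_def)

lemma comb_newton:
  assumes "a < k"
  shows "comb k (newton x) (samples x) a w = fact (pos a) * divided_difference x (lower a) (\<lambda>t. F 0 t w)"
proof -
  have "comb k (newton x) (samples x) a w = (\<Sum>l\<in>lower a. fact (pos a) / node_prod x (lower a) l * F 0 (x l) w)"
    unfolding comb_def lin_def samples_def
    by (rule sum.mono_neutral_cong_right) (use assms in \<open>auto simp: newton_def dest: lower_less\<close>)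
  then show ?thesis by (simp add: divided_difference_def sum_distrib_left)
qed

text \<open>Both quantities equal a derivative of the path at an intermediate point, by the mean
  value forms, and the nodes of the block squeeze that point to \<open>y a\<close>.\<close>

lemma newton_limit:
  assumes inj: "\<And>n. inj_on (x n) {..<k}" and x: "\<And>j. j < k \<Longrightarrow> (\<lambda>n. x n j) \<longlonglongrightarrow> y j" and a: "a < k"
  shows "(\<lambda>n. comb k (newton (x n)) (samples (x n)) a w) \<longlonglongrightarrow> jets a w"
    and "(\<lambda>n. slope (x n) a w) \<longlonglongrightarrow> F (bsize a) (y a) w"
proof -
  define \<delta> where "\<delta> n = (\<Sum>j<k. \<bar>x n j - y j\<bar>)" for n
  have "\<delta> \<longlonglongrightarrow> (\<Sum>j<k. \<bar>y j - y j\<bar>)" unfolding \<delta>_def by (intro tendsto_sum tendsto_rabs tendsto_diff tendsto_const x) auto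
  then have \<delta>: "\<delta> \<longlonglongrightarrow> 0" by simp
  have near: "x n j \<in> {y a - \<delta> n..y a + \<delta> n}" if "j < k" "y j = y a" for n j
  proof -
    have "\<bar>x n j - y j\<bar> \<le> \<delta> n" unfolding \<delta>_def using that by (intro member_le_sum) auto
    then show ?thesis using that(2) by (auto simp: abs_le_iff)
  qed
  have conv: "(\<lambda>n. g n) \<longlonglongrightarrow> F i (y a) w"
    if i: "i \<le> k" and g: "\<And>n. \<exists>\<xi>\<in>{y a - \<delta> n..y a + \<delta> n}. g n = F i \<xi> w" for i g
  proof -
    obtain \<xi> where \<xi>: "\<And>n. \<xi> n \<in> {y a - \<delta> n..y a + \<delta> n}" "\<And>n. g n = F i (\<xi> n) w" using g by metis
    have "\<xi> \<longlonglongrightarrow> y a"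
    proof (rule tendsto_sandwich)
      show "(\<lambda>n. y a - \<delta> n) \<longlonglongrightarrow> y a" "(\<lambda>n. y a + \<delta> n) \<longlonglongrightarrow> y a"
        using tendsto_diff[OF tendsto_const[of "y a"] \<delta>] tendsto_add[OF tendsto_const[of "y a"] \<delta>] by auto
      show "eventually (\<lambda>n. y a - \<delta> n \<le> \<xi> n) sequentially" "eventually (\<lambda>n. \<xi> n \<le> y a + \<delta> n) sequentially"
        using \<xi>(1) by auto
    qed
    moreover have "isCont (\<lambda>s. F i s w) (y a)" using F_cont[OF i] by (simp add: continuous_on_eq_continuous_at)
    ultimately have "(\<lambda>n. F i (\<xi> n) w) \<longlonglongrightarrow> F i (y a) w" by (rule isCont_tendsto_compose[rotated])
    then show ?thesis using \<xi>(2) by simp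
  qed
  show "(\<lambda>n. comb k (newton (x n)) (samples (x n)) a w) \<longlonglongrightarrow> jets a w"
    unfolding jets_def comb_newton[OF a]
  proof (rule conv)
    show "pos a \<le> k" using pos_less[OF a] by simp
    fix n
    show "\<exists>\<xi>\<in>{y a - \<delta> n..y a + \<delta> n}. fact (pos a) * divided_difference (x n) (lower a) (\<lambda>t. F 0 t w) = F (pos a) \<xi> w"
    proof (rule divided_difference_mean_value[where F = "\<lambda>i t. F i t w"])
      show "inj_on (x n) (lower a)" using inj by (rule inj_on_subset) (use a in \<open>auto dest: lower_less\<close>)
      show "x n ` lower a \<subseteq> {y a - \<delta> n..y a + \<delta> n}"
        using near a by (auto simp: lower_def simp del: atLeastAtMost_iff)
      show "((\<lambda>t. F i t w) has_real_derivative F (Suc i) t w) (at t)" if "i < pos a" for i t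
        using that pos_less[OF a] by (intro F_deriv) simp
    qed (auto simp: card_lower)
  qed
  show "(\<lambda>n. slope (x n) a w) \<longlonglongrightarrow> F (bsize a) (y a) w"
    unfolding slope_def
  proof (rule conv[OF bsize_le])
    fix n
    show "\<exists>\<xi>\<in>{y a - \<delta> n..y a + \<delta> n}.
      fact (bsize a) * double_difference (x n) (block a) a (\<lambda>t. F 0 t w) (F 1 (x n a) w) = F (bsize a) \<xi> w"
      unfolding One_nat_def
    proof (rule double_difference_mean_value[where F = "\<lambda>i t. F i t w"])
      show "inj_on (x n) (block a)" using inj by (rule inj_on_subset) (auto simp: block_def)
      show "x n ` block a \<subseteq> {y a - \<delta> n..y a + \<delta> n}"
        using near by (auto simp: block_def simp del: atLeastAtMost_iff)
      show "((\<lambda>t. F i t w) has_real_derivative F (Suc i) t w) (at t)" if "i < bsize a" for i t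
        using that bsize_le[of a] by (intro F_deriv) simp
    qed (auto simp: bsize_def self_mem a)
  qed
qed

text \<open>The jet frame \<open>m\<close> nearly orthonormalizes the divided differences, and a
  small Gram--Schmidt correction \<open>K n\<close> completes it. Composing with
  \<open>newton\<close> gives frames of the samples, although these may become degenerate as nodes
  merge.\<close>

lemma confluent_frames:
  assumes inj: "\<And>n. inj_on (x n) {..<k}" and x: "\<And>j. j < k \<Longrightarrow> (\<lambda>n. x n j) \<longlonglongrightarrow> y j"
  shows "\<exists>K. (\<forall>i<k. \<forall>j<k. (\<lambda>n. K n i j) \<longlonglongrightarrow> (if i = j then 1 else 0)) \<and>
    eventually (\<lambda>n. frame k (K n) (comb k m (comb k (newton (x n)) (samples (x n))))
       \<and> frame k (mat_prod k (K n) (mat_prod k m (newton (x n)))) (samples (x n))) sequentially"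
proof -
  define T where "T n = comb k (newton (x n)) (samples (x n))" for n
  have TH: "T n j \<in> H" for n j unfolding T_def by (intro comb_mem samples_mem)
  have tri: "lower_triangular k m" and on: "orthonormal k (comb k m jets)" using jets_frame by (auto simp: frame_def)
  have "\<exists>K. (\<forall>i<k. \<forall>j<k. (\<lambda>n. K n i j) \<longlonglongrightarrow> (if i = j then 1 else 0)) \<and>
     eventually (\<lambda>n. frame k (K n) (comb k m (T n))) sequentially"
    by (rule frame_perturbation[OF comb_mem comb_tendsto on]) (auto simp: T_def intro!: comb_mem samples_mem newton_limit[OF inj x])
  then obtain K where K: "\<forall>i<k. \<forall>j<k. (\<lambda>n. K n i j) \<longlonglongrightarrow> (if i = j then 1 else 0)"
    "eventually (\<lambda>n. frame k (K n) (comb k m (T n))) sequentially" by auto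
  from K(2) have "eventually (\<lambda>n. frame k (K n) (comb k m (T n))
       \<and> frame k (mat_prod k (K n) (mat_prod k m (newton (x n)))) (samples (x n))) sequentially"
  proof eventually_elim
    fix n assume f: "frame k (K n) (comb k m (T n))"
    then have "frame k (K n) (comb k (mat_prod k m (newton (x n))) (samples (x n)))"
      by (simp add: T_def comb_mat_prod)
    then have "frame k (mat_prod k (K n) (mat_prod k m (newton (x n)))) (samples (x n))"
      by (rule frame_comp) (auto intro: lower_triangular_mat_prod tri lower_triangular_newton[OF inj] samples_mem)
    with f show "frame k (K n) (comb k m (T n)) \<and> frame k (mat_prod k (K n) (mat_prod k m (newton (x n)))) (samples (x n))" ..
  qed
  with K(1) show ?thesis unfolding T_def by (intro exI[of _ K] conjI)
qed

text \<open>A frame certifies that the samples are non-degenerate. Failure at every scale would give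
  a sequence of nodes tending to \<open>y\<close>, against \<open>confluent_frames\<close>.\<close>

lemma frames_near:
  "\<exists>\<delta>>0. \<forall>x. inj_on x {..<k} \<longrightarrow> (\<forall>j<k. \<bar>x j - y j\<bar> < \<delta>) \<longrightarrow> (\<exists>A. frame k A (\<lambda>j. F 0 (x j)))"
proof (rule ccontr)
  assume neg: "\<not> ?thesis"
  have "\<forall>n. \<exists>x. inj_on x {..<k} \<and> (\<forall>j<k. \<bar>x j - y j\<bar> < 1 / real (Suc n)) \<and> \<not> (\<exists>A. frame k A (samples x))"
  proof
    fix n
    have "1 / real (Suc n) > 0" by simp
    with neg show "\<exists>x. inj_on x {..<k} \<and> (\<forall>j<k. \<bar>x j - y j\<bar> < 1 / real (Suc n)) \<and> \<not> (\<exists>A. frame k A (samples x))"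
      unfolding samples_def[abs_def] by metis
  qed
  then obtain x where x: "\<And>n. inj_on (x n) {..<k}" "\<And>n j. j < k \<Longrightarrow> \<bar>x n j - y j\<bar> < 1 / real (Suc n)"
    "\<And>n. \<not> (\<exists>A. frame k A (samples (x n)))" by metis
  have z: "(\<lambda>n. 1 / real (Suc n)) \<longlonglongrightarrow> 0"
    using LIMSEQ_inverse_real_of_nat by (simp add: inverse_eq_divide)
  have lim: "(\<lambda>n. x n j) \<longlonglongrightarrow> y j" if "j < k" for j
  proof -
    have "eventually (\<lambda>n. norm (x n j - y j) \<le> 1 / real (Suc n)) sequentially"
      using less_imp_le[OF x(2)[OF that]] by simp
    then have "(\<lambda>n. x n j - y j) \<longlonglongrightarrow> 0" by (rule Lim_null_comparison[OF _ z])
    then show ?thesis by (simp add: LIM_zero_iff)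
  qed
  have "\<exists>K. eventually (\<lambda>n. frame k (mat_prod k (K n) (mat_prod k m (newton (x n)))) (samples (x n))) sequentially"
    using confluent_frames[OF x(1) lim] by (auto elim: eventually_mono)
  then obtain K n where "frame k (mat_prod k (K n) (mat_prod k m (newton (x n)))) (samples (x n))"
    by (auto simp: eventually_sequentially)
  then have "\<exists>A. frame k A (samples (x n))" by (rule exI[where x = "mat_prod k (K n) (mat_prod k m (newton (x n)))"])
  with x(3)[of n] show False by contradiction
qed

section \<open>Vandermonde factors and the rescaled limit\<close>

definition vandermonde :: "(nat \<Rightarrow> real) \<Rightarrow> real" where
  "vandermonde x = (\<Prod>a<k. \<Prod>l\<in>{l. l < a \<and> y l = y a}. \<bar>x a - x l\<bar>)"

lemma vandermonde_pos:
  assumes "inj_on x {..<k}"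
  shows "vandermonde x > 0"
  unfolding vandermonde_def
proof (intro prod_pos ballI)
  fix a l assume "a \<in> {..<k}" "l \<in> {l. l < a \<and> y l = y a}"
  then have "x a \<noteq> x l" using inj_onD[OF assms, of a l] by auto
  then show "\<bar>x a - x l\<bar> > 0" by simp
qed

lemma prod_node_prod_lower: "(\<Prod>a<k. \<bar>node_prod x (lower a) a\<bar>) = vandermonde x"
proof -
  have "lower a - {a} = {l. l < a \<and> y l = y a}" for a by (auto simp: lower_def)
  then show ?thesis by (simp add: vandermonde_def node_prod_def abs_prod)
qed

text \<open>Over full blocks every pair occurs once from each endpoint, whereas \<open>lower\<close>
  sees it only from the later one.\<close>

lemma prod_node_prod_block: "(\<Prod>a<k. \<bar>node_prod x (block a) a\<bar>) = (vandermonde x)\<^sup>2"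
proof -
  define g where "g a l = (if l < a \<and> y l = y a then \<bar>x a - x l\<bar> else 1)" for a l
  have "\<bar>node_prod x (block a) a\<bar> = (\<Prod>l<k. g a l * g l a)" for a
    unfolding node_prod_def abs_prod
    by (rule prod.mono_neutral_cong_left) (auto simp: block_def g_def abs_minus_commute)
  then have "(\<Prod>a<k. \<bar>node_prod x (block a) a\<bar>) = (\<Prod>a<k. \<Prod>l<k. g a l) * (\<Prod>a<k. \<Prod>l<k. g l a)"
    by (simp add: prod.distrib)
  also have "(\<Prod>a<k. \<Prod>l<k. g l a) = (\<Prod>a<k. \<Prod>l<k. g a l)" by (rule prod.swap)
  also have "(\<Prod>a<k. \<Prod>l<k. g a l) = vandermonde x"
    unfolding vandermonde_def
    by (intro prod.cong refl prod.mono_neutral_cong_right) (auto simp: g_def)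
  finally show ?thesis by (simp add: power2_eq_square)
qed

text \<open>This is \<open>ell\<close> in frame coordinates. The index \<open>a\<close> runs over
  the positions inside the blocks, so each block \<open>I\<close> contributes \<open>|I|\<close>
  equal factors to the integrand.\<close>

definition confluent_const :: real where
  "confluent_const = (\<Prod>a<k. \<bar>m a a\<bar>) * (1 / sqrt (2 * pi)) ^ k * (\<Prod>a<k. fact (pos a) / fact (bsize a)) *
     (\<integral>w. (\<Prod>a<k. \<bar>residual k (comb k m jets) (F (bsize a) (y a)) w\<bar>) \<partial>M)"

text \<open>\<open>slope\<close> differs from a multiple of \<open>F 1 (x a)\<close> by a multiple
  of the derivative of the Lagrange polynomial, which is a combination of samples and has residual
  0.\<close>

lemma slope_decomposition:
  assumes inj: "inj_on x {..<k}" and a: "a < k" and fr: "frame k A (samples x)"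
  shows "slope x a \<in> H"
    and "residual k (comb k A (samples x)) (F 1 (x a)) w =
      node_prod x (block a) a / fact (bsize a) * residual k (comb k A (samples x)) (slope x a) w"
proof -
  define p where "p = node_prod x (block a) a"
  have "inj_on x (block a)" using inj by (rule inj_on_subset) (auto simp: block_def)
  then have p: "p \<noteq> 0" unfolding p_def using a by (intro node_prod_nonzero) (auto simp: self_mem)
  \<comment> \<open>The coefficient does not depend on the row \<open>i\<close>; \<open>comb\<close>
    expects a matrix, and row 0 is taken.\<close>
  define c where "c i l = (if l \<in> block a then poly (pderiv (nodal_poly x (block a - {l}))) (x a) / node_prod x (block a) l else 0)" for i l :: nat
  define Q where "Q = comb k c (samples x) 0"
  have Q: "Q w = poly (pderiv (lagrange_poly x (block a) (\<lambda>t. F 0 t w))) (x a)" for w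
    unfolding Q_def comb_def lin_def pderiv_lagrange_poly samples_def
    by (rule sum.mono_neutral_cong_right) (auto simp: c_def block_def)
  have QH: "Q \<in> H" unfolding Q_def by (intro comb_mem samples_mem)
  have F1: "F 1 (x a) \<in> H" by (rule F_mem) (use k_pos in auto)
  have s: "slope x a = (\<lambda>w. (fact (bsize a) / p) * F 1 (x a) w + (- fact (bsize a) / p) * Q w)"
    by (auto simp: slope_def double_difference_def Q p_def diff_divide_distrib algebra_simps)
  show sH: "slope x a \<in> H" unfolding s by (rule lincomb_mem[OF F1 QH])
  have on: "orthonormal k (comb k A (samples x))" using fr by (simp add: frame_def)
  have "residual k (comb k A (samples x)) (slope x a) w = (fact (bsize a) / p) * residual k (comb k A (samples x)) (F 1 (x a)) w
      + (- fact (bsize a) / p) * residual k (comb k A (samples x)) Q w"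
    unfolding s by (rule residual_lincomb[OF on F1 QH])
  also have "residual k (comb k A (samples x)) Q w = 0" unfolding Q_def by (rule residual_frame_span[OF fr])
  finally show "residual k (comb k A (samples x)) (F 1 (x a)) w =
      node_prod x (block a) a / fact (bsize a) * residual k (comb k A (samples x)) (slope x a) w"
    using p by (simp add: p_def[symmetric])
qed

text \<open>The frame diagonal splits into those of \<open>K n\<close>, \<open>m\<close> and
  \<open>newton\<close>; the residuals of the derivatives split into node products and residuals of
  slopes. The hypothesis on \<open>r\<close> speaks of every frame, so those of
  \<open>confluent_frames\<close> may be inserted.\<close>

lemma confluent_limit:
  assumes inj: "\<And>n. inj_on (x n) {..<k}" and x: "\<And>j. j < k \<Longrightarrow> (\<lambda>n. x n j) \<longlonglongrightarrow> y j"
    and r: "\<And>n A. frame k A (\<lambda>j. F 0 (x n j)) \<Longrightarrow> r n = crossing_const k A (\<lambda>j. F 0 (x n j)) (\<lambda>j. F 1 (x n j))"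
  shows "(\<lambda>n. r n / vandermonde (x n)) \<longlonglongrightarrow> confluent_const"
proof -
  obtain K where K0: "\<forall>i<k. \<forall>j<k. (\<lambda>n. K n i j) \<longlonglongrightarrow> (if i = j then 1 else 0)"
    and ev: "eventually (\<lambda>n. frame k (K n) (comb k m (comb k (newton (x n)) (samples (x n))))
       \<and> frame k (mat_prod k (K n) (mat_prod k m (newton (x n)))) (samples (x n))) sequentially"
    using confluent_frames[OF inj x] by auto
  note K = K0[rule_format]
  have trim: "lower_triangular k m" and on: "orthonormal k (comb k m jets)" using jets_frame by (auto simp: frame_def)
  define A where "A n = mat_prod k (K n) (mat_prod k m (newton (x n)))" for n
  define e where "e n = comb k (A n) (samples (x n))" for n
  have eH: "e n j \<in> H" for n j unfolding e_def by (intro comb_mem samples_mem)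
  have e'H: "comb k m jets j \<in> H" if "j < k" for j using on that by (auto simp: orthonormal_def)
  have elim: "(\<lambda>n. e n j w) \<longlonglongrightarrow> comb k m jets j w" if j: "j < k" for j w
  proof -
    have "(\<lambda>n. comb k (K n) (comb k m (comb k (newton (x n)) (samples (x n)))) j w) \<longlonglongrightarrow>
       comb k (\<lambda>i j. if i = j then 1 else 0) (comb k m jets) j w"
      using j by (intro comb_tendsto K newton_limit[OF inj x] tendsto_const) auto
    also have "comb k (\<lambda>i j. if i = j then 1 else 0) (comb k m jets) j w = (\<Sum>l<k. if l = j then comb k m jets j w else 0)"
      unfolding comb_def[of k "\<lambda>i j. if i = j then 1 else 0"] lin_def by (rule sum.cong) auto
    finally show ?thesis using j by (simp add: e_def A_def comb_mat_prod)
  qed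
  \<comment> \<open>Frames are available only from some index on, so the sequences are shifted by
    \<open>n0\<close> before residuals are formed.\<close>
  obtain n0 where n00: "\<forall>n\<ge>n0. frame k (K n) (comb k m (comb k (newton (x n)) (samples (x n)))) \<and> frame k (A n) (samples (x n))"
    using ev unfolding A_def eventually_sequentially by (rule exE)
  have n0: "frame k (K n) (comb k m (comb k (newton (x n)) (samples (x n))))" "frame k (A n) (samples (x n))" if "n \<ge> n0" for n
    using n00 that by auto
  have sH: "slope (x (n + n0)) a \<in> H" if "a < k" for n a
    by (rule slope_decomposition(1)[OF inj that n0(2)]) simp
  define R where "R n a = residual k (e (n + n0)) (slope (x (n + n0)) a)" for n a
  have RH: "R n a \<in> H" if "a < k" for n a
    unfolding R_def residual_def[abs_def] using sH[OF that] eH by (intro diff_mem sum_mem) auto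
  have Rlim: "(\<lambda>n. R n a w) \<longlonglongrightarrow> residual k (comb k m jets) (F (bsize a) (y a)) w" if a: "a < k" for a w
    unfolding R_def
  proof (rule residual_tendsto)
    show "(\<lambda>n. e (n + n0) j w) \<longlonglongrightarrow> comb k m jets j w" if "j < k" for j w
      by (rule LIMSEQ_ignore_initial_segment[OF elim[OF that]])
    show "(\<lambda>n. slope (x (n + n0)) a w) \<longlonglongrightarrow> F (bsize a) (y a) w" for w
      by (rule LIMSEQ_ignore_initial_segment[OF newton_limit(2)[OF inj x a]])
    show "F (bsize a) (y a) \<in> H" by (rule F_mem[OF bsize_le])
  qed (auto intro: eH e'H sH a)
  have Elim: "(\<lambda>n. \<integral>w. (\<Prod>a<k. \<bar>R n a w\<bar>) \<partial>M) \<longlonglongrightarrow>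
      (\<integral>w. (\<Prod>a<k. \<bar>residual k (comb k m jets) (F (bsize a) (y a)) w\<bar>) \<partial>M)"
    by (rule expectation_abs_prod_tendsto[OF RH Rlim])
  define c where "c = (1 / sqrt (2 * pi)) ^ k * (\<Prod>a<k. fact (pos a) / fact (bsize a) :: real)"
  have "(\<lambda>n. (\<Prod>a<k. \<bar>K (n + n0) a a\<bar>) * (\<Prod>a<k. \<bar>m a a\<bar>) * c * (\<integral>w. (\<Prod>a<k. \<bar>R n a w\<bar>) \<partial>M)) \<longlonglongrightarrow>
     (\<Prod>a<k. \<bar>1\<bar>) * (\<Prod>a<k. \<bar>m a a\<bar>) * c * (\<integral>w. (\<Prod>a<k. \<bar>residual k (comb k m jets) (F (bsize a) (y a)) w\<bar>) \<partial>M)"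
  proof (intro tendsto_mult tendsto_const Elim tendsto_prod tendsto_rabs)
    fix a assume "a \<in> {..<k}"
    then show "(\<lambda>n. K (n + n0) a a) \<longlonglongrightarrow> 1" using LIMSEQ_ignore_initial_segment[OF K[of a a]] by simp
  qed
  moreover have "r (n + n0) / vandermonde (x (n + n0)) =
     (\<Prod>a<k. \<bar>K (n + n0) a a\<bar>) * (\<Prod>a<k. \<bar>m a a\<bar>) * c * (\<integral>w. (\<Prod>a<k. \<bar>R n a w\<bar>) \<partial>M)" for n
  proof -
    define n' where "n' = n + n0"
    have n': "n' \<ge> n0" by (simp add: n'_def)
    have triK: "lower_triangular k (K n')" using n0(1)[OF n'] by (simp add: frame_def)
    have triN: "lower_triangular k (newton (x n'))" by (rule lower_triangular_newton[OF inj])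
    have fr: "frame k (A n') (samples (x n'))" by (rule n0(2)[OF n'])
    have v: "vandermonde (x n') > 0" by (rule vandermonde_pos[OF inj])
    have dA: "\<bar>A n' a a\<bar> = \<bar>K n' a a\<bar> * \<bar>m a a\<bar> * fact (pos a) / \<bar>node_prod (x n') (lower a) a\<bar>" if "a < k" for a
    proof -
      have "A n' a a = K n' a a * (m a a * newton (x n') a a)"
        unfolding A_def using mat_prod_diag[OF triK lower_triangular_mat_prod[OF trim triN] that] mat_prod_diag[OF trim triN that] by simp
      then show ?thesis using self_mem(1)[of a] by (simp add: newton_def abs_mult)
    qed
    have "r n' = (\<Prod>a<k. \<bar>A n' a a\<bar>) * (1 / sqrt (2 * pi)) ^ k *
        (\<integral>w. (\<Prod>a<k. \<bar>residual k (e n') (F 1 (x n' a)) w\<bar>) \<partial>M)"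
      using r[OF fr[unfolded samples_def[abs_def]]] by (simp add: crossing_const_def e_def samples_def[abs_def])
    also have "(\<Prod>a<k. \<bar>A n' a a\<bar>) = (\<Prod>a<k. \<bar>K n' a a\<bar> * \<bar>m a a\<bar> * fact (pos a) / \<bar>node_prod (x n') (lower a) a\<bar>)"
      by (rule prod.cong) (simp_all add: dA)
    also have "\<dots> = (\<Prod>a<k. \<bar>K n' a a\<bar>) * (\<Prod>a<k. \<bar>m a a\<bar>) * (\<Prod>a<k. fact (pos a)) / vandermonde (x n')"
      by (simp only: prod_dividef prod.distrib prod_node_prod_lower)
    also have "(\<integral>w. (\<Prod>a<k. \<bar>residual k (e n') (F 1 (x n' a)) w\<bar>) \<partial>M) =
        (\<integral>w. ((vandermonde (x n'))\<^sup>2 / (\<Prod>a<k. fact (bsize a))) * (\<Prod>a<k. \<bar>R n a w\<bar>) \<partial>M)"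
    proof (rule Bochner_Integration.integral_cong)
      fix w
      have "(\<Prod>a<k. \<bar>residual k (e n') (F 1 (x n' a)) w\<bar>) = (\<Prod>a<k. (\<bar>node_prod (x n') (block a) a\<bar> / fact (bsize a)) * \<bar>R n a w\<bar>)"
      proof (rule prod.cong)
        fix a assume "a \<in> {..<k}"
        then show "\<bar>residual k (e n') (F 1 (x n' a)) w\<bar> = (\<bar>node_prod (x n') (block a) a\<bar> / fact (bsize a)) * \<bar>R n a w\<bar>"
          using slope_decomposition(2)[OF inj _ fr, of a w]
          by (simp add: e_def R_def n'_def[symmetric] abs_mult)
      qed simp
      also have "\<dots> = ((vandermonde (x n'))\<^sup>2 / (\<Prod>a<k. fact (bsize a))) * (\<Prod>a<k. \<bar>R n a w\<bar>)"
        by (simp only: prod_dividef prod.distrib prod_node_prod_block)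
      finally show "(\<Prod>a<k. \<bar>residual k (e n') (F 1 (x n' a)) w\<bar>) =
        ((vandermonde (x n'))\<^sup>2 / (\<Prod>a<k. fact (bsize a))) * (\<Prod>a<k. \<bar>R n a w\<bar>)" .
    qed simp
    finally show ?thesis using v by (simp add: n'_def[symmetric] c_def prod_dividef power2_eq_square)
  qed
  ultimately have "(\<lambda>n. r (n + n0) / vandermonde (x (n + n0))) \<longlonglongrightarrow> confluent_const"
    by (simp add: confluent_const_def c_def mult.assoc)
  then show ?thesis by (rule LIMSEQ_offset)
qed

end

section \<open>Gram matrices and the conditional law\<close>

lemma mat_mult_mat:
  "Matrix.mat n k f * Matrix.mat k p g = Matrix.mat n p (\<lambda>(i, j). \<Sum>l<k. f (i, l) * g (l, j))"
  for f g :: "nat \<times> nat \<Rightarrow> real"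
  by (rule eq_matI) (auto simp: scalar_prod_def atLeast0LessThan)

lemma transpose_mat_mat: "transpose_mat (Matrix.mat n k f) = Matrix.mat k n (\<lambda>(i, j). f (j, i))"
  by (rule eq_matI) auto

context gaussian_space
begin

definition gram :: "nat \<Rightarrow> (nat \<Rightarrow> 'w \<Rightarrow> real) \<Rightarrow> nat \<Rightarrow> (nat \<Rightarrow> 'w \<Rightarrow> real) \<Rightarrow> real Matrix.mat" where
  "gram n X k Y = Matrix.mat n k (\<lambda>(a, b). inner_rv M (X a) (Y b))"

text \<open>A combination of variance 0 vanishes almost surely and is orthogonal to every
  \<open>X b\<close>; its coefficients are then a row vector killed by the invertible Gram
  matrix.\<close>

lemma gram_nondegenerate:
  assumes X: "\<And>a. a < k \<Longrightarrow> X a \<in> H" and inv: "invertible_mat (gram k X k X)" and c: "\<exists>j<k. c j \<noteq> 0"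
  shows "inner_rv M (\<lambda>w. \<Sum>j<k. c j * X j w) (\<lambda>w. \<Sum>j<k. c j * X j w) \<noteq> 0"
proof
  assume z: "inner_rv M (\<lambda>w. \<Sum>j<k. c j * X j w) (\<lambda>w. \<Sum>j<k. c j * X j w) = 0"
  have Y: "(\<lambda>w. \<Sum>j<k. c j * X j w) \<in> H" by (rule sum_mem) (simp add: X)
  then have ae: "AE w in M. (\<Sum>j<k. c j * X j w) = 0" using inner_self_eq_0[OF Y] z by simp
  have s: "(\<Sum>l<k. c l * inner_rv M (X l) (X b)) = 0" if b: "b < k" for b
  proof -
    have "(\<Sum>l<k. c l * inner_rv M (X l) (X b)) = inner_rv M (\<lambda>w. \<Sum>j<k. c j * X j w) (X b)"
      by (rule inner_sum_left[symmetric]) (use X b in auto)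
    also have "\<dots> = (\<integral>w. 0 \<partial>M)"
      unfolding inner_rv_def
    proof (rule integral_cong_AE)
      show "(\<lambda>w. (\<Sum>j<k. c j * X j w) * X b w) \<in> borel_measurable M"
        using meas[OF Y] meas[OF X[OF b]] by measurable
      show "AE w in M. (\<Sum>j<k. c j * X j w) * X b w = 0" using ae by eventually_elim simp
    qed simp
    finally show ?thesis by simp
  qed
  obtain B where B: "gram k X k X * B = 1\<^sub>m k" "B * gram k X k X = 1\<^sub>m (dim_row B)"
    using inv by (auto simp: invertible_mat_def inverts_mat_def gram_def)
  have "dim_col (B * gram k X k X) = k" by (simp add: gram_def)
  then have "dim_row B = k" using B(2) by simp
  moreover have "dim_col B = k" using arg_cong[OF B(1), of dim_col] by simp
  ultimately have Bc: "B \<in> carrier_mat k k" by auto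
  have G: "gram k X k X \<in> carrier_mat k k" by (simp add: gram_def)
  define v where "v = Matrix.mat 1 k (\<lambda>(i, j). c j)"
  have v: "v \<in> carrier_mat 1 k" by (simp add: v_def)
  have "v * gram k X k X = 0\<^sub>m 1 k"
    unfolding v_def gram_def mat_mult_mat by (rule eq_matI) (auto simp: s)
  then have "(v * gram k X k X) * B = 0\<^sub>m 1 k" using Bc by simp
  moreover have "(v * gram k X k X) * B = v" using assoc_mult_mat[OF v G Bc] B(1) v by simp
  ultimately have v0: "v = 0\<^sub>m 1 k" by simp
  have "c j = 0" if "j < k" for j
  proof -
    have "c j = v $$ (0, j)" using that by (simp add: v_def)
    then show ?thesis using that v0 by simp
  qed
  then show False using c by auto
qed

lemma gram_frame:
  assumes fr: "frame k m U"
  shows "Matrix.mat k k (\<lambda>(i, j). m i j) * gram k U k U * transpose_mat (Matrix.mat k k (\<lambda>(i, j). m i j)) = 1\<^sub>m k"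
proof -
  have UH: "\<And>a. a < k \<Longrightarrow> U a \<in> H" and on: "orthonormal k (comb k m U)" using fr by (auto simp: frame_def)
  have eH: "comb k m U j \<in> H" for j by (rule comb_mem[OF UH])
  have "inner_rv M (comb k m U i) (comb k m U j) = (\<Sum>l<k. (\<Sum>p<k. m i p * inner_rv M (U p) (U l)) * m j l)" for i j
  proof -
    have "inner_rv M (comb k m U i) (comb k m U j) = (\<Sum>l<k. m j l * inner_rv M (comb k m U i) (U l))"
      by (subst (2) comb_def[abs_def], unfold lin_def, rule inner_sum_right) (use UH eH in auto)
    also have "\<dots> = (\<Sum>l<k. m j l * (\<Sum>p<k. m i p * inner_rv M (U p) (U l)))"
    proof (rule sum.cong)
      fix l assume l: "l \<in> {..<k}"
      have "inner_rv M (comb k m U i) (U l) = (\<Sum>p<k. m i p * inner_rv M (U p) (U l))"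
        by (subst comb_def[abs_def], unfold lin_def, rule inner_sum_left) (use UH l in auto)
      then show "m j l * inner_rv M (comb k m U i) (U l) = m j l * (\<Sum>p<k. m i p * inner_rv M (U p) (U l))" by simp
    qed simp
    finally show ?thesis by (simp add: mult.commute)
  qed
  then show ?thesis
    unfolding gram_def transpose_mat_mat mat_mult_mat
    by (intro eq_matI) (use on in \<open>auto simp: orthonormal_def\<close>)
qed

text \<open>Determinants of the identity \<open>m G m^T = 1\<close>: up to sign, the diagonal
  product of a frame is the inverse square root of the determinant.\<close>

lemma det_gram_frame:
  assumes fr: "frame k m U"
  shows "Determinant.det (gram k U k U) * (\<Prod>a<k. m a a)\<^sup>2 = 1"
proof -
  define Mm where "Mm = Matrix.mat k k (\<lambda>(i, j). m i j)"
  have c: "Mm \<in> carrier_mat k k" "gram k U k U \<in> carrier_mat k k" by (auto simp: Mm_def gram_def)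
  have "Determinant.det Mm = prod_list (diag_mat Mm)"
    by (rule det_lower_triangular[OF _ c(1)]) (use fr in \<open>auto simp: Mm_def frame_def lower_triangular_def\<close>)
  also have "\<dots> = (\<Prod>a<k. m a a)" by (simp add: prod_list_diag_prod Mm_def atLeast0LessThan)
  finally have d: "Determinant.det Mm = (\<Prod>a<k. m a a)" .
  have "Determinant.det (Mm * gram k U k U * transpose_mat Mm) = Determinant.det Mm * Determinant.det (gram k U k U) * Determinant.det Mm"
    using c by (simp only: det_mult[OF mult_carrier_mat[OF c] transpose_carrier_mat[THEN iffD2, OF c(1)]] det_mult[OF c] det_transpose[OF c(1)])
  then show ?thesis using gram_frame[OF fr] by (simp add: Mm_def[symmetric] d power2_eq_square mult.commute mult.left_commute)
qed

lemma residual_frame_expand: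
  "residual k (comb k m U) V w =
    V w - (\<Sum>a<k. (\<Sum>j<k. inner_rv M V (comb k m U j) * m j a) * U a w)"
proof -
  have "(\<Sum>j<k. inner_rv M V (comb k m U j) * comb k m U j w) =
      (\<Sum>j<k. \<Sum>a<k. inner_rv M V (comb k m U j) * m j a * U a w)"
    by (simp add: comb_def[of k m U _ w] lin_def sum_distrib_left mult.assoc)
  also have "\<dots> = (\<Sum>a<k. \<Sum>j<k. inner_rv M V (comb k m U j) * m j a * U a w)" by (rule sum.swap)
  finally show ?thesis by (simp add: residual_def sum_distrib_right)
qed

text \<open>Regression writes \<open>V = K U + R\<close> with \<open>R\<close> orthogonal to
  \<open>U\<close>. The covariance of \<open>V\<close> and \<open>U\<close> is then
  \<open>K G\<close> and the variance of \<open>V\<close> is \<open>K G K^T\<close> plus that of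
  \<open>R\<close>, so the Schur complement is the variance of \<open>R\<close>. The residuals on
  the original space thus realize the conditional law.\<close>

lemma conditional_law:
  assumes fr: "frame k m U" and V: "\<And>b. b < n \<Longrightarrow> V b \<in> H"
  shows "centered_gaussian_law (gram n V n V - gram n V k U * the (mat_inverse (gram k U k U)) * transpose_mat (gram n V k U)) =
    distr M (\<Pi>\<^sub>M b\<in>{..<n}. borel) (\<lambda>w. \<lambda>b\<in>{..<n}. residual k (comb k m U) (V b) w)"
proof -
  have UH: "\<And>a. a < k \<Longrightarrow> U a \<in> H" and on: "orthonormal k (comb k m U)" using fr by (auto simp: frame_def)
  define e where "e = comb k m U"
  define R where "R b = residual k e (V b)" for b
  have eH: "e j \<in> H" for j unfolding e_def by (rule comb_mem[OF UH])
  have RH: "R b \<in> H" if "b < n" for b unfolding R_def e_def by (rule residual_mem[OF on V[OF that]])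
  define K where "K b a = (\<Sum>j<k. inner_rv M (V b) (e j) * m j a)" for b a
  have Veq: "V b = (\<lambda>w. (\<Sum>a<k. K b a * U a w) + R b w)" for b
  proof
    fix w
    show "V b w = (\<Sum>a<k. K b a * U a w) + R b w"
      by (simp add: R_def e_def residual_frame_expand K_def)
  qed
  have RU: "inner_rv M (R b) (U a) = 0" if "b < n" "a < k" for a b
  proof -
    \<comment> \<open>Orthogonality to the frame passes to \<open>U\<close>, whose members are
      combinations of the frame.\<close>
    obtain L where L: "\<And>i. i < k \<Longrightarrow> U i = comb k L e i" unfolding e_def using frame_inverse[OF fr] by metis
    have "inner_rv M (R b) (U a) = inner_rv M (R b) (\<lambda>w. \<Sum>j<k. L a j * e j w)"
      using L[OF that(2)] by (simp add: comb_def[abs_def] lin_def)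
    also have "\<dots> = (\<Sum>j<k. L a j * inner_rv M (R b) (e j))" by (rule inner_sum_right) (use RH that eH in auto)
    also have "\<dots> = 0" using residual_orthogonal[OF on V[OF that(1)]] by (simp add: R_def e_def)
    finally show ?thesis .
  qed
  define S where "S b w = (\<Sum>a<k. K b a * U a w)" for b w
  have SH: "S b \<in> H" for b unfolding S_def[abs_def] by (rule sum_mem) (simp add: UH)
  have SR: "inner_rv M (S b) (R b') = 0" if "b' < n" for b b'
  proof -
    have "inner_rv M (S b) (R b') = (\<Sum>a<k. K b a * inner_rv M (U a) (R b'))"
      unfolding S_def[abs_def] by (rule inner_sum_left) (use UH RH that in auto)
    also have "\<dots> = 0" using RU[OF that] by (simp add: inner_rv_commute[of M _ "R b'"])
    finally show ?thesis .
  qed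
  have VUe: "inner_rv M (V b) Z = inner_rv M (S b) Z + inner_rv M (R b) Z" if "b < n" "Z \<in> H" for b Z
    using inner_lincomb[OF SH[of b] RH[OF that(1)] that(2), of 1 1] Veq[of b] by (simp add: S_def)
  have SU: "inner_rv M (S b) (U a) = (\<Sum>l<k. K b l * inner_rv M (U l) (U a))" if "a < k" for a b
    unfolding S_def[abs_def] by (rule inner_sum_left) (use UH that in auto)
  have SS: "inner_rv M (S b) (S b') = (\<Sum>l<k. (\<Sum>p<k. K b p * inner_rv M (U p) (U l)) * K b' l)" for b b'
  proof -
    have "inner_rv M (S b) (S b') = (\<Sum>l<k. K b' l * inner_rv M (S b) (U l))"
      by (subst (2) S_def[abs_def], rule inner_sum_right) (use UH SH in auto)
    then show ?thesis using SU by (simp add: mult.commute)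
  qed
  define Km where "Km = Matrix.mat n k (\<lambda>(b, a). K b a)"
  define G where "G = gram k U k U"
  have cK: "Km \<in> carrier_mat n k" and cG: "G \<in> carrier_mat k k" by (auto simp: Km_def G_def gram_def)
  have cKt: "transpose_mat Km \<in> carrier_mat k n" using cK by simp
  have Gt: "transpose_mat G = G"
    unfolding G_def gram_def transpose_mat_mat by (rule eq_matI) (auto simp: inner_rv_commute)
  have B: "gram n V k U = Km * G"
    unfolding gram_def Km_def G_def mat_mult_mat by (rule eq_matI) (auto simp: VUe UH SU RU)
  have C: "gram n V n V = Km * G * transpose_mat Km + gram n R n R"
  proof (rule eq_matI)
    fix b b' assume "b < dim_row (Km * G * transpose_mat Km + gram n R n R)" "b' < dim_col (Km * G * transpose_mat Km + gram n R n R)"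
    then have b: "b < n" "b' < n" by (auto simp: gram_def)
    have "inner_rv M (V b) (V b') = inner_rv M (S b) (V b') + inner_rv M (R b) (V b')"
      by (rule VUe[OF b(1) V[OF b(2)]])
    also have "inner_rv M (S b) (V b') = inner_rv M (S b) (S b')"
    proof -
      have "inner_rv M (S b) (V b') = inner_rv M (V b') (S b)" by (rule inner_rv_commute)
      also have "\<dots> = inner_rv M (S b') (S b) + inner_rv M (R b') (S b)" by (rule VUe[OF b(2) SH])
      also have "inner_rv M (S b') (S b) = inner_rv M (S b) (S b')" by (rule inner_rv_commute)
      also have "inner_rv M (R b') (S b) = inner_rv M (S b) (R b')" by (rule inner_rv_commute)
      finally show ?thesis using SR[OF b(2), of b] by simp
    qed
    also have "inner_rv M (R b) (V b') = inner_rv M (R b) (R b')"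
    proof -
      have "inner_rv M (R b) (V b') = inner_rv M (V b') (R b)" by (rule inner_rv_commute)
      also have "\<dots> = inner_rv M (R b') (R b)" using VUe[OF b(2) RH[OF b(1)]] SR[OF b(1), of b'] by simp
      also have "\<dots> = inner_rv M (R b) (R b')" by (rule inner_rv_commute)
      finally show ?thesis .
    qed
    finally show "gram n V n V $$ (b, b') = (Km * G * transpose_mat Km + gram n R n R) $$ (b, b')"
      using b by (simp add: gram_def Km_def G_def transpose_mat_mat mat_mult_mat SS del: index_mult_mat)
  qed (auto simp: gram_def Km_def)
  \<comment> \<open>This makes \<open>mat_inverse\<close> return a value; otherwise
    \<open>the\<close> would be unspecified.\<close>
  have "Determinant.det G \<noteq> 0" using det_gram_frame[OF fr] by (auto simp: G_def)
  then have "G \<in> Units (ring_mat TYPE(real) k ())" by (rule det_non_zero_imp_unit[OF cG])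
  then obtain Gi where Gi: "mat_inverse G = Some Gi" using mat_inverse(1)[OF cG, where b="()"] by (cases "mat_inverse G") auto
  then have i: "G * Gi = 1\<^sub>m k" "Gi \<in> carrier_mat k k" using mat_inverse(2)[OF cG Gi] by auto
  have "gram n V k U * the (mat_inverse (gram k U k U)) * transpose_mat (gram n V k U) = (Km * G) * Gi * (G * transpose_mat Km)"
    unfolding B G_def[symmetric] Gi using transpose_mult[OF cK cG] by (simp add: Gt)
  also have "(Km * G) * Gi = Km" using assoc_mult_mat[OF cK cG i(2)] i(1) cK by simp
  also have "Km * (G * transpose_mat Km) = Km * G * transpose_mat Km" by (rule assoc_mult_mat[OF cK cG cKt, symmetric])
  finally have BB: "gram n V k U * the (mat_inverse (gram k U k U)) * transpose_mat (gram n V k U) = Km * G * transpose_mat Km" .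
  have S: "gram n V n V - gram n V k U * the (mat_inverse (gram k U k U)) * transpose_mat (gram n V k U) = gram n R n R"
    unfolding BB C using cK cG by (intro eq_matI) (auto simp: gram_def)
  define N where "N = distr M (\<Pi>\<^sub>M b\<in>{..<n}. borel) (\<lambda>w. \<lambda>b\<in>{..<n}. R b w)"
  have rm: "(\<lambda>w. \<lambda>b\<in>{..<n}. R b w) \<in> M \<rightarrow>\<^sub>M (\<Pi>\<^sub>M b\<in>{..<n}. borel)"
    by (rule measurable_restrict) (simp add: meas RH)
  have coord: "(\<lambda>v. v b) \<in> borel_measurable (\<Pi>\<^sub>M b\<in>{..<n}. (borel :: real measure))" if "b < n" for b
  proof -
    from that have "b \<in> {..<n}" by simp
    then show ?thesis by measurable
  qed
  have coordN: "(\<lambda>v. v b) \<in> borel_measurable N" if "b < n" for b using coord[OF that] by (simp add: N_def)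
  have "centered_gaussian_law (gram n R n R) = N"
  proof (rule centered_gaussian_law_eqI)
    show "gram n R n R \<in> carrier_mat n n" by (simp add: gram_def)
    show "sets N = sets (\<Pi>\<^sub>M b\<in>{..<n}. borel)" by (simp add: N_def)
    show "prob_space N" unfolding N_def by (rule prob_space_distr[OF rm])
    show mean: "rv_mean N (\<lambda>v. v b) = 0" if "b < n" for b
    proof -
      have "rv_mean N (\<lambda>v. v b) = (\<integral>v. v b \<partial>N)" by (rule rv_mean_eq[OF coordN[OF that]])
      also have "\<dots> = (\<integral>w. R b w \<partial>M)"
        unfolding N_def using that by (subst integral_distr[OF rm coord]) auto
      finally have "rv_mean N (\<lambda>v. v b) = (\<integral>w. R b w \<partial>M)" .
      then show ?thesis using centered_gaussian_mean[OF gauss[OF RH[OF that]]] by simp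
    qed
    show "gaussian_vector N {..<n} (\<lambda>a v. v a)"
      unfolding gaussian_vector_def
    proof (intro conjI allI ballI)
      show "finite {..<n}" by simp
      show "(\<lambda>v. v a) \<in> borel_measurable N" if "a \<in> {..<n}" for a using that coordN by simp
      fix c :: "nat \<Rightarrow> real"
      have sH: "(\<lambda>w. \<Sum>j<n. c j * R j w) \<in> H" by (rule sum_mem) (simp add: RH)
      have "distr N borel (\<lambda>v. \<Sum>j<n. c j * v j) = distr M borel ((\<lambda>v. \<Sum>j<n. c j * v j) \<circ> (\<lambda>w. \<lambda>b\<in>{..<n}. R b w))"
        unfolding N_def by (rule distr_distr) (auto intro!: rm borel_measurable_sum borel_measurable_times coord)
      also have "(\<lambda>v. \<Sum>j<n. c j * v j) \<circ> (\<lambda>w. \<lambda>b\<in>{..<n}. R b w) = (\<lambda>w. \<Sum>j<n. c j * R j w)"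
        by (auto simp: comp_def)
      finally show "\<exists>m s. 0 \<le> s \<and> distr N borel (\<lambda>v. \<Sum>j<n. c j * v j) = normal_law m s"
        using gauss[OF sH] by (auto simp: centered_gaussian_def)
    qed
    show "var_mat N (map (\<lambda>a v. v a) [0..<n]) = gram n R n R"
    proof (rule eq_matI)
      fix a b assume "a < dim_row (gram n R n R)" "b < dim_col (gram n R n R)"
      then have ab: "a < n" "b < n" by (auto simp: gram_def)
      have pm: "(\<lambda>v. v a * v b) \<in> borel_measurable (\<Pi>\<^sub>M b\<in>{..<n}. (borel :: real measure))"
        using coord[OF ab(1)] coord[OF ab(2)] by (rule borel_measurable_times)
      then have "rv_cov N (\<lambda>v. v a) (\<lambda>v. v b) = (\<integral>v. v a * v b \<partial>N)"
        unfolding rv_cov_def mean[OF ab(1)] mean[OF ab(2)] diff_0_right by (intro rv_mean_eq) (simp add: N_def)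
      also have "\<dots> = inner_rv M (R a) (R b)"
        unfolding N_def inner_rv_def using ab by (subst integral_distr[OF rm pm]) auto
      finally show "var_mat N (map (\<lambda>a v. v a) [0..<n]) $$ (a, b) = gram n R n R $$ (a, b)"
        using ab by (simp add: var_mat_def cov_mat_def gram_def)
    qed (auto simp: var_mat_def cov_mat_def gram_def)
  qed
  then show ?thesis unfolding S by (simp add: N_def R_def e_def)
qed

end

section \<open>Enumeration of the blocks\<close>

definition pairs :: "'i set list \<Rightarrow> ('i set \<Rightarrow> nat) \<Rightarrow> ('i set \<times> nat) list" where
  "pairs Bs d = concat (map (\<lambda>I. map (Pair I) [0..<d I]) Bs)"

lemma jet_eq_pairs: "jet f y d = map (\<lambda>(I, i). process_deriv f i (block_value y I)) (pairs (block_list y) d)"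
  by (simp add: jet_def pairs_def map_concat comp_def)

lemma set_pairs: "set (pairs Bs d) = (SIGMA I:set Bs. {..<d I})"
  by (auto simp: pairs_def)

lemma pairs_append: "pairs (Bs @ Cs) d = pairs Bs d @ pairs Cs d"
  by (simp add: pairs_def)

lemma pairs_single: "pairs [I] d = map (Pair I) [0..<d I]"
  by (simp add: pairs_def)

lemma distinct_pairs: "distinct Bs \<Longrightarrow> distinct (pairs Bs d)"
proof (induction Bs rule: rev_induct)
  case (snoc I Bs)
  then show ?case
    by (auto simp: pairs_append pairs_single distinct_map inj_on_def set_pairs)
qed (simp add: pairs_def)

text \<open>The pairs of one block are consecutive and ordered by their second component, so that
  component counts the earlier entries of the block. This matches the derivative orders used in
  \<open>confluence\<close>.\<close>

lemma pairs_index: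
  assumes "distinct Bs" "a < length (pairs Bs d)"
  shows "card {l. l < a \<and> fst (pairs Bs d ! l) = fst (pairs Bs d ! a)} = snd (pairs Bs d ! a)"
  using assms
proof (induction Bs rule: rev_induct)
  case (snoc I Bs)
  define n where "n = length (pairs Bs d)"
  show ?case
  proof (cases "a < n")
    case True
    then have "{l. l < a \<and> fst (pairs (Bs @ [I]) d ! l) = fst (pairs (Bs @ [I]) d ! a)} =
      {l. l < a \<and> fst (pairs Bs d ! l) = fst (pairs Bs d ! a)}"
      by (auto simp: pairs_append nth_append n_def)
    then show ?thesis using snoc True by (simp add: pairs_append nth_append n_def)
  next
    case False
    have a: "a - n < d I" using snoc.prems False by (auto simp: pairs_append pairs_single n_def)
    have "fst (pairs Bs d ! l) \<noteq> I" if "l < n" for l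
    proof -
      have "pairs Bs d ! l \<in> set (pairs Bs d)" using that by (simp add: n_def)
      then have "fst (pairs Bs d ! l) \<in> set Bs" by (auto simp: set_pairs)
      then show ?thesis using snoc.prems(1) by auto
    qed
    then have "{l. l < a \<and> fst (pairs (Bs @ [I]) d ! l) = fst (pairs (Bs @ [I]) d ! a)} = {n..<a}"
      using False a by (auto simp: pairs_append pairs_single nth_append n_def[symmetric] not_less)
    then show ?thesis using False a by (simp add: pairs_append pairs_single nth_append n_def[symmetric])
  qed
qed (simp add: pairs_def)

lemma prod_pairs:
  assumes "distinct Bs"
  shows "(\<Prod>a<length (pairs Bs d). h (pairs Bs d ! a)) = (\<Prod>I\<in>set Bs. \<Prod>i<d I. h (I, i))"
proof -
  have "(\<Prod>a<length (pairs Bs d). h (pairs Bs d ! a)) = (\<Prod>p\<in>set (pairs Bs d). h p)"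
    by (rule prod.reindex_bij_betw[OF bij_betw_nth[OF distinct_pairs[OF assms] refl refl]])
  also have "\<dots> = (\<Prod>I\<in>set Bs. \<Prod>i<d I. h (I, i))"
    unfolding set_pairs by (subst prod.Sigma) (auto simp: case_prod_beta')
  finally show ?thesis .
qed

context
  fixes y :: "real ^ 'n :: {finite, linorder}"
begin

definition block_pairs :: "('n set \<times> nat) list" where
  "block_pairs = pairs (block_list y) card"

text \<open>Positions inside a block count from 0 in the order of the index type; the enumeration
  increases within each block but in general not across blocks.\<close>

definition enum_block :: "nat \<Rightarrow> 'n" where
  "enum_block a = sorted_list_of_set (fst (block_pairs ! a)) ! snd (block_pairs ! a)"

lemma block_iff: "I \<in> blocks y \<Longrightarrow> i \<in> I \<Longrightarrow> I = {j. y $ j = y $ i}"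
  unfolding blocks_eq by auto

lemma bij_betw_enum_pairs:
  "bij_betw (\<lambda>(I, i). sorted_list_of_set I ! i) (set block_pairs) (UNIV :: 'n set)"
  unfolding bij_betw_def
proof
  have mem: "sorted_list_of_set I ! i \<in> I" if "i < card I" for I :: "'n set" and i
    using nth_mem[of i "sorted_list_of_set I"] that by simp
  show "inj_on (\<lambda>(I, i). sorted_list_of_set I ! i) (set block_pairs)"
  proof (rule inj_onI, clarify)
    fix I i J j assume I: "(I, i) \<in> set block_pairs" "(J, j) \<in> set block_pairs"
      and eq: "sorted_list_of_set I ! i = sorted_list_of_set J ! j"
    have IJ: "I \<in> blocks y" "J \<in> blocks y" "i < card I" "j < card J"
      using I by (auto simp: block_pairs_def set_pairs)
    have "sorted_list_of_set I ! i \<in> I" "sorted_list_of_set I ! i \<in> J" using mem[OF IJ(3)] mem[OF IJ(4)] eq by auto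
    then have e: "I = J" using block_iff IJ by metis
    moreover have "i = j" using eq e IJ by (simp add: nth_eq_iff_index_eq)
    ultimately show "I = J \<and> i = j" by simp
  qed
  show "(\<lambda>(I, i). sorted_list_of_set I ! i) ` set block_pairs = UNIV"
  proof safe
    fix v :: 'n
    define I where "I = {j. y $ j = y $ v}"
    have "v \<in> set (sorted_list_of_set I)" by (simp add: I_def)
    then obtain i where i: "i < length (sorted_list_of_set I)" "sorted_list_of_set I ! i = v" by (metis in_set_conv_nth)
    have "I \<in> blocks y" by (auto simp: I_def blocks_eq)
    then have "(I, i) \<in> set block_pairs" using i by (simp add: block_pairs_def set_pairs)
    then show "v \<in> (\<lambda>(I, i). sorted_list_of_set I ! i) ` set block_pairs" using i by (auto intro!: image_eqI[of _ _ "(I, i)"])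
  qed simp
qed

lemma distinct_block_pairs: "distinct block_pairs"
  unfolding block_pairs_def by (rule distinct_pairs) simp

lemma length_block_pairs: "length block_pairs = CARD('n)"
  using bij_betw_same_card[OF bij_betw_enum_pairs] distinct_card[OF distinct_block_pairs] by simp

lemma bij_betw_enum_block: "bij_betw enum_block {..<CARD('n)} UNIV"
proof -
  have "bij_betw ((\<lambda>(I, i). sorted_list_of_set I ! i) \<circ> (!) block_pairs) {..<CARD('n)} UNIV"
    by (rule bij_betw_trans[OF bij_betw_nth[OF distinct_block_pairs _ refl] bij_betw_enum_pairs]) (simp add: length_block_pairs)
  moreover have "(\<lambda>(I, i). sorted_list_of_set I ! i) \<circ> (!) block_pairs = enum_block"
    by (auto simp: enum_block_def case_prod_beta')
  ultimately show ?thesis by simp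
qed

lemma block_pairs_nth:
  assumes "a < CARD('n)"
  shows "fst (block_pairs ! a) \<in> blocks y" "snd (block_pairs ! a) < card (fst (block_pairs ! a))"
    "enum_block a \<in> fst (block_pairs ! a)" "fst (block_pairs ! a) = {j. y $ j = y $ enum_block a}"
    "block_value y (fst (block_pairs ! a)) = y $ enum_block a"
proof -
  have "block_pairs ! a \<in> set block_pairs" using assms by (simp add: length_block_pairs)
  then show 1: "fst (block_pairs ! a) \<in> blocks y" and 2: "snd (block_pairs ! a) < card (fst (block_pairs ! a))"
    by (auto simp: block_pairs_def set_pairs)
  show 3: "enum_block a \<in> fst (block_pairs ! a)"
    unfolding enum_block_def using nth_mem[of "snd (block_pairs ! a)" "sorted_list_of_set (fst (block_pairs ! a))"] 2 by simp
  show 4: "fst (block_pairs ! a) = {j. y $ j = y $ enum_block a}" by (rule block_iff[OF 1 3])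
  show "block_value y (fst (block_pairs ! a)) = y $ enum_block a"
    unfolding 4 by (rule block_value_eq)
qed

lemma same_block_iff:
  assumes "a < CARD('n)" "b < CARD('n)"
  shows "y $ enum_block a = y $ enum_block b \<longleftrightarrow> fst (block_pairs ! a) = fst (block_pairs ! b)"
  using block_pairs_nth(3,4)[OF assms(1)] block_pairs_nth(3,4)[OF assms(2)] by auto

text \<open>Together with \<open>enum_block_size\<close> this identifies \<open>pos\<close> and
  \<open>bsize\<close> of the locale \<open>confluence\<close> with the order \<open>i\<close> and
  the size \<open>|I|\<close>.\<close>

lemma enum_block_index:
  assumes a: "a < CARD('n)"
  shows "card {l. l < a \<and> y $ enum_block l = y $ enum_block a} = snd (block_pairs ! a)"
proof -
  have "{l. l < a \<and> y $ enum_block l = y $ enum_block a} = {l. l < a \<and> fst (block_pairs ! l) = fst (block_pairs ! a)}"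
    using same_block_iff a by auto
  then show ?thesis
    using pairs_index[of "block_list y" a card] a length_block_pairs by (simp add: block_pairs_def)
qed

lemma enum_block_size:
  assumes a: "a < CARD('n)"
  shows "card {l. l < CARD('n) \<and> y $ enum_block l = y $ enum_block a} = card (fst (block_pairs ! a))"
proof (rule bij_betw_same_card[of enum_block])
  show "bij_betw enum_block {l. l < CARD('n) \<and> y $ enum_block l = y $ enum_block a} (fst (block_pairs ! a))"
    unfolding bij_betw_def block_pairs_nth(4)[OF a]
  proof
    show "inj_on enum_block {l. l < CARD('n) \<and> y $ enum_block l = y $ enum_block a}"
      using bij_betw_enum_block by (auto simp: bij_betw_def intro: inj_on_subset)
    show "enum_block ` {l. l < CARD('n) \<and> y $ enum_block l = y $ enum_block a} = {j. y $ j = y $ enum_block a}"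
    proof safe
      fix j assume j: "y $ j = y $ enum_block a"
      have "j \<in> enum_block ` {..<CARD('n)}" using bij_betw_enum_block by (simp add: bij_betw_def)
      then obtain l where "l < CARD('n)" "j = enum_block l" by auto
      then show "j \<in> enum_block ` {l. l < CARD('n) \<and> y $ enum_block l = y $ enum_block a}" using j by auto
    qed
  qed
qed

lemma enum_block_mono:
  assumes a: "a < CARD('n)" and l: "l < a" and e: "y $ enum_block l = y $ enum_block a"
  shows "enum_block l < enum_block a"
proof -
  have lk: "l < CARD('n)" using a l by simp
  have f: "fst (block_pairs ! l) = fst (block_pairs ! a)" using same_block_iff[OF lk a] e by simp
  have "card {j. j < l \<and> y $ enum_block j = y $ enum_block l} < card {j. j < a \<and> y $ enum_block j = y $ enum_block a}"
    by (rule psubset_card_mono) (use l e in auto)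
  then have s: "snd (block_pairs ! l) < snd (block_pairs ! a)"
    by (simp add: enum_block_index[OF lk] enum_block_index[OF a])
  have "sorted_wrt (<) (sorted_list_of_set (fst (block_pairs ! a)))" by simp
  from sorted_wrt_nth_less[OF this s] show ?thesis
    using block_pairs_nth(2)[OF a] by (simp add: enum_block_def f)
qed

text \<open>The enumeration increases on blocks, so the pairs \<open>i < j\<close> of a block
  correspond to positions \<open>l < a\<close> with equal \<open>y\<close>-values, where
  \<open>i\<close> sits at \<open>l\<close> and \<open>j\<close> at \<open>a\<close>.\<close>

lemma prod_block_differences:
  fixes x :: "(real, 'n) Finite_Cartesian_Product.vec"
  shows "(\<Prod>I\<in>blocks y. \<Prod>(i, j)\<in>{(i, j). i \<in> I \<and> j \<in> I \<and> i < j}. 1 / \<bar>x $ i - x $ j\<bar>) =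
    1 / (\<Prod>a<CARD('n). \<Prod>l\<in>{l. l < a \<and> y $ enum_block l = y $ enum_block a}. \<bar>x $ enum_block a - x $ enum_block l\<bar>)"
proof -
  define g where "g p = 1 / \<bar>x $ fst p - x $ snd p\<bar>" for p :: "'n \<times> 'n"
  define P where "P = {(i, j). y $ i = y $ j \<and> i < j}"
  define Q where "Q = (SIGMA a:{..<CARD('n)}. {l. l < a \<and> y $ enum_block l = y $ enum_block a})"
  have P: "P = (\<Union>I\<in>blocks y. {(i, j). i \<in> I \<and> j \<in> I \<and> i < j})"
  proof safe
    fix i j assume "(i, j) \<in> P"
    then show "(i, j) \<in> (\<Union>I\<in>blocks y. {(i, j). i \<in> I \<and> j \<in> I \<and> i < j})"
      by (auto simp: P_def blocks_eq)
  next
    fix I i j assume "I \<in> blocks y" "i \<in> I" "j \<in> I" "i < j"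
    then show "(i, j) \<in> P" using block_iff[of I j] by (auto simp: P_def)
  qed
  have "(\<Prod>I\<in>blocks y. \<Prod>(i, j)\<in>{(i, j). i \<in> I \<and> j \<in> I \<and> i < j}. 1 / \<bar>x $ i - x $ j\<bar>) =
      (\<Prod>I\<in>blocks y. \<Prod>p\<in>{(i, j). i \<in> I \<and> j \<in> I \<and> i < j}. g p)"
    by (simp add: g_def case_prod_beta')
  also have "\<dots> = (\<Prod>p\<in>P. g p)"
    unfolding P
  proof (rule prod.UNION_disjoint[symmetric])
    show "\<forall>I\<in>blocks y. \<forall>J\<in>blocks y. I \<noteq> J \<longrightarrow>
        {(i, j). i \<in> I \<and> j \<in> I \<and> i < j} \<inter> {(i, j). i \<in> J \<and> j \<in> J \<and> i < j} = {}"
    proof (intro ballI impI)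
      fix I J assume "I \<in> blocks y" "J \<in> blocks y" "I \<noteq> J"
      then have "I \<inter> J = {}" using block_iff[of I] block_iff[of J] by blast
      then show "{(i, j). i \<in> I \<and> j \<in> I \<and> i < j} \<inter> {(i, j). i \<in> J \<and> j \<in> J \<and> i < j} = {}" by auto
    qed
  qed auto
  also have "\<dots> = (\<Prod>q\<in>Q. g (enum_block (snd q), enum_block (fst q)))"
  proof (rule prod.reindex_bij_betw[symmetric, of "\<lambda>q. (enum_block (snd q), enum_block (fst q))"])
    have inj: "inj_on enum_block {..<CARD('n)}" and sur: "enum_block ` {..<CARD('n)} = UNIV"
      using bij_betw_enum_block by (auto simp: bij_betw_def)
    show "bij_betw (\<lambda>q. (enum_block (snd q), enum_block (fst q))) Q P"
      unfolding bij_betw_def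
    proof
      show "inj_on (\<lambda>q. (enum_block (snd q), enum_block (fst q))) Q"
        using inj by (auto simp: inj_on_def Q_def)
      show "(\<lambda>q. (enum_block (snd q), enum_block (fst q))) ` Q = P"
      proof safe
        fix a l assume "(a, l) \<in> Q"
        then show "(enum_block (snd (a, l)), enum_block (fst (a, l))) \<in> P"
          using enum_block_mono by (auto simp: Q_def P_def)
      next
        fix i j assume ij: "(i, j) \<in> P"
        have "i \<in> enum_block ` {..<CARD('n)}" "j \<in> enum_block ` {..<CARD('n)}" using sur by auto
        then obtain l a where la: "l < CARD('n)" "a < CARD('n)" "i = enum_block l" "j = enum_block a" by auto
        have "l < a"
        proof (rule ccontr)
          assume "\<not> l < a"
          moreover have "l \<noteq> a" using ij la by (auto simp: P_def)
          ultimately have "enum_block a < enum_block l"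
            using enum_block_mono[of l a] ij la by (auto simp: P_def)
          then show False using ij la by (auto simp: P_def)
        qed
        then have "(a, l) \<in> Q" using la ij by (auto simp: Q_def P_def)
        then show "(i, j) \<in> (\<lambda>q. (enum_block (snd q), enum_block (fst q))) ` Q"
          using la by (intro image_eqI[of _ _ "(a, l)"]) auto
      qed
    qed
  qed
  also have "\<dots> = (\<Prod>a<CARD('n). \<Prod>l\<in>{l. l < a \<and> y $ enum_block l = y $ enum_block a}. 1 / \<bar>x $ enum_block a - x $ enum_block l\<bar>)"
    unfolding Q_def by (subst prod.Sigma) (auto simp: g_def case_prod_beta' abs_minus_commute intro!: prod.cong)
  also have "\<dots> = 1 / (\<Prod>a<CARD('n). \<Prod>l\<in>{l. l < a \<and> y $ enum_block l = y $ enum_block a}. \<bar>x $ enum_block a - x $ enum_block l\<bar>)"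
    by (simp add: prod_dividef)
  finally show ?thesis .
qed

end

section \<open>A version of the process with smooth paths\<close>

text \<open>\<open>X\<close> may fail to be measurable for \<open>M\<close>, as derivatives of paths
  do on the exceptional set. Its preimages differ from those of \<open>X'\<close> only within a null
  set, hence it is measurable for the completion.\<close>

lemma rv_mean_AE:
  assumes X' [measurable]: "X' \<in> borel_measurable M" and ae: "AE w in M. X w = X' w"
  shows "rv_mean M X = (\<integral>w. X' w \<partial>M)"
proof -
  obtain N where N: "N \<in> null_sets M" "{w \<in> space M. X w \<noteq> X' w} \<subseteq> N"
    using ae by (auto simp: eventually_ae_filter)
  have X: "X \<in> borel_measurable (completion M)"
  proof (rule measurableI)
    fix A :: "real set" assume A: "A \<in> sets borel"
    have e: "X -` A \<inter> space M = (X' -` A \<inter> space M - N) \<union> (X -` A \<inter> space M \<inter> N)"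
      using N(2) by auto
    have 1: "X' -` A \<inter> space M - N \<in> sets (completion M)"
      using measurable_sets[OF X' A] N(1) by auto
    have 2: "X -` A \<inter> space M \<inter> N \<in> sets (completion M)"
      by (rule sets_completionI_sub[OF N(1)]) auto
    show "X -` A \<inter> space (completion M) \<in> sets (completion M)"
      by (subst space_completion, subst e) (rule sets.Un[OF 1 2])
  qed simp
  have "rv_mean M X = (\<integral>w. X' w \<partial>completion M)"
    unfolding rv_mean_def
    by (rule integral_cong_AE[OF X measurable_completion[OF X'] AE_completion[OF ae]])
  then show ?thesis using integral_completion[OF X'] by simp
qed

lemma (in gaussian_space) cov_mat_gram:
  assumes "\<And>a. a < length Xs \<Longrightarrow> X a \<in> H" "\<And>a. a < length Xs \<Longrightarrow> AE w in M. (Xs ! a) w = X a w"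
    and "\<And>a. a < length Ys \<Longrightarrow> Y a \<in> H" "\<And>a. a < length Ys \<Longrightarrow> AE w in M. (Ys ! a) w = Y a w"
  shows "cov_mat M Xs Ys = gram (length Xs) X (length Ys) Y"
proof (rule eq_matI)
  fix a b assume "a < dim_row (gram (length Xs) X (length Ys) Y)" "b < dim_col (gram (length Xs) X (length Ys) Y)"
  then have ab: "a < length Xs" "b < length Ys" by (auto simp: gram_def)
  have m: "rv_mean M (Xs ! a) = 0" "rv_mean M (Ys ! b) = 0"
    using rv_mean_AE[OF meas[OF assms(1)[OF ab(1)]] assms(2)[OF ab(1)]] centered_gaussian_mean[OF gauss[OF assms(1)[OF ab(1)]]]
      rv_mean_AE[OF meas[OF assms(3)[OF ab(2)]] assms(4)[OF ab(2)]] centered_gaussian_mean[OF gauss[OF assms(3)[OF ab(2)]]]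
    by simp_all
  have "AE w in M. (Xs ! a) w * (Ys ! b) w = X a w * Y b w"
    using assms(2)[OF ab(1)] assms(4)[OF ab(2)] by eventually_elim simp
  then have "rv_cov M (Xs ! a) (Ys ! b) = inner_rv M (X a) (Y b)"
    unfolding rv_cov_def m diff_0_right inner_rv_def
    by (rule rv_mean_AE[rotated]) (use meas[OF assms(1)[OF ab(1)]] meas[OF assms(3)[OF ab(2)]] in measurable)
  then show "cov_mat M Xs Ys $$ (a, b) = gram (length Xs) X (length Ys) Y $$ (a, b)"
    using ab by (simp add: cov_mat_def gram_def)
qed (auto simp: cov_mat_def gram_def)

lemma (in gaussian_space) AE_nonzero:
  assumes X: "X \<in> H" and v: "inner_rv M X X \<noteq> 0"
  shows "AE w in M. X w \<noteq> 0"
proof -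
  define c where "c = 1 / sqrt (inner_rv M X X)"
  have pos: "inner_rv M X X > 0" using v inner_self_nonneg[of X] by linarith
  have Z: "(\<lambda>w. c * X w) \<in> H" by (rule scale_mem[OF X])
  have "inner_rv M (\<lambda>w. c * X w) (\<lambda>w. c * X w) = c * inner_rv M X (\<lambda>w. c * X w)" by (rule inner_scale[OF X Z])
  also have "inner_rv M X (\<lambda>w. c * X w) = c * inner_rv M X X"
    by (subst inner_rv_commute) (rule inner_scale[OF X X])
  finally have "inner_rv M (\<lambda>w. c * X w) (\<lambda>w. c * X w) = 1"
    using pos by (simp add: c_def field_simps)
  from unit_gaussian_AE_nonzero[OF gauss[OF Z] this] show ?thesis
    by eventually_elim auto
qed

section \<open>Paths of class C^k and the smooth version\<close>

lemma funpow_deriv_zero: "(deriv ^^ i) (\<lambda>_. 0 :: real) = (\<lambda>_. 0)"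
  by (induction i) auto

lemma class_C_zero: "class_C k (\<lambda>_. 0)"
  by (simp add: class_C_def funpow_deriv_zero)

lemma class_C_deriv:
  assumes "class_C k g" "i < k"
  shows "((deriv ^^ i) g has_real_derivative (deriv ^^ Suc i) g t) (at t)"
  using assms field_differentiable_derivI[of "(deriv ^^ i) g" t] by (simp add: class_C_def)

lemma class_C_continuous:
  assumes "class_C k g" "i \<le> k"
  shows "continuous_on UNIV ((deriv ^^ i) g)"
proof (cases "i = k")
  case False
  then have "i < k" using assms by simp
  then show ?thesis using class_C_deriv[OF assms(1)] by (meson DERIV_continuous_on)
qed (use assms in \<open>simp add: class_C_def\<close>)

text \<open>The coordinate at 0 of the path shifted by \<open>t\<close> is the value at
  \<open>t\<close>, so the normalization at 0 carries over to every time.\<close>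

lemma stationary_second_moment:
  assumes "prob_space M" "gaussian_process M f" "stationary_process M f" "correlation M f 0 = 1"
  shows "inner_rv M (f t) (f t) = 1"
proof -
  have m: "f s \<in> borel_measurable M" for s
    using assms(2) by (auto simp: gaussian_process_def gaussian_vector_def dest: spec[of _ "{s}"])
  have pm: "(\<lambda>w s. f (s + h) w) \<in> M \<rightarrow>\<^sub>M (\<Pi>\<^sub>M t\<in>UNIV. (borel :: real measure))" for h
    by (rule measurable_PiM_single') (auto simp: m)
  have c: "(\<lambda>p. p 0 * p 0) \<in> borel_measurable (\<Pi>\<^sub>M t\<in>(UNIV :: real set). (borel :: real measure))" by measurable
  have "inner_rv M (f t) (f t) = (\<integral>p. p 0 * p 0 \<partial>distr M (\<Pi>\<^sub>M t\<in>UNIV. borel) (\<lambda>w s. f (s + t) w))"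
    by (subst integral_distr[OF pm c]) (simp add: inner_rv_def)
  also have "distr M (\<Pi>\<^sub>M t\<in>UNIV. borel) (\<lambda>w s. f (s + t) w) = distr M (\<Pi>\<^sub>M t\<in>UNIV. borel) (\<lambda>w s. f s w)"
    using assms(3) unfolding stationary_process_def by blast
  also have "(\<integral>p. p 0 * p 0 \<partial>distr M (\<Pi>\<^sub>M t\<in>UNIV. borel) (\<lambda>w s. f s w)) = inner_rv M (f 0) (f 0)"
    using pm[of 0] by (subst integral_distr[OF _ c]) (simp_all add: inner_rv_def)
  finally show ?thesis using assms(4) by (simp add: inner_rv_def correlation_def)
qed

text \<open>Setting the process to 0 on the exceptional null set makes every path smooth and changes
  no finite-dimensional law. Derivatives are then pointwise limits of difference quotients with
  increments \<open>1 / (n + 1)\<close>, hence stay Gaussian.\<close>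

lemma smooth_version:
  assumes P: "prob_space M" and g: "gaussian_process M f" and cp: "centered_process M f"
    and st: "stationary_process M f" and cl: "process_of_class M k f" and nm: "normalized_process M f"
    and k: "k > 0"
  obtains N f0 H where "N \<in> null_sets M" "\<And>t w. w \<in> space M \<Longrightarrow> w \<notin> N \<Longrightarrow> f0 t w = f t w"
    "smooth_process M H (process_deriv f0) k"
proof -
  interpret prob_space M by (rule P)
  obtain N where N: "N \<in> null_sets M" "{w \<in> space M. \<not> class_C k (\<lambda>t. f t w)} \<subseteq> N"
    using cl by (auto simp: process_of_class_def eventually_ae_filter)
  define f0 where "f0 t w = (if w \<in> space M - N then f t w else 0)" for t w
  have eq: "f0 t w = f t w" if "w \<in> space M" "w \<notin> N" for t w using that by (simp add: f0_def)
  have AE_N: "AE w in M. w \<in> space M \<and> w \<notin> N" using AE_not_in[OF N(1)] AE_space by eventually_elim simp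
  have fm: "f t \<in> borel_measurable M" for t
    using g by (auto simp: gaussian_process_def gaussian_vector_def dest: spec[of _ "{t}"])
  have set: "{w \<in> space M. w \<in> space M - N} \<in> sets M"
  proof -
    have "{w \<in> space M. w \<in> space M - N} = space M - N" by auto
    then show ?thesis using N(1) by auto
  qed
  have f0m: "f0 t \<in> borel_measurable M" for t
    unfolding f0_def by (rule measurable_If[OF fm _ set]) simp
  have C: "class_C k (\<lambda>t. f0 t w)" for w
  proof (cases "w \<in> space M - N")
    case True
    then show ?thesis using N(2) by (auto simp: f0_def)
  next
    case False
    show ?thesis unfolding f0_def if_not_P[OF False] by (rule class_C_zero)
  qed
  have g0: "gaussian_process M f0"
    unfolding gaussian_process_def gaussian_vector_def
  proof (intro allI impI conjI ballI f0m)
    fix J :: "real set" and c :: "real \<Rightarrow> real" assume J: "finite J"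
    have "distr M borel (\<lambda>w. \<Sum>j\<in>J. c j * f0 j w) = distr M borel (\<lambda>w. \<Sum>j\<in>J. c j * f j w)"
    proof (rule distr_cong_AE)
      show "AE w in M. (\<Sum>j\<in>J. c j * f0 j w) = (\<Sum>j\<in>J. c j * f j w)" using AE_N by eventually_elim (simp add: eq)
      show "(\<lambda>w. \<Sum>j\<in>J. c j * f0 j w) \<in> borel_measurable M" "(\<lambda>w. \<Sum>j\<in>J. c j * f j w) \<in> borel_measurable M"
        by (intro borel_measurable_sum borel_measurable_times borel_measurable_const fm f0m)+
    qed auto
    then show "\<exists>m s. 0 \<le> s \<and> distr M borel (\<lambda>w. \<Sum>j\<in>J. c j * f0 j w) = normal_law m s"
      using g J unfolding gaussian_process_def gaussian_vector_def by metis
  qed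
  have cp0: "centered_process M f0"
    unfolding centered_process_def
  proof
    fix t
    have "(\<integral>w. f0 t w \<partial>M) = (\<integral>w. f t w \<partial>M)"
      by (rule integral_cong_AE[OF f0m fm]) (use AE_N in \<open>eventually_elim, simp add: eq\<close>)
    then show "(\<integral>w. f0 t w \<partial>M) = 0" using cp by (simp add: centered_process_def)
  qed
  define H0 where "H0 = {Y. \<exists>J c. finite J \<and> Y = (\<lambda>w. \<Sum>t\<in>J. c t * f0 t w)}"
  have H0: "gaussian_space M H0" unfolding H0_def by (rule gaussian_space_span[OF P g0 cp0])
  \<comment> \<open>Level \<open>i\<close> contains the derivatives of order up to \<open>i\<close>;
    the spaces increase, so level \<open>k\<close> contains all those that are needed.\<close>
  define Hs where "Hs = rec_nat H0 (\<lambda>_ K. gaussian_space.pointwise_closure K)"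
  have Hs0: "Hs 0 = H0" and HsS: "Hs (Suc i) = gaussian_space.pointwise_closure (Hs i)" for i by (simp_all add: Hs_def)
  have Hg: "gaussian_space M (Hs i)" for i
    by (induction i) (auto simp: Hs0 HsS H0 gaussian_space.gaussian_space_pointwise_closure)
  have Hsub: "Hs i \<subseteq> Hs (Suc i)" for i
    unfolding HsS by (rule gaussian_space.pointwise_closure_superset[OF Hg])
  have Hmono: "i \<le> j \<Longrightarrow> Hs i \<subseteq> Hs j" for i j by (rule lift_Suc_mono_le[of Hs, OF Hsub])
  have dF: "((\<lambda>s. process_deriv f0 i s w) has_real_derivative process_deriv f0 (Suc i) t w) (at t)" if "i < k" for i t w
    unfolding process_deriv_def using class_C_deriv[OF C that] by simp
  have F: "process_deriv f0 i t \<in> Hs i" if "i \<le> k" for i t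
    using that
  proof (induction i arbitrary: t)
    case 0
    have "(\<lambda>w. \<Sum>s\<in>{t}. 1 * f0 s w) = process_deriv f0 0 t" by (simp add: process_deriv_def fun_eq_iff)
    moreover have "(\<lambda>w. \<Sum>s\<in>{t}. 1 * f0 s w) \<in> H0"
      unfolding H0_def by (intro CollectI exI[of _ "{t}"] exI[of _ "\<lambda>_. 1"]) simp
    ultimately show ?case by (simp add: Hs0)
  next
    case (Suc i)
    interpret K: gaussian_space M "Hs i" by (rule Hg)
    define h where "h n = 1 / real (Suc n)" for n
    have h: "h \<longlonglongrightarrow> 0" "\<And>n. h n > 0"
      unfolding h_def using LIMSEQ_inverse_real_of_nat by (simp_all add: inverse_eq_divide)
    show ?case unfolding HsS
    proof (rule K.pointwise_closureI)
      show "(\<lambda>w. (1 / h n) * process_deriv f0 i (t + h n) w + (- 1 / h n) * process_deriv f0 i t w) \<in> Hs i" for n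
        using Suc by (intro K.lincomb_mem) auto
      fix w
      have "((\<lambda>y. (process_deriv f0 i y w - process_deriv f0 i t w) / (y - t)) \<longlongrightarrow> process_deriv f0 (Suc i) t w) (at t)"
        using dF[of i w t] Suc.prems by (simp add: has_field_derivative_iff)
      moreover have "filterlim (\<lambda>n. t + h n) (at t) sequentially"
        unfolding filterlim_at using tendsto_add[OF tendsto_const[of t] h(1)] h(2) by (auto simp: less_imp_neq[symmetric])
      ultimately have "(\<lambda>n. (process_deriv f0 i (t + h n) w - process_deriv f0 i t w) / (t + h n - t)) \<longlonglongrightarrow> process_deriv f0 (Suc i) t w"
        by (rule filterlim_compose)
      then show "(\<lambda>n. (1 / h n) * process_deriv f0 i (t + h n) w + (- 1 / h n) * process_deriv f0 i t w) \<longlonglongrightarrow> process_deriv f0 (Suc i) t w"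
        by (simp add: diff_divide_distrib)
    qed
  qed
  have unit: "inner_rv M (f0 t) (f0 t) = 1" for t
  proof -
    have "inner_rv M (f0 t) (f0 t) = inner_rv M (f t) (f t)"
      unfolding inner_rv_def
      by (rule integral_cong_AE) (use AE_N f0m fm in \<open>auto simp: eq elim: eventually_mono\<close>)
    then show ?thesis using stationary_second_moment[OF P g st] nm by (simp add: normalized_process_def)
  qed
  have "smooth_process M (Hs k) (process_deriv f0) k"
    unfolding smooth_process_def smooth_process_axioms_def
  proof (intro conjI allI impI Hg k dF)
    show "process_deriv f0 i t \<in> Hs k" if "i \<le> k" for i t using F[OF that] Hmono[OF that] by blast
    show "continuous_on UNIV (\<lambda>s. process_deriv f0 i s w)" if "i \<le> k" for i w
      unfolding process_deriv_def using class_C_continuous[OF C that] by simp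
    show "inner_rv M (process_deriv f0 0 t) (process_deriv f0 0 t) = 1" for t
      using unit by (simp add: process_deriv_def[abs_def])
  qed
  with N(1) eq show ?thesis by (rule that)
qed

section \<open>Convergence of the rescaled \<open>k\<close>-point function\<close>

text \<open>Neighbourhoods of \<open>y\<close> in a metric space have a countable base, so a failure
  of convergence is witnessed by a sequence inside \<open>S\<close>.\<close>

lemma tendsto_within_sequentially:
  fixes g :: "'a :: metric_space \<Rightarrow> real"
  assumes "\<And>X. (\<And>n. X n \<in> S) \<Longrightarrow> X \<longlonglongrightarrow> y \<Longrightarrow> (\<lambda>n. g (X n)) \<longlonglongrightarrow> L"
  shows "(g \<longlongrightarrow> L) (inf (nhds y) (principal S))"
proof (rule tendstoI, rule ccontr)
  fix e :: real assume e: "e > 0" and "\<not> eventually (\<lambda>x. dist (g x) L < e) (inf (nhds y) (principal S))"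
  then have "\<forall>d>0. \<exists>x. dist x y < d \<and> x \<in> S \<and> \<not> dist (g x) L < e"
    by (auto simp: eventually_inf_principal eventually_nhds_metric)
  then have "\<forall>n. \<exists>x. dist x y < 1 / real (Suc n) \<and> x \<in> S \<and> \<not> dist (g x) L < e" by simp
  then obtain X where X: "\<And>n. dist (X n) y < 1 / real (Suc n)" "\<And>n. X n \<in> S" "\<And>n. \<not> dist (g (X n)) L < e" by metis
  have z: "(\<lambda>n. 1 / real (Suc n)) \<longlonglongrightarrow> 0"
    using LIMSEQ_inverse_real_of_nat by (simp add: inverse_eq_divide)
  have "(\<lambda>n. dist (X n) y) \<longlonglongrightarrow> 0"
    by (rule tendsto_sandwich[OF _ _ tendsto_const z]) (auto intro!: always_eventually less_imp_le[OF X(1)] simp del: of_nat_Suc)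
  then have "X \<longlonglongrightarrow> y" by (subst tendsto_dist_iff)
  then have "(\<lambda>n. g (X n)) \<longlonglongrightarrow> L" by (rule assms[OF X(2)])
  then have "eventually (\<lambda>n. dist (g (X n)) L < e) sequentially" using e by (rule tendstoD)
  then show False using X(3) by (auto simp: eventually_sequentially)
qed

theorem theorem1p13:
  fixes M :: "'w measure"
    and f :: "real \<Rightarrow> 'w \<Rightarrow> real"
    and y :: "real ^ 'n :: {finite, linorder}"
  assumes "prob_space M"
    and "gaussian_process M f"
    and "centered_process M f"
    and "stationary_process M f"
    and "process_of_class M CARD('n) f"
    and "normalized_process M f"
    and "nondegenerate M (jet f y card)"
  shows "(\<exists>U. open U \<and> y \<in> U \<and>
           (\<forall>x \<in> U - large_diagonal. kpoint_defined M f x) \<and>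
           ((\<lambda>x. (\<Prod>I\<in>blocks y. \<Prod>(i, j)\<in>{(i, j). i \<in> I \<and> j \<in> I \<and> i < j}. 1 / \<bar>x $ i - x $ j\<bar>)
                  * kpoint_function M f x)
             \<longlongrightarrow> ell M f y) (inf (nhds y) (principal (U - large_diagonal)))) \<and>
         (nondegenerate M (jet f y (\<lambda>I. card I + 1)) \<longrightarrow> ell M f y > 0)"
proof -
  define k where "k = CARD('n)"
  have k: "k > 0" by (simp add: k_def)
  \<comment> \<open>From here on the smooth version carries the argument; it agrees with
    \<open>f\<close> off the null set \<open>N\<close>.\<close>
  obtain N f0 H where N: "N \<in> null_sets M" and f0: "\<And>t w. w \<in> space M \<Longrightarrow> w \<notin> N \<Longrightarrow> f0 t w = f t w"
    and sp: "smooth_process M H (process_deriv f0) k"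
    using smooth_version[OF assms(1-4) assms(5)[folded k_def] assms(6) k] by blast
  define F where "F = process_deriv f0"
  interpret SP: smooth_process M H F k unfolding F_def by (rule sp)
  have AE_N: "AE w in M. w \<in> space M \<and> w \<notin> N" using AE_not_in[OF N] AE_space by eventually_elim simp
  have Feq: "AE w in M. process_deriv f i t w = F i t w" for i t
    using AE_N by eventually_elim (simp add: F_def process_deriv_def f0)
  define e where "e = enum_block y"
  define ps where "ps = block_pairs y"
  \<comment> \<open>\<open>yy\<close> lists the coordinates of \<open>y\<close> block by block, so
    that index \<open>a\<close> corresponds to entry \<open>a\<close> of the jet list.\<close>
  define yy where "yy a = y $ e a" for a
  have len: "length ps = k" by (simp add: ps_def k_def length_block_pairs)
  have ebij: "bij_betw e {..<k} UNIV" unfolding e_def k_def by (rule bij_betw_enum_block)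
  define X where "X a = F (card {l. l < a \<and> yy l = yy a}) (yy a)" for a
  have ps_fst: "fst (ps ! a) \<in> blocks y" "snd (ps ! a) < card (fst (ps ! a))" "block_value y (fst (ps ! a)) = yy a" if "a < k" for a
    using block_pairs_nth[of a y] that by (auto simp: ps_def yy_def e_def k_def)
  have idx: "card {l. l < a \<and> yy l = yy a} = snd (ps ! a)" if "a < k" for a
    using enum_block_index[of a y] that by (simp add: ps_def yy_def e_def k_def)
  have siz: "card {l. l < k \<and> yy l = yy a} = card (fst (ps ! a))" if "a < k" for a
    using enum_block_size[of a y] that by (simp add: ps_def yy_def e_def k_def)
  have cardk: "card I \<le> k" for I :: "'n set" unfolding k_def by (rule card_mono) auto
  have XH: "X a \<in> H" if "a < k" for a
    unfolding X_def idx[OF that] using ps_fst(2)[OF that] cardk[of "fst (ps ! a)"] by (intro SP.F_mem) simp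
  have jet_len: "length (jet f y card) = k" by (simp add: jet_eq_pairs len[unfolded ps_def block_pairs_def])
  have jet_nth: "AE w in M. (jet f y card ! a) w = X a w" if "a < k" for a
  proof -
    have "jet f y card ! a = process_deriv f (snd (ps ! a)) (yy a)"
      using that len ps_fst(3)[OF that] by (simp add: jet_eq_pairs ps_def block_pairs_def case_prod_beta')
    then show ?thesis using Feq by (simp add: X_def idx[OF that])
  qed
  have VU: "var_mat M (jet f y card) = SP.gram k X k X"
    unfolding var_mat_def
    using SP.cov_mat_gram[of "jet f y card" X "jet f y card" X] XH jet_nth by (simp add: jet_len)
  have inv: "invertible_mat (SP.gram k X k X)" using assms(7) by (simp add: nondegenerate_def VU)
  obtain m where m: "SP.frame k m X"
    using SP.frame_exists[of k X, OF XH SP.gram_nondegenerate[OF XH inv]] by blast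
  interpret C: confluence M H F k yy m
    using m unfolding X_def by unfold_locales
  have CX: "C.jets = X" by (simp add: C.jets_def[abs_def] C.pos_def X_def[abs_def])
  have Cpos: "C.pos a = snd (ps ! a)" and Csiz: "C.bsize a = card (fst (ps ! a))" if "a < k" for a
    using idx[OF that] siz[OF that] by (simp_all add: C.pos_def C.bsize_def C.block_def)
  have inj: "inj_on (\<lambda>a. x $ e a) {..<k}" if "x \<notin> large_diagonal" for x :: "(real, 'n) Finite_Cartesian_Product.vec"
  proof (rule inj_onI)
    fix a b assume "a \<in> {..<k}" "b \<in> {..<k}" "x $ e a = x $ e b"
    moreover have "e a = e b" using that \<open>x $ e a = x $ e b\<close> by (auto simp: large_diagonal_def)
    ultimately show "a = b" using ebij by (auto simp: bij_betw_def inj_on_def)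
  qed
  \<comment> \<open>The product over the index type is reindexed along \<open>e\<close>, and the
    zeros of \<open>f\<close> and of its version coincide almost surely.\<close>
  have quot: "kpoint_quotient M f x \<epsilon> =
      (\<integral>\<^sup>+w. (\<Prod>a<k. zero_count (F 0) {x $ e a - \<epsilon>..x $ e a + \<epsilon>} w) \<partial>M) / ennreal ((2 * \<epsilon>) ^ k)" for x :: "(real, 'n) Finite_Cartesian_Product.vec" and \<epsilon>
  proof -
    have "(\<integral>\<^sup>+w. (\<Prod>i\<in>UNIV. zero_count f {x $ i - \<epsilon>..x $ i + \<epsilon>} w) \<partial>M) =
        (\<integral>\<^sup>+w. (\<Prod>a<k. zero_count (F 0) {x $ e a - \<epsilon>..x $ e a + \<epsilon>} w) \<partial>M)"
    proof (rule nn_integral_cong_AE)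
      show "AE w in M. (\<Prod>i\<in>UNIV. zero_count f {x $ i - \<epsilon>..x $ i + \<epsilon>} w) =
          (\<Prod>a<k. zero_count (F 0) {x $ e a - \<epsilon>..x $ e a + \<epsilon>} w)"
        using AE_N
      proof eventually_elim
        fix w assume w: "w \<in> space M \<and> w \<notin> N"
        have "zero_count f A w = zero_count (F 0) A w" for A
          using w f0 by (simp add: zero_count_def F_def process_deriv_def)
        moreover have "(\<Prod>a<k. zero_count f {x $ e a - \<epsilon>..x $ e a + \<epsilon>} w) = (\<Prod>i\<in>UNIV. zero_count f {x $ i - \<epsilon>..x $ i + \<epsilon>} w)"
          by (rule prod.reindex_bij_betw[OF ebij])
        ultimately show "(\<Prod>i\<in>UNIV. zero_count f {x $ i - \<epsilon>..x $ i + \<epsilon>} w) =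
          (\<Prod>a<k. zero_count (F 0) {x $ e a - \<epsilon>..x $ e a + \<epsilon>} w)" by simp
      qed
    qed
    then show ?thesis by (simp add: kpoint_quotient_def k_def)
  qed
  have kac: "(kpoint_quotient M f x \<longlongrightarrow>
      ennreal (SP.crossing_const k A (\<lambda>a. F 0 (x $ e a)) (\<lambda>a. F 1 (x $ e a)))) (at_right 0)"
    if "SP.frame k A (\<lambda>a. F 0 (x $ e a))" for A and x :: "(real, 'n) Finite_Cartesian_Product.vec"
    using SP.kac_rice[OF that] by (simp add: quot[abs_def])
  \<comment> \<open>Uniqueness of the limit makes the value independent of the chosen frame, as
    \<open>confluent_limit\<close> requires.\<close>
  have kfun: "kpoint_function M f x = SP.crossing_const k A (\<lambda>a. F 0 (x $ e a)) (\<lambda>a. F 1 (x $ e a))"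
    if "SP.frame k A (\<lambda>a. F 0 (x $ e a))" for A and x :: "(real, 'n) Finite_Cartesian_Product.vec"
    unfolding kpoint_function_def using tendsto_Lim[OF trivial_limit_at_right_real kac[OF that]] SP.crossing_const_nonneg by simp
  obtain \<delta> where \<delta>: "\<delta> > 0" "\<And>x. inj_on x {..<k} \<Longrightarrow> (\<forall>j<k. \<bar>x j - yy j\<bar> < \<delta>) \<Longrightarrow> \<exists>A. SP.frame k A (\<lambda>j. F 0 (x j))"
    using C.frames_near by blast
  define U where "U = ball y \<delta>"
  have fr: "\<exists>A. SP.frame k A (\<lambda>a. F 0 (x $ e a))" if "x \<in> U - large_diagonal" for x
  proof (rule \<delta>(2))
    show "inj_on (\<lambda>a. x $ e a) {..<k}" using that by (intro inj) auto
    show "\<forall>j<k. \<bar>x $ e j - yy j\<bar> < \<delta>"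
    proof (intro allI impI)
      fix j
      have "dist (x $ e j) (y $ e j) \<le> dist x y" by (rule dist_vec_nth_le)
      also have "dist x y < \<delta>" using that by (simp add: U_def dist_commute)
      finally show "\<bar>x $ e j - yy j\<bar> < \<delta>" by (simp add: yy_def dist_real_def)
    qed
  qed
  \<comment> \<open>\<open>ell\<close> has one factor to the power \<open>|I|\<close> per block,
    \<open>confluent_const\<close> one factor per position; \<open>prod_pairs\<close> mediates
    between the two.\<close>
  have ell: "ell M f y = C.confluent_const"
  proof -
    define bl where "bl = block_list y"
    define n where "n = length bl"
    define V where "V b = F (card (bl ! b)) (block_value y (bl ! b))" for b
    define Vs where "Vs = map (\<lambda>I. process_deriv f (card I) (block_value y I)) bl"
    have VsL: "length Vs = n" by (simp add: Vs_def n_def)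
    have VH: "V b \<in> H" for b unfolding V_def by (rule SP.F_mem[OF cardk])
    have VA: "AE w in M. (Vs ! b) w = V b w" if "b < n" for b
      using that Feq by (simp add: Vs_def V_def n_def)
    have cVU: "cov_mat M Vs (jet f y card) = SP.gram n V k X"
      using SP.cov_mat_gram[of Vs V "jet f y card" X] VH VA XH jet_nth by (simp add: jet_len VsL)
    have cVV: "var_mat M Vs = SP.gram n V n V"
      unfolding var_mat_def using SP.cov_mat_gram[of Vs V Vs V] VH VA by (simp add: VsL)
    define R where "R I = SP.residual k (comb k m X) (F (card I) (block_value y I))" for I
    define E where "E = (\<integral>w. (\<Prod>b<n. \<bar>R (bl ! b) w\<bar> ^ card (bl ! b)) \<partial>M)"
    have Xf: "SP.orthonormal k (comb k m X)" using m by (simp add: SP.frame_def)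
    have rm: "(\<lambda>w. \<lambda>b\<in>{..<n}. SP.residual k (comb k m X) (V b) w) \<in> M \<rightarrow>\<^sub>M (\<Pi>\<^sub>M b\<in>{..<n}. borel)"
      by (rule measurable_restrict) (rule SP.meas[OF SP.residual_mem[OF Xf VH]])
    have cond: "gaussian_cond_expectation M (jet f y card) Vs (\<lambda>v. \<Prod>a<n. \<bar>v a\<bar> ^ card (bl ! a)) = E"
    proof -
      have hm: "(\<lambda>v. \<Prod>a<n. \<bar>v a\<bar> ^ card (bl ! a)) \<in> borel_measurable (\<Pi>\<^sub>M b\<in>{..<n}. (borel :: real measure))"
        by (intro borel_measurable_prod borel_measurable_power borel_measurable_abs measurable_component_singleton) 
      have "gaussian_cond_expectation M (jet f y card) Vs (\<lambda>v. \<Prod>a<n. \<bar>v a\<bar> ^ card (bl ! a)) =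
          (\<integral>v. (\<Prod>a<n. \<bar>v a\<bar> ^ card (bl ! a)) \<partial>distr M (\<Pi>\<^sub>M b\<in>{..<n}. borel)
            (\<lambda>w. \<lambda>b\<in>{..<n}. SP.residual k (comb k m X) (V b) w))"
        unfolding gaussian_cond_expectation_def Let_def VU cVU cVV SP.conditional_law[OF m VH] ..
      also have "\<dots> = E"
        unfolding E_def by (subst integral_distr[OF rm hm]) (simp add: R_def V_def)
      finally show ?thesis .
    qed
    have prodR: "(\<Prod>a<k. \<bar>SP.residual k (comb k m X) (F (C.bsize a) (yy a)) w\<bar>) = (\<Prod>b<n. \<bar>R (bl ! b) w\<bar> ^ card (bl ! b))" for w
    proof -
      have "(\<Prod>a<k. \<bar>SP.residual k (comb k m X) (F (C.bsize a) (yy a)) w\<bar>) = (\<Prod>a<k. (\<lambda>p. \<bar>R (fst p) w\<bar>) (ps ! a))"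
        by (rule prod.cong) (auto simp: R_def Csiz ps_fst(3))
      also have "\<dots> = (\<Prod>I\<in>blocks y. \<Prod>i<card I. \<bar>R I w\<bar>)"
        using prod_pairs[of "block_list y" "\<lambda>p. \<bar>R (fst p) w\<bar>" card] len by (simp add: ps_def block_pairs_def)
      also have "\<dots> = (\<Prod>I\<in>set bl. \<bar>R I w\<bar> ^ card I)" by (simp add: bl_def)
      also have "\<dots> = (\<Prod>b<n. \<bar>R (bl ! b) w\<bar> ^ card (bl ! b))"
        by (rule prod.reindex_bij_betw[symmetric, OF bij_betw_nth]) (simp_all add: bl_def n_def)
      finally show ?thesis .
    qed
    have prodF: "(\<Prod>a<k. fact (C.pos a) / fact (C.bsize a)) = (\<Prod>I\<in>blocks y. \<Prod>i<card I. fact i / fact (card I) :: real)"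
    proof -
      have "(\<Prod>a<k. fact (C.pos a) / fact (C.bsize a)) = (\<Prod>a<k. (\<lambda>p. fact (snd p) / fact (card (fst p)) :: real) (ps ! a))"
        by (rule prod.cong) (auto simp: Cpos Csiz)
      also have "\<dots> = (\<Prod>I\<in>blocks y. \<Prod>i<card I. fact i / fact (card I) :: real)"
        using prod_pairs[of "block_list y" "\<lambda>p. fact (snd p) / fact (card (fst p)) :: real" card] len
        by (simp add: ps_def block_pairs_def)
      finally show ?thesis .
    qed
    have mpos: "(\<Prod>a<k. \<bar>m a a\<bar>) > 0"
      using m by (intro prod_pos) (auto simp: SP.frame_def lower_triangular_def)
    have det: "sqrt (Determinant.det (SP.gram k X k X)) = 1 / (\<Prod>a<k. \<bar>m a a\<bar>)"
    proof -
      have "(\<Prod>a<k. m a a)\<^sup>2 = (\<Prod>a<k. \<bar>m a a\<bar>)\<^sup>2" by (metis abs_prod power2_abs)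
      moreover have "D = (1 / q)\<^sup>2" if "D * q\<^sup>2 = 1" "q > 0" for D q :: real
        using that by (simp add: power_divide field_simps)
      ultimately have "Determinant.det (SP.gram k X k X) = (1 / (\<Prod>a<k. \<bar>m a a\<bar>))\<^sup>2"
        using SP.det_gram_frame[OF m] mpos by metis
      then show ?thesis using mpos by simp
    qed
    have pow: "(2 * pi) powr (real CARD('n) / 2) = sqrt (2 * pi) ^ k"
      by (simp add: k_def powr_half_sqrt[symmetric] powr_realpow[symmetric] powr_powr)
    have "ell M f y = (\<Prod>I\<in>blocks y. \<Prod>i<card I. fact i / fact (card I)) * (E / (sqrt (2 * pi) ^ k * (1 / (\<Prod>a<k. \<bar>m a a\<bar>))))"
      unfolding ell_def pow VU det cond[unfolded Vs_def n_def bl_def] ..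
    also have "\<dots> = C.confluent_const"
      by (simp add: C.confluent_const_def CX prodR prodF E_def power_divide)
    finally show ?thesis .
  qed
  have lim: "((\<lambda>x. (\<Prod>I\<in>blocks y. \<Prod>(i, j)\<in>{(i, j). i \<in> I \<and> j \<in> I \<and> i < j}. 1 / \<bar>x $ i - x $ j\<bar>) * kpoint_function M f x)
             \<longlongrightarrow> ell M f y) (inf (nhds y) (principal (U - large_diagonal)))"
  proof (rule tendsto_within_sequentially)
    fix Z assume Z: "\<And>n. Z n \<in> U - large_diagonal" "Z \<longlonglongrightarrow> y"
    have "(\<lambda>n. kpoint_function M f (Z n) / C.vandermonde (\<lambda>a. Z n $ e a)) \<longlonglongrightarrow> C.confluent_const"
    proof (rule C.confluent_limit)
      show "inj_on (\<lambda>a. Z n $ e a) {..<k}" for n using Z(1) by (intro inj) auto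
      show "(\<lambda>n. Z n $ e j) \<longlonglongrightarrow> yy j" for j unfolding yy_def by (rule tendsto_vec_nth[OF Z(2)])
      show "kpoint_function M f (Z n) = SP.crossing_const k A (\<lambda>j. F 0 (Z n $ e j)) (\<lambda>j. F 1 (Z n $ e j))"
        if "SP.frame k A (\<lambda>j. F 0 (Z n $ e j))" for n A by (rule kfun[OF that])
    qed
    moreover have "(\<Prod>I\<in>blocks y. \<Prod>(i, j)\<in>{(i, j). i \<in> I \<and> j \<in> I \<and> i < j}. 1 / \<bar>x $ i - x $ j\<bar>) = 1 / C.vandermonde (\<lambda>a. x $ e a)"
      for x :: "(real, 'n) Finite_Cartesian_Product.vec"
      unfolding C.vandermonde_def unfolding yy_def e_def k_def by (rule prod_block_differences)
    ultimately show "(\<lambda>n. (\<Prod>I\<in>blocks y. \<Prod>(i, j)\<in>{(i, j). i \<in> I \<and> j \<in> I \<and> i < j}. 1 / \<bar>Z n $ i - Z n $ j\<bar>) * kpoint_function M f (Z n))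
        \<longlonglongrightarrow> ell M f y"
      by (simp add: ell)
  qed
  \<comment> \<open>If the jets up to order \<open>|I|\<close> are non-degenerate, no residual has
    variance 0, so the integrand of the constant is almost surely positive.\<close>
  have pos: "ell M f y > 0" if nd: "nondegenerate M (jet f y (\<lambda>I. card I + 1))"
  proof -
    define js where "js = jet f y (\<lambda>I. card I + 1)"
    define qs where "qs = pairs (block_list y) (\<lambda>I. card I + 1)"
    define Y where "Y p = F (snd p) (block_value y (fst p))" for p :: "'n set \<times> nat"
    have qset: "set qs = (SIGMA I:blocks y. {..<card I + 1})" by (simp add: qs_def set_pairs)
    have YH: "Y p \<in> H" if "p \<in> set qs" for p
    proof -
      have "snd p \<le> card (fst p)" using that by (auto simp: qset)
      then show ?thesis unfolding Y_def using cardk[of "fst p"] by (intro SP.F_mem) simp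
    qed
    have YnH: "Y (qs ! a) \<in> H" if "a < length qs" for a using that by (intro YH) simp
    have jl: "length js = length qs" by (simp add: js_def jet_eq_pairs qs_def)
    have jn: "AE w in M. (js ! a) w = Y (qs ! a) w" if "a < length qs" for a
      using that Feq by (simp add: js_def jet_eq_pairs qs_def Y_def case_prod_beta')
    have "var_mat M js = SP.gram (length qs) (\<lambda>a. Y (qs ! a)) (length qs) (\<lambda>a. Y (qs ! a))"
      unfolding var_mat_def
      using SP.cov_mat_gram[of js "\<lambda>a. Y (qs ! a)" js "\<lambda>a. Y (qs ! a)"] YnH jn
      by (simp add: jl)
    then have qinv: "invertible_mat (SP.gram (length qs) (\<lambda>a. Y (qs ! a)) (length qs) (\<lambda>a. Y (qs ! a)))"
      using nd by (simp add: nondegenerate_def js_def)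
    have bq: "bij_betw ((!) qs) {..<length qs} (set qs)"
      by (rule bij_betw_nth) (simp_all add: qs_def distinct_pairs)
    have bp: "bij_betw ((!) ps) {..<k} (set ps)"
      by (rule bij_betw_nth) (simp_all add: ps_def distinct_block_pairs len[unfolded ps_def])
    have pset: "set ps = (SIGMA I:blocks y. {..<card I})" by (simp add: ps_def block_pairs_def set_pairs)
    define R where "R a = SP.residual k (comb k m X) (F (C.bsize a) (yy a))" for a
    have Xf: "SP.orthonormal k (comb k m X)" using m by (simp add: SP.frame_def)
    have RH: "R a \<in> H" for a unfolding R_def by (rule SP.residual_mem[OF Xf SP.F_mem[OF C.bsize_le]])
    have Rnz: "inner_rv M (R a) (R a) \<noteq> 0" if a: "a < k" for a
    proof -
      \<comment> \<open>The additional jet of the block of \<open>a\<close>, of order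
        \<open>|I|\<close>; it occurs in \<open>qs\<close> but not in \<open>ps\<close>.\<close>
      define p0 where "p0 = (fst (ps ! a), card (fst (ps ! a)))"
      define K where "K b = (\<Sum>j<k. inner_rv M (F (C.bsize a) (yy a)) (comb k m X j) * m j b)" for b
      define K' where "K' p = K (the_inv_into {..<k} ((!) ps) p)" for p
      \<comment> \<open>The coefficients express the residual in the enlarged jet list; the
        coefficient 1 at \<open>p0\<close> makes the combination nontrivial.\<close>
      define c where "c p = (if p = p0 then 1 else if p \<in> set ps then - K' p else 0)" for p
      have p0: "p0 \<in> set qs" "p0 \<notin> set ps" using ps_fst(1)[OF a] by (auto simp: p0_def qset pset)
      have sub: "set ps \<subseteq> set qs" by (auto simp: pset qset)
      have Req: "R a = (\<lambda>w. \<Sum>i<length qs. c (qs ! i) * Y (qs ! i) w)"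
      proof
        fix w
        have V: "F (C.bsize a) (yy a) w = Y p0 w" using a by (simp add: Y_def p0_def Csiz ps_fst(3))
        have "(\<Sum>b<k. K b * X b w) = (\<Sum>b<k. (\<lambda>p. K' p * Y p w) (ps ! b))"
        proof (rule sum.cong)
          fix b assume "b \<in> {..<k}"
          then have b: "b < k" by simp
          have "X b = Y (ps ! b)" by (simp add: X_def Y_def idx[OF b] ps_fst(3)[OF b])
          moreover have "K' (ps ! b) = K b"
            using the_inv_into_f_f[of "(!) ps" "{..<k}" b] bp b by (simp add: K'_def bij_betw_def)
          ultimately show "K b * X b w = (\<lambda>p. K' p * Y p w) (ps ! b)" by simp
        qed simp
        also have "\<dots> = (\<Sum>p\<in>set ps. K' p * Y p w)" by (rule sum.reindex_bij_betw[OF bp])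
        finally have KX: "(\<Sum>b<k. K b * X b w) = (\<Sum>p\<in>set ps. K' p * Y p w)" .
        have "(\<Sum>i<length qs. c (qs ! i) * Y (qs ! i) w) = (\<Sum>p\<in>set qs. c p * Y p w)"
          by (rule sum.reindex_bij_betw[OF bq])
        also have "\<dots> = (\<Sum>p\<in>insert p0 (set ps). c p * Y p w)"
          by (rule sum.mono_neutral_right) (use p0 sub in \<open>auto simp: c_def\<close>)
        also have "\<dots> = Y p0 w + (\<Sum>p\<in>set ps. c p * Y p w)" using p0(2) by (simp add: c_def)
        also have "(\<Sum>p\<in>set ps. c p * Y p w) = (\<Sum>p\<in>set ps. - (K' p * Y p w))"
          by (rule sum.cong) (use p0(2) in \<open>auto simp: c_def\<close>)
        also have "\<dots> = - (\<Sum>b<k. K b * X b w)" by (simp add: KX sum_negf)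
        finally show "R a w = (\<Sum>i<length qs. c (qs ! i) * Y (qs ! i) w)"
          by (simp add: R_def SP.residual_frame_expand K_def V[symmetric])
      qed
      obtain i where i: "i < length qs" "qs ! i = p0" using p0(1) by (metis in_set_conv_nth)
      show ?thesis
        unfolding Req
        by (rule SP.gram_nondegenerate[OF YnH qinv]) (use i in \<open>auto simp: c_def intro!: exI[of _ i]\<close>)
    qed
    define I where "I = (\<integral>w. (\<Prod>a<k. \<bar>R a w\<bar>) \<partial>M)"
    have int: "integrable M (\<lambda>w. \<Prod>a<k. \<bar>R a w\<bar>)" by (rule SP.nn_integral_abs_prod(1)[OF SP.gauss[OF RH]])
    have "I \<noteq> 0"
    proof
      assume "I = 0"
      then have "AE w in M. (\<Prod>a<k. \<bar>R a w\<bar>) = 0"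
        using integral_nonneg_eq_0_iff_AE[OF int] by (simp add: I_def prod_nonneg)
      moreover have "AE w in M. \<forall>a\<in>{..<k}. R a w \<noteq> 0"
        by (intro AE_finite_allI SP.AE_nonzero RH Rnz) auto
      ultimately have "AE w in M. False" by eventually_elim (auto simp: prod_zero_iff)
      then show False by (simp add: SP.AE_const)
    qed
    moreover have "I \<ge> 0" unfolding I_def by (intro Bochner_Integration.integral_nonneg prod_nonneg) auto
    ultimately have Ip: "I > 0" by simp
    have mpos: "(\<Prod>a<k. \<bar>m a a\<bar>) > 0"
      using m by (intro prod_pos) (auto simp: SP.frame_def lower_triangular_def)
    have "(\<Prod>a<k. fact (C.pos a) / fact (C.bsize a) :: real) > 0" by (intro prod_pos) auto
    then show ?thesis
      unfolding ell C.confluent_const_def CX using Ip mpos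
      by (intro mult_pos_pos) (auto simp: I_def R_def)
  qed
  have def: "kpoint_defined M f x" if x: "x \<in> U - large_diagonal" for x
  proof -
    obtain A where "SP.frame k A (\<lambda>a. F 0 (x $ e a))" using fr[OF x] by blast
    from kac[OF this] show ?thesis
      unfolding kpoint_defined_def using SP.crossing_const_nonneg by blast
  qed
  have "open U" "y \<in> U" using \<delta>(1) by (auto simp: U_def)
  with lim def pos show ?thesis by blast
qed

end
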